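(* The lattice $\mathscr{S_\infty PL}$ is both upper dense and lower dense in the lattice $\mathscr{PL}$. That is: (upper density) whenever $I\in\mathscr{S_\infty PL}$, $J\in\mathscr{PL}$ and $I\subsetneq J$, there is $L\in\mathscr{S_\infty PL}$ with $I\subsetneq L\subsetneq J$; and (lower density) whenever $I\in\mathscr{S_\infty PL}$, $J\in\mathscr{PL}$ and $J\subsetneq I$, there is $L\in\mathscr{S_\infty PL}$ with $J\subsetneq L\subsetneq I$.
   Context: $H$ is a separable infinite-dimensional complex Hilbert space. "Ideal" means a two-sided ideal of $B(H)$ contained in the compact operators $K(H)$. $c_o^*$ is the set of nonnegative monotone nonincreasing sequences converging to $0$, and $(\ell^1)^*$ is the set of summable sequences in $c_o^*$. For a compact operator $X$, $s(X)\in c_o^*$ is its sequence of s-numbers (singular values, with multiplicity), and $\Sigma(I):=\{s(X)\mid X\in I\}$ is the characteristic set of the ideal $I$; $I\mapsto\Sigma(I)$ is an inclusion-preserving bijection between ideals and the hereditary (solid) subcones of $c_o^*$ invariant under all ampliations $D_m$, where $(D_m\xi)_n:=\xi_{\lceil n/m\rceil}$, $m\in\mathbb N$. For $\xi\in c_o^*$, $(\xi)$ denotes the principal ideal generated by the diagonal operator $\mathrm{diag}\,\xi$; every principal ideal has this form, and $\eta\in\Sigma((\xi))$ if and only if $\eta=O(D_m\xi)$ for some $m\in\mathbb N$. $\mathscr L_1$ is the trace class. For $\xi\in(\ell^1)^*$ put $(\xi_{a_\infty})_n:=\frac1n\sum_{j=n+1}^\infty\xi_j$. For an ideal $I$, ${}_{a_\infty}I$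 is the ideal with $\Sigma({}_{a_\infty}I)=\{\xi\in(\ell^1)^*\mid \xi_{a_\infty}\in\Sigma(I)\}$ and $I_{a_\infty}$ is the ideal with $\Sigma(I_{a_\infty})=\{\xi\in c_o^*\mid \xi=O(\eta_{a_\infty})\text{ for some }\eta\in\Sigma(I\cap\mathscr L_1)\}$. $I$ is am-$\infty$ stable if $I={}_{a_\infty}I$ (equivalently, $I\subset\mathscr L_1$ and $I=I_{a_\infty}$). A principal ideal $(\xi)$ is am-$\infty$ stable if and only if $\xi$ is summable and $\infty$-regular, i.e., $\xi_{a_\infty}=O(\xi)$. $\mathscr{PL}$ is the lattice (under inclusion, with meet $\cap$ and join $+$) of all nonzero principal ideals, and $\mathscr{S_\infty PL}$ is its sublattice of all nonzero am-$\infty$ stable principal ideals. *)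

theory Defs
  imports "HOL-Analysis.Analysis"
begin

(* The real Hilbert space structure (inner, norm, topology, completeness) of the
   library is kept, with inner = Re cinner; cinner is linear in its first argument.
   Definiteness of cinner and the unit law for scaleC are inherited from the real
   structure. *)
class complex_hilbert = banach + real_inner +
  fixes scaleC :: "complex \<Rightarrow> 'a \<Rightarrow> 'a" (infixr "*\<^sub>C" 75)
    and cinner :: "'a \<Rightarrow> 'a \<Rightarrow> complex"
  assumes scaleC_add_right: "c *\<^sub>C (x + y) = c *\<^sub>C x + c *\<^sub>C y"
    and scaleC_add_left: "(c + d) *\<^sub>C x = c *\<^sub>C x + d *\<^sub>C x"
    and scaleC_scaleC: "c *\<^sub>C d *\<^sub>C x = (c * d) *\<^sub>C x"
    and scaleR_scaleC: "r *\<^sub>R x = complex_of_real r *\<^sub>C x"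
    and cinner_commute: "cinner x y = cnj (cinner y x)"
    and cinner_add_left: "cinner (x + y) z = cinner x z + cinner y z"
    and cinner_scaleC_left: "cinner (c *\<^sub>C x) y = c * cinner x y"
    and inner_eq_Re_cinner: "inner x y = Re (cinner x y)"

global_interpretation complex_vector: vector_space "scaleC :: complex \<Rightarrow> 'a \<Rightarrow> 'a::complex_hilbert"
proof
  fix x :: 'a
  show "1 *\<^sub>C x = x"
    using scaleR_scaleC [of 1 x] by simp
qed (simp_all add: scaleC_add_right scaleC_add_left scaleC_scaleC)

definition separable_hilbert :: "'h::complex_hilbert itself \<Rightarrow> bool" where
  "separable_hilbert _ \<longleftrightarrow> (\<exists>D :: 'h set. countable D \<and> closure D = UNIV)"

definition infinite_dim_hilbert :: "'h::complex_hilbert itself \<Rightarrow> bool" where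
  "infinite_dim_hilbert _ \<longleftrightarrow> \<not> (\<exists>B :: 'h set. finite B \<and> complex_vector.span B = UNIV)"


definition bounded_ops :: "('h::complex_hilbert \<Rightarrow> 'h) set" where
  "bounded_ops = {X. bounded_linear X \<and> (\<forall>c x. X (c *\<^sub>C x) = c *\<^sub>C X x)}"

definition compact_ops :: "('h::complex_hilbert \<Rightarrow> 'h) set" where
  "compact_ops = {X \<in> bounded_ops. compact (closure (X ` cball 0 1))}"

definition cadjoint :: "('h::complex_hilbert \<Rightarrow> 'h) \<Rightarrow> ('h \<Rightarrow> 'h)" where
  "cadjoint X = (THE Y. \<forall>x y. cinner (X x) y = cinner x (Y y))"


(* Sequences are indexed from 0: \<xi> n is the term with index n + 1 in the usual
   indexing from 1. *)
definition c0_star :: "(nat \<Rightarrow> real) set" where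
  "c0_star = {\<xi>. (\<forall>n. 0 \<le> \<xi> n) \<and> decseq \<xi> \<and> \<xi> \<longlonglongrightarrow> 0}"

definition l1_star :: "(nat \<Rightarrow> real) set" where
  "l1_star = {\<xi> \<in> c0_star. summable \<xi>}"

(* (1/N) * (sum of the terms with index > N), where N = n + 1 in the indexing from 1. *)
definition am_inf :: "(nat \<Rightarrow> real) \<Rightarrow> (nat \<Rightarrow> real)" where
  "am_inf \<xi> n = (\<Sum>j. \<xi> (j + Suc n)) / real (Suc n)"

(* For compact X: each t > 0 is listed as often as the multiplicity of t^2 as an
   eigenvalue of X* X; zeros are appended iff X has finite rank. The multiplicity is
   a (finite) complex dimension. *)
definition s_numbers :: "('h::complex_hilbert \<Rightarrow> 'h) \<Rightarrow> (nat \<Rightarrow> real)" where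
  "s_numbers X = (THE s. s \<in> c0_star \<and>
     (\<forall>t>0. card {n. s n = t} =
        complex_vector.dim {v. cadjoint X (X v) = complex_of_real (t\<^sup>2) *\<^sub>C v}))"


definition op_ideal :: "('h::complex_hilbert \<Rightarrow> 'h) set \<Rightarrow> bool" where
  "op_ideal I \<longleftrightarrow> I \<subseteq> compact_ops \<and> (\<lambda>x. 0) \<in> I \<and>
     (\<forall>X\<in>I. \<forall>Y\<in>I. (\<lambda>x. X x + Y x) \<in> I) \<and>
     (\<forall>X\<in>I. \<forall>A\<in>bounded_ops. A \<circ> X \<in> I \<and> X \<circ> A \<in> I)"

definition char_set :: "('h::complex_hilbert \<Rightarrow> 'h) set \<Rightarrow> (nat \<Rightarrow> real) set" where
  "char_set I = s_numbers ` I"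

(* Inverse of the bijection between ideals and characteristic sets. *)
definition ideal_of_char_set :: "(nat \<Rightarrow> real) set \<Rightarrow> ('h::complex_hilbert \<Rightarrow> 'h) set" where
  "ideal_of_char_set S = (THE J. op_ideal J \<and> char_set J = S)"

definition pre_am_inf :: "('h::complex_hilbert \<Rightarrow> 'h) set \<Rightarrow> ('h \<Rightarrow> 'h) set" where
  "pre_am_inf I = ideal_of_char_set {\<xi> \<in> l1_star. am_inf \<xi> \<in> char_set I}"

definition am_inf_stable :: "('h::complex_hilbert \<Rightarrow> 'h) set \<Rightarrow> bool" where
  "am_inf_stable I \<longleftrightarrow> op_ideal I \<and> I = pre_am_inf I"

definition principal_ideal :: "('h::complex_hilbert \<Rightarrow> 'h) \<Rightarrow> ('h \<Rightarrow> 'h) set" where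
  "principal_ideal X = \<Inter> {J. op_ideal J \<and> X \<in> J}"

definition PL :: "('h::complex_hilbert \<Rightarrow> 'h) set set" where
  "PL = {I. I \<noteq> {\<lambda>x. 0} \<and> (\<exists>X\<in>compact_ops. I = principal_ideal X)}"

definition S_inf_PL :: "('h::complex_hilbert \<Rightarrow> 'h) set set" where
  "S_inf_PL = {I \<in> PL. am_inf_stable I}"

end

theory Submission
  imports Defs
begin

text \<open>
  By the singular value decomposition a principal ideal \<open>(X)\<close> consists of the compact operators \<open>Z\<close>
  with \<open>s(Z) = O(D\<^sub>m s(X))\<close> for some \<open>m\<close>, and \<open>(X)\<close> is am-\<open>\<infinity>\<close> stable iff \<open>s(X)\<close> is summable and
  \<open>\<infinity>\<close>-regular, so everything reduces to sequences.
  If \<open>\<xi>\<close> is \<open>\<infinity>\<close>-regular, then \<open>T\<^sub>n = \<Sum>j\<ge>n. \<xi>\<^sub>j\<close> satisfies \<open>T\<^sub>n \<le> C n (T\<^sub>n - T\<^sub>n\<^sub>+\<^sub>1)\<close>, hence \<open>n powr \<epsilon> * T\<^sub>n\<close>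
  decreases, and \<open>\<xi>\<close> is equivalent to \<open>T\<^sub>n / n\<close>, for which \<open>n powr p * T\<^sub>n / n\<close> with \<open>p = 1 + \<epsilon>\<close>
  decreases. Conversely, such a decreasing weighted sequence with \<open>p > 1\<close> is \<open>\<infinity>\<close>-regular.
  With \<open>1 < q < p\<close>, the largest minorant (respectively least majorant) of the sequence generating \<open>J\<close> whose
  product with \<open>n powr q\<close> decreases is still not equivalent to \<open>\<xi>\<close>, the gap between \<open>q\<close> and \<open>p\<close>
  being used here. After multiplication by \<open>n powr q\<close> any decreasing sequence between the two is
  admissible, and a sparse staircase lies strictly between them.
\<close>

section \<open>\<infinity>-regular sequences\<close>

text \<open>The obstacle is that a regularised hull may absorb the gap between the two ideals.
  Taking the hull with the full exponent p would leave nothing to play against the constant of a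
  supposed domination. With q < p, the product of the tail mean with n powr q still decays by (r /
  2) powr (p - q) between indices a and r * a. Failure of domination can be witnessed with r as
  large as desired, and then this decay beats any fixed constant. Domination tolerates dilations
  while pointwise order does not. Both density proofs therefore pass to equivalent generators that
  are comparable index by index: the tail mean t for \<xi>, and for \<eta> a stretched or compressed
  multiple e that lies above or below t. On the operator side, \<open>cadjoint\<close>,
  \<open>s_numbers\<close> and \<open>ideal_of_char_set\<close> are definite descriptions. Existence
  and uniqueness have to be established for each: by exchanging the two sequences of a Schmidt
  expansion, by comparing multiplicities, and by showing that an ideal is determined by the
  s-numbers of its members.\<close>

text \<open>Indexing from 0, \<open>D\<^sub>m \<eta>\<close> is \<open>n \<mapsto> \<eta> (n div m)\<close>, so for decreasing \<open>\<xi>\<close> this says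
  \<open>\<xi> = O(D\<^sub>m \<eta>)\<close> for some \<open>m\<close>, with the constant absorbed into \<open>m\<close>.\<close>

definition dominated :: "(nat \<Rightarrow> real) \<Rightarrow> (nat \<Rightarrow> real) \<Rightarrow> bool" where
  "dominated \<xi> \<eta> \<longleftrightarrow> (\<exists>m>0. \<forall>n. \<xi> (m * n) \<le> real m * \<eta> n)"

lemma c0_starD:
  assumes "\<xi> \<in> c0_star"
  shows "0 \<le> \<xi> n" "decseq \<xi>" "\<xi> \<longlonglongrightarrow> 0"
  using assms by (auto simp: c0_star_def)

text \<open>A decreasing \<xi> only gets smaller under a longer dilation, so dilation and constant
  can both be raised to a common value.\<close>

lemma dominatedI:
  assumes "decseq \<xi>" "\<And>n. 0 \<le> \<eta> n" "0 < m" "\<And>n. \<xi> (m * n) \<le> C * \<eta> n"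
  shows "dominated \<xi> \<eta>"
proof -
  define k where "k = max m (nat \<lceil>C\<rceil>)"
  have k: "0 < k" "m \<le> k" "C \<le> real k"
    using assms(3) by (auto simp: k_def) (linarith)
  have "\<xi> (k * n) \<le> real k * \<eta> n" for n
  proof -
    have "\<xi> (k * n) \<le> \<xi> (m * n)"
      using k by (intro decseqD [OF assms(1)]) simp
    also have "\<dots> \<le> C * \<eta> n" by (rule assms)
    also have "\<dots> \<le> real k * \<eta> n"
      using k assms(2) by (intro mult_right_mono) auto
    finally show ?thesis .
  qed
  then show ?thesis using k by (auto simp: dominated_def)
qed

lemma dominated_div:
  assumes "decseq \<xi>" "\<And>n. 0 \<le> \<eta> n" "0 < m" "\<And>n. \<xi> n \<le> C * \<eta> (n div m)"
  shows "dominated \<xi> \<eta>"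
proof (rule dominatedI [OF assms(1-3)])
  show "\<xi> (m * n) \<le> C * \<eta> n" for n
    using assms(4) [of "m * n"] assms(3) by simp
qed

lemma dominated_le:
  assumes "\<And>n. \<xi> n \<le> \<eta> n"
  shows "dominated \<xi> \<eta>"
  unfolding dominated_def by (rule exI [of _ 1]) (simp add: assms)

lemma dominated_refl [simp]: "dominated \<xi> \<xi>"
  by (rule dominated_le) simp

lemma dominated_trans:
  assumes "dominated \<xi> \<eta>" "dominated \<eta> \<zeta>"
  shows "dominated \<xi> \<zeta>"
proof -
  obtain m k where mk: "0 < m" "\<And>n. \<xi> (m * n) \<le> real m * \<eta> n" "0 < k" "\<And>n. \<eta> (k * n) \<le> real k * \<zeta> n"
    using assms by (auto simp: dominated_def)
  have "\<xi> (m * k * n) \<le> real (m * k) * \<zeta> n" for n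
  proof -
    have "\<xi> (m * k * n) \<le> real m * \<eta> (k * n)"
      using mk(2) [of "k * n"] by (simp add: mult.assoc)
    also have "\<dots> \<le> real m * (real k * \<zeta> n)"
      using mk(4) by (intro mult_left_mono) auto
    finally show ?thesis by (simp add: mult.assoc)
  qed
  then show ?thesis using mk unfolding dominated_def by (intro exI [of _ "m * k"]) auto
qed

lemma dominated_add:
  assumes "dominated \<xi> \<zeta>" "dominated \<eta> \<zeta>" "decseq \<xi>" "decseq \<eta>"
  shows "dominated (\<lambda>n. \<xi> n + \<eta> n) \<zeta>"
proof -
  obtain m k where mk: "0 < m" "\<And>n. \<xi> (m * n) \<le> real m * \<zeta> n" "0 < k" "\<And>n. \<eta> (k * n) \<le> real k * \<zeta> n"
    using assms by (auto simp: dominated_def)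
  have "\<xi> ((m + k) * n) + \<eta> ((m + k) * n) \<le> real (m + k) * \<zeta> n" for n
  proof -
    have "\<xi> ((m + k) * n) \<le> \<xi> (m * n)" "\<eta> ((m + k) * n) \<le> \<eta> (k * n)"
      by (intro decseqD [OF assms(3)] decseqD [OF assms(4)]; simp)+
    with mk(2) [of n] mk(4) [of n] show ?thesis by (simp add: algebra_simps)
  qed
  then show ?thesis using mk unfolding dominated_def by (intro exI [of _ "m + k"]) auto
qed

lemma dominated_divE:
  assumes "dominated \<xi> \<eta>" "decseq \<xi>"
  obtains m where "0 < m" "\<And>n. \<xi> n \<le> real m * \<eta> (n div m)"
proof -
  obtain m where m: "0 < m" "\<And>n. \<xi> (m * n) \<le> real m * \<eta> n"
    using assms by (auto simp: dominated_def)
  have "\<xi> n \<le> real m * \<eta> (n div m)" for n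
    using decseqD [OF assms(2), of "m * (n div m)" n] m(2) [of "n div m"] by simp
  with m that show thesis by blast
qed

section \<open>Tail means and \<infinity>-regularity\<close>

text \<open>In the indexing from 1 this is 1/N times the sum of the terms with index at least N,
  whereas \<open>am_inf\<close> starts after N. Keeping the N-th term makes the mean dominate \<xi>
  even when \<xi> is finitely supported.\<close>

definition tail_mean :: "(nat \<Rightarrow> real) \<Rightarrow> nat \<Rightarrow> real" where
  "tail_mean \<xi> n = (\<Sum>j. \<xi> (j + n)) / real (Suc n)"

text \<open>Since \<open>dominated\<close> permits dilations, the condition depends only on the
  equivalence class of \<xi>. That it captures am-\<infinity> stability of the ideal is
  \<open>am_inf_stable_iff\<close>.\<close>

definition inf_regular :: "(nat \<Rightarrow> real) \<Rightarrow> bool" where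
  "inf_regular \<xi> \<longleftrightarrow> summable \<xi> \<and> dominated (tail_mean \<xi>) \<xi>"

lemma tail_Suc:
  fixes \<xi> :: "nat \<Rightarrow> real"
  assumes "summable \<xi>"
  shows "(\<Sum>j. \<xi> (j + n)) = \<xi> n + (\<Sum>j. \<xi> (j + Suc n))"
proof -
  have "summable (\<lambda>j. \<xi> (j + n))" using assms by simp
  from suminf_split_head [OF this] show ?thesis by simp
qed

lemma tail_split:
  fixes \<xi> :: "nat \<Rightarrow> real"
  assumes "summable \<xi>"
  shows "(\<Sum>j. \<xi> (j + n)) = (\<Sum>j<k. \<xi> (j + n)) + (\<Sum>j. \<xi> (j + (k + n)))"
proof -
  have "summable (\<lambda>j. \<xi> (j + n))" using assms by simp
  from suminf_split_initial_segment [OF this, of k] show ?thesis by (simp add: add.assoc)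
qed

lemma tail_nonneg:
  fixes \<xi> :: "nat \<Rightarrow> real"
  assumes "summable \<xi>" "\<And>n. 0 \<le> \<xi> n"
  shows "0 \<le> (\<Sum>j. \<xi> (j + n))"
  using assms by (intro suminf_nonneg) auto

lemma tail_mean_c0_star:
  assumes "\<xi> \<in> c0_star" "summable \<xi>"
  shows "tail_mean \<xi> \<in> c0_star"
proof -
  have nn: "0 \<le> (\<Sum>j. \<xi> (j + n))" for n
    using tail_nonneg assms c0_starD by blast
  have le: "(\<Sum>j. \<xi> (j + Suc n)) \<le> (\<Sum>j. \<xi> (j + n))" for n
    using tail_Suc [OF assms(2), of n] c0_starD(1) [OF assms(1), of n] by simp
  have "decseq (tail_mean \<xi>)"
  proof (rule decseq_SucI)
    fix n show "tail_mean \<xi> (Suc n) \<le> tail_mean \<xi> n"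
      unfolding tail_mean_def using nn[of n] nn[of "Suc n"] le[of n] by (intro frac_le) auto
  qed
  moreover have "(\<lambda>n. (\<Sum>j. \<xi> (j + n))) \<longlonglongrightarrow> 0"
    using suminf_exist_split2 [OF assms(2)] .
  then have "tail_mean \<xi> \<longlonglongrightarrow> 0"
  proof (rule tendsto_sandwich [rotated 2, OF tendsto_const])
    show "\<forall>\<^sub>F n in sequentially. 0 \<le> tail_mean \<xi> n"
      using nn by (simp add: tail_mean_def)
    show "\<forall>\<^sub>F n in sequentially. tail_mean \<xi> n \<le> (\<Sum>j. \<xi> (j + n))"
    proof (intro always_eventually allI)
      fix n
      have "tail_mean \<xi> n \<le> (\<Sum>j. \<xi> (j + n)) / 1"
        unfolding tail_mean_def by (intro divide_left_mono nn) auto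
      then show "tail_mean \<xi> n \<le> (\<Sum>j. \<xi> (j + n))" by simp
    qed
  qed
  ultimately show ?thesis using nn by (auto simp: c0_star_def tail_mean_def)
qed

text \<open>The n + 1 terms with indices from n to 2 * n are all at least
  \<open>\<xi> (2 * n)\<close> and belong to the tail starting at n; hence the dilation by
  2.\<close>

lemma dominated_tail_mean:
  assumes "\<xi> \<in> c0_star" "summable \<xi>"
  shows "dominated \<xi> (tail_mean \<xi>)"
proof (rule dominatedI [where m = 2 and C = 1])
  fix n
  have dec: "decseq \<xi>" and nn: "\<And>n. 0 \<le> \<xi> n"
    using assms c0_starD by auto
  have "real (Suc n) * \<xi> (2 * n) = (\<Sum>j<Suc n. \<xi> (2 * n))" by simp
  also have "\<dots> \<le> (\<Sum>j<Suc n. \<xi> (j + n))"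
    by (intro sum_mono decseqD [OF dec]) auto
  also have "\<dots> \<le> (\<Sum>j. \<xi> (j + n))"
    using tail_split [OF assms(2), of n "Suc n"] tail_nonneg [OF assms(2) nn, of "Suc n + n"]
    by linarith
  finally show "\<xi> (2 * n) \<le> 1 * tail_mean \<xi> n"
    by (simp add: tail_mean_def field_simps)
qed (use assms tail_mean_c0_star c0_starD in auto)

text \<open>Terms are grouped into blocks of length m, on which the index divided by m is constant.
  One factor m in the bound is the block length, the other the constant of domination.\<close>

lemma summable_dominated:
  assumes "dominated \<eta> \<xi>" "decseq \<eta>" "\<And>n. 0 \<le> \<eta> n" "summable \<xi>" "\<And>n. 0 \<le> \<xi> n"
  obtains m where "0 < m" "summable \<eta>" "\<And>n. (\<Sum>j. \<eta> (j + n)) \<le> real (m * m) * (\<Sum>j. \<xi> (j + n div m))"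
proof -
  obtain m where m: "0 < m" "\<And>n. \<eta> n \<le> real m * \<xi> (n div m)"
    using dominated_divE [OF assms(1,2)] by blast
  have bound: "(\<Sum>j<k. \<eta> (j + n)) \<le> real (m * m) * (\<Sum>j. \<xi> (j + n div m))" for n k
  proof -
    have "(\<Sum>j<k. \<eta> (j + n)) \<le> (\<Sum>j<k. \<eta> (j + m * (n div m)))"
      by (intro sum_mono decseqD [OF assms(2)]) simp
    \<comment> \<open>Lengthening the sum to \<open>k * m\<close> terms completes the
      blocks.\<close>
    also have "\<dots> \<le> (\<Sum>j<k * m. \<eta> (j + m * (n div m)))"
      using m(1) assms(3) by (intro sum_mono2) (auto intro: less_le_trans)
    also have "\<dots> \<le> (\<Sum>j<k * m. real m * \<xi> ((j + m * (n div m)) div m))"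
      by (intro sum_mono m(2))
    also have "\<dots> = (\<Sum>i<k. \<Sum>j = i * m..<i * m + m. real m * \<xi> ((j + m * (n div m)) div m))"
      by (rule sum.nat_group [symmetric])
    also have "\<dots> = (\<Sum>i<k. \<Sum>j = i * m..<i * m + m. real m * \<xi> (i + n div m))"
    proof (intro sum.cong refl)
      fix i j assume "j \<in> {i * m..<i * m + m}"
      then have "j div m = i" by (auto intro!: div_nat_eqI simp: mult.commute)
      then show "real m * \<xi> ((j + m * (n div m)) div m) = real m * \<xi> (i + n div m)"
        using m(1) by (simp add: add.commute)
    qed
    also have "\<dots> = real (m * m) * (\<Sum>i<k. \<xi> (i + n div m))"
      by (simp add: sum_distrib_left mult.assoc)
    also have "\<dots> \<le> real (m * m) * (\<Sum>j. \<xi> (j + n div m))"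
      using assms(4,5) by (intro mult_left_mono sum_le_suminf) auto
    finally show ?thesis .
  qed
  have "summable \<eta>"
    using bound [where n = 0] assms(3) by (intro summableI_nonneg_bounded) auto
  moreover have "(\<Sum>j. \<eta> (j + n)) \<le> real (m * m) * (\<Sum>j. \<xi> (j + n div m))" for n
    using calculation bound by (intro suminf_le_const) auto
  ultimately show thesis using m that by blast
qed

text \<open>This is the reason for using tail means: \<open>am_inf\<close> does not respect
  domination, as (1, 1, 0, ...) is dominated by (1, 0, 0, ...), for which \<open>am_inf\<close> is
  zero.\<close>

lemma tail_mean_mono:
  assumes "dominated \<eta> \<xi>" "\<eta> \<in> c0_star" "\<xi> \<in> c0_star" "summable \<xi>"
  shows "summable \<eta>" "dominated (tail_mean \<eta>) (tail_mean \<xi>)"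
proof -
  obtain m where m: "0 < m" "summable \<eta>" "\<And>n. (\<Sum>j. \<eta> (j + n)) \<le> real (m * m) * (\<Sum>j. \<xi> (j + n div m))"
    using summable_dominated [OF assms(1)] assms c0_starD by metis
  show "summable \<eta>" by fact
  show "dominated (tail_mean \<eta>) (tail_mean \<xi>)"
  proof (rule dominated_div [where m = m and C = "real (m * m)"])
    fix n
    have "tail_mean \<eta> n \<le> real (m * m) * (\<Sum>j. \<xi> (j + n div m)) / real (Suc n)"
      unfolding tail_mean_def by (intro divide_right_mono m) auto
    also have "\<dots> \<le> real (m * m) * (\<Sum>j. \<xi> (j + n div m)) / real (Suc (n div m))"
      using assms c0_starD by (intro divide_left_mono mult_nonneg_nonneg tail_nonneg) auto
    finally show "tail_mean \<eta> n \<le> real (m * m) * tail_mean \<xi> (n div m)"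
      by (simp add: tail_mean_def)
  qed (use m tail_mean_c0_star assms c0_starD in auto)
qed

lemma tail_mean_add:
  assumes "summable \<xi>" "summable \<eta>"
  shows "tail_mean (\<lambda>n. \<xi> n + \<eta> n) = (\<lambda>n. tail_mean \<xi> n + tail_mean \<eta> n)"
  using assms by (auto simp: tail_mean_def suminf_add [symmetric] add_divide_distrib)

lemma am_inf_le_tail_mean:
  assumes "\<xi> \<in> c0_star" "summable \<xi>"
  shows "am_inf \<xi> n \<le> tail_mean \<xi> n"
  unfolding am_inf_def tail_mean_def
  using tail_Suc [OF assms(2), of n] c0_starD(1) [OF assms(1), of n]
  by (intro divide_right_mono) auto

lemma am_inf_c0_star:
  assumes "\<xi> \<in> c0_star" "summable \<xi>"
  shows "am_inf \<xi> \<in> c0_star"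
proof -
  have nn: "0 \<le> (\<Sum>j. \<xi> (j + n))" for n
    using tail_nonneg assms c0_starD by blast
  have le: "(\<Sum>j. \<xi> (j + Suc n)) \<le> (\<Sum>j. \<xi> (j + n))" for n
    using tail_Suc [OF assms(2), of n] c0_starD(1) [OF assms(1), of n] by simp
  have nn': "0 \<le> am_inf \<xi> n" for n
    using nn[of "Suc n"] by (simp add: am_inf_def)
  have "decseq (am_inf \<xi>)"
  proof (rule decseq_SucI)
    fix n show "am_inf \<xi> (Suc n) \<le> am_inf \<xi> n"
      unfolding am_inf_def using nn[of "Suc n"] nn[of "Suc (Suc n)"] le[of "Suc n"] by (intro frac_le) auto
  qed
  moreover have "am_inf \<xi> \<longlonglongrightarrow> 0"
    by (rule tendsto_sandwich [OF _ _ tendsto_const c0_starD(3) [OF tail_mean_c0_star [OF assms]]])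
       (auto simp: nn' am_inf_le_tail_mean assms)
  ultimately show ?thesis using nn' by (auto simp: c0_star_def)
qed

text \<open>For \<open>\<xi> = (1, 0, 0, \<dots>)\<close> the sequence \<open>am_inf \<xi>\<close> vanishes while \<open>tail_mean \<xi>\<close> does not,
  so the zero sequence \<open>\<zeta>\<close> has to be excluded.\<close>
lemma dominated_am_inf_iff:
  assumes "\<xi> \<in> c0_star" "summable \<xi>" "\<zeta> \<in> c0_star" "\<zeta> 0 > 0"
  shows "dominated (am_inf \<xi>) \<zeta> \<longleftrightarrow> dominated (tail_mean \<xi>) \<zeta>"
proof
  assume "dominated (tail_mean \<xi>) \<zeta>"
  then show "dominated (am_inf \<xi>) \<zeta>"
    using am_inf_le_tail_mean [OF assms(1,2)] dominated_le dominated_trans by blast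
next
  assume "dominated (am_inf \<xi>) \<zeta>"
  then obtain m where m: "0 < m" "\<And>n. am_inf \<xi> (m * n) \<le> real m * \<zeta> n"
    by (auto simp: dominated_def)
  \<comment> \<open>The dilation \<open>2 * m\<close> skips the term that \<open>am_inf\<close>
    omits, which works for positive n only. At n = 0 the ratio in \<open>C\<close> takes over, and
    there \<open>\<zeta> 0 > 0\<close> enters.\<close>
  define C where "C = max (real m) (tail_mean \<xi> 0 / \<zeta> 0)"
  note dec = c0_starD(2) [OF tail_mean_c0_star [OF assms(1,2)]]
  show "dominated (tail_mean \<xi>) \<zeta>"
  proof (rule dominatedI [where m = "2 * m" and C = C])
    fix n
    show "tail_mean \<xi> (2 * m * n) \<le> C * \<zeta> n"
    proof (cases "n = 0")
      case True
      have "tail_mean \<xi> 0 \<le> C * \<zeta> 0"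
        using assms(4) by (simp add: C_def pos_divide_le_eq [symmetric])
      with True show ?thesis by simp
    next
      case False
      define k where "k = m * n"
      have k: "Suc k \<le> 2 * k" using False m(1) by (simp add: k_def Suc_le_eq)
      have "tail_mean \<xi> (2 * k) \<le> tail_mean \<xi> (Suc k)"
        using k by (intro decseqD [OF dec])
      also have "\<dots> \<le> am_inf \<xi> k"
        unfolding tail_mean_def am_inf_def
        using assms c0_starD by (intro divide_left_mono tail_nonneg) auto
      also have "\<dots> \<le> real m * \<zeta> n" using m(2) by (simp add: k_def)
      also have "\<dots> \<le> C * \<zeta> n"
        using c0_starD(1) [OF assms(3)] by (intro mult_right_mono) (auto simp: C_def)
      finally show ?thesis by (simp add: k_def mult.assoc)
    qed
  qed (use m dec assms c0_starD in auto)
qed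

section \<open>Regularity and power weights\<close>

text \<open>At index n the tail sum loses at least the fraction \<epsilon> / (n + 1) of itself,
  where \<epsilon> = 1 / C. As 1 - \<epsilon> x \<le> exp (- \<epsilon> x) \<le> (1 + x) powr (-
  \<epsilon>), this outweighs the growth of n powr \<epsilon>. The exponent p = 1 + \<epsilon> also
  cancels the denominator of the tail mean.\<close>

lemma inf_regular_weight:
  assumes "\<xi> \<in> c0_star" "inf_regular \<xi>"
  obtains p where "1 < p" "decseq (\<lambda>n. real (Suc n) powr p * tail_mean \<xi> n)"
proof -
  have sm: "summable \<xi>" and dom: "dominated (tail_mean \<xi>) \<xi>"
    using assms(2) by (auto simp: inf_regular_def)
  have dec: "decseq \<xi>" and nn: "\<And>n. 0 \<le> \<xi> n"
    using assms c0_starD by auto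
  define T where "T n = (\<Sum>j. \<xi> (j + n))" for n
  have T0: "0 \<le> T n" for n using tail_nonneg [OF sm nn] by (simp add: T_def)
  obtain m where m: "0 < m" "\<And>n. tail_mean \<xi> (m * n) \<le> real m * \<xi> n"
    using dom by (auto simp: dominated_def)
  \<comment> \<open>The first summand pays for the terms from n up to \<open>m * n\<close>, each at
    most \<open>\<xi> n\<close>; the second pays for the tail from \<open>m * n\<close> on, which
    the domination hypothesis controls.\<close>
  define C where "C = real m + real m * real m"
  have C1: "C \<ge> 1" using m(1) by (simp add: C_def Suc_le_eq add_increasing2)
  have TC: "T n \<le> C * real (Suc n) * \<xi> n" for n
  proof -
    have mn: "n \<le> m * n" using m(1) by simp
    have "T n = (\<Sum>j<m * n - n. \<xi> (j + n)) + T (m * n)"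
      using tail_split [OF sm, of n "m * n - n"] mn by (simp add: T_def)
    also have "(\<Sum>j<m * n - n. \<xi> (j + n)) \<le> (\<Sum>j<m * n - n. \<xi> n)"
      by (intro sum_mono decseqD [OF dec]) simp
    also have "\<dots> = real (m * n - n) * \<xi> n" by simp
    also have "\<dots> \<le> real m * real (Suc n) * \<xi> n"
    proof (intro mult_right_mono nn)
      show "real (m * n - n) \<le> real m * real (Suc n)"
        unfolding of_nat_mult [symmetric] of_nat_le_iff by simp
    qed
    also have "T (m * n) \<le> real m * real m * real (Suc n) * \<xi> n"
    proof -
      have "T (m * n) = real (Suc (m * n)) * tail_mean \<xi> (m * n)"
        by (simp add: T_def tail_mean_def del: of_nat_Suc)
      also have "\<dots> \<le> real (Suc (m * n)) * (real m * \<xi> n)"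
        by (intro mult_left_mono m) simp
      also have "\<dots> \<le> (real m * real (Suc n)) * (real m * \<xi> n)"
      proof (intro mult_right_mono)
        show "real (Suc (m * n)) \<le> real m * real (Suc n)"
          using m(1) by (simp add: algebra_simps)
      qed (simp add: nn)
      finally show ?thesis by (simp add: mult_ac)
    qed
    finally show ?thesis by (simp add: C_def algebra_simps)
  qed
  define \<epsilon> where "\<epsilon> = 1 / C"
  have eps: "0 < \<epsilon>" using C1 by (simp add: \<epsilon>_def)
  have step: "real (Suc (Suc n)) powr \<epsilon> * T (Suc n) \<le> real (Suc n) powr \<epsilon> * T n" for n
  proof -
    define x where "x = 1 / real (Suc n)"
    have x0: "0 < x" by (simp add: x_def)
    have "T n / (C * real (Suc n)) \<le> \<xi> n"
      using TC [of n] C1 by (subst pos_divide_le_eq) (auto simp: mult_ac)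
    then have "\<epsilon> * x * T n \<le> \<xi> n"
      by (simp add: \<epsilon>_def x_def)
    then have "T (Suc n) \<le> (1 - \<epsilon> * x) * T n"
      using tail_Suc [OF sm, of n] by (simp add: T_def algebra_simps)
    also have "\<dots> \<le> exp (- (\<epsilon> * x)) * T n"
      using exp_ge_add_one_self [of "- (\<epsilon> * x)"] by (intro mult_right_mono T0) simp
    also have "\<dots> \<le> exp (- (\<epsilon> * ln (1 + x))) * T n"
      using ln_add_one_self_le_self [of x] x0 eps by (intro mult_right_mono T0) simp
    also have "exp (- (\<epsilon> * ln (1 + x))) = 1 / (1 + x) powr \<epsilon>"
      using x0 by (simp add: powr_def exp_minus field_simps)
    finally have "(1 + x) powr \<epsilon> * T (Suc n) \<le> T n"
      using x0 by (simp add: field_simps)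
    moreover have "real (Suc (Suc n)) powr \<epsilon> = real (Suc n) powr \<epsilon> * (1 + x) powr \<epsilon>"
    proof -
      have "real (Suc (Suc n)) = real (Suc n) * (1 + x)" by (simp add: x_def field_simps)
      then show ?thesis by (simp only: powr_mult)
    qed
    ultimately show ?thesis by (simp add: mult.assoc mult_left_mono)
  qed
  have eq: "real (Suc n) powr (1 + \<epsilon>) * tail_mean \<xi> n = real (Suc n) powr \<epsilon> * T n" for n
    by (simp add: powr_add tail_mean_def T_def)
  show thesis
  proof (rule that)
    show "1 < 1 + \<epsilon>" using eps by simp
    show "decseq (\<lambda>n. real (Suc n) powr (1 + \<epsilon>) * tail_mean \<xi> n)"
      unfolding eq by (rule decseq_SucI) (rule step)
  qed
qed

text \<open>A discrete integral test: after n the terms are at most \<open>W n\<close> times (j + 1)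
  powr (- p), and the differences of \<open>u\<close> majorise (p - 1) times these powers.
  Telescoping bounds the tail after n by \<open>\<xi> n\<close> times (n + 1) / (p - 1), and the
  term at n itself contributes the 1 in \<open>C\<close>.\<close>

lemma weight_inf_regular:
  assumes p: "1 < p" and dec: "decseq (\<lambda>n. real (Suc n) powr p * \<xi> n)" and cs: "\<xi> \<in> c0_star"
  shows "inf_regular \<xi>"
proof -
  have nn: "\<And>n. 0 \<le> \<xi> n" using cs c0_starD by auto
  define W where "W n = real (Suc n) powr p * \<xi> n" for n
  define u where "u n = real (Suc n) powr (1 - p)" for n
  have W0: "0 \<le> W n" for n using nn by (simp add: W_def)
  have u: "(p - 1) * real (Suc (Suc j)) powr (- p) \<le> u j - u (Suc j)" for j
  proof -
    define x where "x = 1 / real (Suc j)"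
    define y where "y = real (Suc (Suc j))"
    have x0: "0 < x" by (simp add: x_def)
    have y0: "0 < y" by (simp add: y_def)
    have xy: "x / (1 + x) = 1 / y" "real (Suc j) = y / (1 + x)" by (auto simp: x_def y_def field_simps)
    have "1 / y \<le> ln (1 + x)"
    proof -
      have "ln (1 / (1 + x)) \<le> 1 / (1 + x) - 1"
        using x0 by (intro ln_le_minus_one) simp
      moreover have "1 / (1 + x) - 1 = - (x / (1 + x))" using x0 by (simp add: field_simps)
      ultimately show ?thesis using x0 xy by (simp add: ln_div)
    qed
    then have "(p - 1) * (1 / y) \<le> (p - 1) * ln (1 + x)"
      using p by (intro mult_left_mono) auto
    also have "\<dots> \<le> exp ((p - 1) * ln (1 + x)) - 1"
      using exp_ge_add_one_self [of "(p - 1) * ln (1 + x)"] by linarith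
    also have "exp ((p - 1) * ln (1 + x)) = (1 + x) powr (p - 1)"
      using x0 by (simp add: powr_def)
    finally have "y powr (1 - p) * ((p - 1) * (1 / y)) \<le> y powr (1 - p) * ((1 + x) powr (p - 1) - 1)"
      by (intro mult_left_mono) auto
    also have "y powr (1 - p) * ((1 + x) powr (p - 1) - 1) = u j - u (Suc j)"
      using x0 y0 unfolding u_def xy(2) y_def [symmetric]
      by (simp add: powr_divide algebra_simps powr_diff)
    also have "y powr (1 - p) * ((p - 1) * (1 / y)) = (p - 1) * y powr (- p)"
      using y0 by (simp add: powr_diff powr_minus field_simps)
    finally show ?thesis by (simp add: y_def)
  qed
  have xi: "\<xi> (Suc j) \<le> W n / (p - 1) * (u j - u (Suc j))" if "n \<le> j" for n j
  proof -
    have "\<xi> (Suc j) = W (Suc j) * real (Suc (Suc j)) powr (- p)"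
      by (simp add: W_def powr_minus field_simps)
    also have "\<dots> \<le> W n * real (Suc (Suc j)) powr (- p)"
      using decseqD [OF dec, of n "Suc j"] that by (intro mult_right_mono) (auto simp: W_def)
    also have "\<dots> = W n / (p - 1) * ((p - 1) * real (Suc (Suc j)) powr (- p))"
      using p by simp
    also have "\<dots> \<le> W n / (p - 1) * (u j - u (Suc j))"
      using p W0 by (intro mult_left_mono u) auto
    finally show ?thesis .
  qed
  have part: "(\<Sum>j<k. \<xi> (Suc j + n)) \<le> W n / (p - 1) * u n" for k n
  proof -
    have "(\<Sum>j<k. \<xi> (Suc j + n)) \<le> (\<Sum>j<k. W n / (p - 1) * (u (j + n) - u (Suc j + n)))"
      by (intro sum_mono) (use xi in auto)
    also have "\<dots> = W n / (p - 1) * (\<Sum>j<k. u (j + n) - u (Suc j + n))"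
      by (simp add: sum_distrib_left)
    also have "(\<Sum>j<k. u (j + n) - u (Suc j + n)) = u n - u (k + n)"
      using sum_lessThan_telescope' [of "\<lambda>j. u (j + n)" k] by simp
    also have "W n / (p - 1) * (u n - u (k + n)) \<le> W n / (p - 1) * u n"
      using p W0 by (intro mult_left_mono) (auto simp: u_def)
    finally show ?thesis .
  qed
  have "summable (\<lambda>j. \<xi> (Suc j))"
    using part [where n = 0] nn by (intro summableI_nonneg_bounded) auto
  then have sm: "summable \<xi>" by (simp add: summable_Suc_iff)
  define C where "C = 1 + 1 / (p - 1)"
  have "dominated (tail_mean \<xi>) \<xi>"
  proof (rule dominatedI [where m = 1 and C = C])
    fix n
    have "(\<Sum>j. \<xi> (j + Suc n)) \<le> W n / (p - 1) * u n"
      using part [where n = n] sm by (intro suminf_le_const) (auto simp: summable_iff_shift simp del: add_Suc add_Suc_right, simp add: summable_iff_shift [of \<xi> "Suc n", simplified])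
    also have "\<dots> = \<xi> n / (p - 1) * real (Suc n)"
      by (simp add: W_def u_def powr_diff)
    finally have "(\<Sum>j. \<xi> (j + n)) \<le> \<xi> n + \<xi> n / (p - 1) * real (Suc n)"
      using tail_Suc [OF sm, of n] by simp
    moreover have "\<xi> n \<le> \<xi> n * real (Suc n)" using nn [of n] by (simp add: mult_le_cancel_left1)
    moreover have "C * \<xi> n * real (Suc n) = \<xi> n * real (Suc n) + \<xi> n / (p - 1) * real (Suc n)"
      by (simp add: C_def algebra_simps)
    ultimately have "(\<Sum>j. \<xi> (j + n)) \<le> C * \<xi> n * real (Suc n)"
      by linarith
    then show "tail_mean \<xi> (1 * n) \<le> C * \<xi> n"
      by (simp add: tail_mean_def divide_le_eq)
  qed (use tail_mean_c0_star [OF cs sm] c0_starD nn in auto)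
  with sm show ?thesis by (simp add: inf_regular_def)
qed

section \<open>Strict interpolation between decreasing sequences\<close>

text \<open>\<open>Z\<close> is the maximum of \<open>X\<close> and a staircase with steps
  \<open>h i = Y (N i) / Suc i\<close>, where \<open>N i = Suc i * k i\<close>. The indices
  \<open>k i\<close> are chosen so that \<open>Y (N i)\<close> exceeds \<open>X (k i)\<close> by the
  square of \<open>Suc i\<close>. One factor separates \<open>h i\<close> from
  \<open>X (k i)\<close>, the other \<open>Y (N i)\<close> from \<open>h i\<close>, so both gaps
  outgrow every constant.\<close>

lemma dominated_interpolate:
  assumes X: "decseq X" "\<And>n. 0 \<le> X n" "X 0 > 0"
    and Y: "decseq Y" "\<And>n. X n \<le> Y n" "\<not> dominated Y X"
  obtains Z where "decseq Z" "\<And>n. X n \<le> Z n" "\<And>n. Z n \<le> Y n" "\<not> dominated Z X" "\<not> dominated Y Z"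
proof -
  have Y0: "0 \<le> Y n" for n using X(2) Y(2) order_trans by blast
  \<comment> \<open>The witness can be taken beyond any \<open>K\<close>: otherwise finitely many
    exceptions could be absorbed into the constant while \<open>X K\<close> is positive, and if
    \<open>X K\<close> is zero, a dilation pushes \<open>Y\<close> to zero at every positive index,
    leaving only index 0 and \<open>X 0 > 0\<close>.\<close>
  have ex: "\<exists>k>K. Y (i * k) > real i * real i * X k" if i: "0 < i" for i K
  proof (rule ccontr)
    assume "\<not> ?thesis"
    then have le: "Y (i * k) \<le> real i * real i * X k" if "K < k" for k using that by force
    show False
    proof (cases "X K > 0")
      case True
      define C where "C = max (real i * real i) (Y 0 / X K)"
      have "Y (i * k) \<le> C * X k" for k
      proof (cases "K < k")
        case True
        have "Y (i * k) \<le> real i * real i * X k" using le True by simp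
        also have "\<dots> \<le> C * X k" using X(2) by (intro mult_right_mono) (auto simp: C_def)
        finally show ?thesis .
      next
        case False
        have "Y (i * k) \<le> Y 0" using decseqD [OF Y(1)] by simp
        also have "\<dots> = Y 0 / X K * X K" using True by simp
        also have "\<dots> \<le> Y 0 / X K * X k"
          using False True Y0 by (intro mult_left_mono decseqD [OF X(1)]) auto
        also have "\<dots> \<le> C * X k" using X(2) by (intro mult_right_mono) (auto simp: C_def)
        finally show ?thesis .
      qed
      then have "dominated Y X" using i X Y by (intro dominatedI [where m = i and C = C]) auto
      with Y(3) show False ..
    next
      case False
      have z: "Y (i * Suc K) \<le> 0"
      proof -
        have "X (Suc K) \<le> X K" using X(1) by (simp add: decseq_SucD)
        with False X(2) [of "Suc K"] have "X (Suc K) = 0" by linarith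
        with le [of "Suc K"] show ?thesis by simp
      qed
      define C where "C = Y 0 / X 0"
      have "Y (i * Suc K * n) \<le> C * X n" for n
      proof (cases "n = 0")
        case True then show ?thesis using X(3) by (simp add: C_def)
      next
        case False
        then have "Y (i * Suc K * n) \<le> Y (i * Suc K)"
          by (intro decseqD [OF Y(1)]) simp
        also have "\<dots> \<le> 0" by (rule z)
        also have "\<dots> \<le> C * X n" using X Y0 [of 0] by (simp add: C_def)
        finally show ?thesis .
      qed
      then have "dominated Y X" using i X Y by (intro dominatedI [where m = "i * Suc K" and C = C]) auto
      with Y(3) show False ..
    qed
  qed
  have "\<exists>k. \<forall>i. Y (Suc i * k i) > real (Suc i) * real (Suc i) * X (k i) \<and> Suc i * k i < k (Suc i)"
  proof (rule dependent_nat_choice)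
    show "\<exists>x. real (Suc 0) * real (Suc 0) * X x < Y (Suc 0 * x)"
      using ex [of "Suc 0" 0] by auto
    show "\<exists>y. real (Suc (Suc i)) * real (Suc (Suc i)) * X y < Y (Suc (Suc i) * y) \<and> Suc i * x < y" for x i
      using ex [of "Suc (Suc i)" "Suc i * x"] by blast
  qed
  then obtain k where k: "\<And>i. Y (Suc i * k i) > real (Suc i) * real (Suc i) * X (k i)"
      "\<And>i. Suc i * k i < k (Suc i)" by blast
  define N where "N i = Suc i * k i" for i
  define h where "h i = Y (N i) / real (Suc i)" for i
  \<comment> \<open>\<open>l n\<close> is the number of the step on which n lies. Because
    \<open>N i < k (Suc i) \<le> N (Suc i)\<close>, the index \<open>k i\<close> lies on step i
    exactly.\<close>
  define l where "l n = (LEAST i. n \<le> N i)" for n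
  have kN: "k i \<le> N i" for i by (simp add: N_def)
  have "N i < N (Suc i)" for i using k(2) [of i] kN [of "Suc i"] by (simp add: N_def)
  then have smN: "strict_mono N" by (simp add: strict_mono_Suc_iff)
  then have "n \<le> N n" for n by (rule strict_mono_imp_increasing)
  then have lN: "n \<le> N (l n)" for n
    unfolding l_def by (rule LeastI)
  have l_le: "l n \<le> i" if "n \<le> N i" for n i unfolding l_def by (rule Least_le) fact
  have hX: "h i > real (Suc i) * X (k i)" for i
    using k(1) [of i] by (simp add: h_def N_def pos_less_divide_eq mult_ac del: of_nat_Suc)
  have h0: "h i > 0" for i by (rule le_less_trans [OF _ hX]) (simp add: X(2))
  have hdec: "h j \<le> h i" if "i \<le> j" for i j
    unfolding h_def using that smN Y0
    by (intro frac_le decseqD [OF Y(1)]) (auto simp: strict_mono_less_eq)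
  define Z where "Z n = max (X n) (h (l n))" for n
  have lmono: "l m \<le> l n" if "m \<le> n" for m n
    by (rule l_le [OF order_trans [OF that lN]])
  have lk: "l (k i) = i" for i
  proof (rule antisym)
    show "l (k i) \<le> i" by (rule l_le [OF kN])
    show "i \<le> l (k i)"
    proof (cases i)
      case (Suc j)
      show ?thesis
      proof (rule ccontr)
        assume "\<not> ?thesis"
        then have "N (l (k i)) \<le> N j" using smN Suc by (simp add: strict_mono_less_eq)
        with lN [of "k i"] k(2) [of j] Suc show False by (simp add: N_def)
      qed
    qed simp
  qed
  have Zk: "Z (k i) = h i" for i
  proof -
    have "X (k i) \<le> real (Suc i) * X (k i)" using X(2) [of "k i"] by (simp add: mult_le_cancel_right1)
    with hX [of i] show ?thesis by (simp add: Z_def lk)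
  qed
  show thesis
  proof (rule that)
    show "decseq Z"
      unfolding decseq_def Z_def using hdec lmono decseqD [OF X(1)]
      by (intro allI impI max.mono) auto
    show "X n \<le> Z n" for n by (simp add: Z_def)
    show "Z n \<le> Y n" for n
    proof -
      have "h (l n) \<le> Y (N (l n)) / 1" unfolding h_def using Y0 by (intro divide_left_mono) auto
      also have "\<dots> \<le> Y n" using decseqD [OF Y(1) lN] by simp
      finally show ?thesis using Y(2) by (simp add: Z_def)
    qed
    show "\<not> dominated Z X"
    proof
      assume "dominated Z X"
      then obtain m where m: "0 < m" "\<And>n. Z (m * n) \<le> real m * X n" by (auto simp: dominated_def)
      \<comment> \<open>\<open>m * k m\<close> is at most \<open>N m\<close>, hence on step m or on
        an earlier one, and earlier steps are no lower.\<close>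
      have "l (m * k m) \<le> m" by (rule l_le) (simp add: N_def)
      then have "h m \<le> Z (m * k m)" using hdec by (simp add: Z_def le_max_iff_disj)
      also have "\<dots> \<le> real m * X (k m)" by (rule m)
      also have "\<dots> \<le> real (Suc m) * X (k m)" using X(2) by (intro mult_right_mono) auto
      finally show False using hX [of m] by simp
    qed
    show "\<not> dominated Y Z"
    proof
      assume "dominated Y Z"
      then obtain m where m: "0 < m" "\<And>n. Y (m * n) \<le> real m * Z n" by (auto simp: dominated_def)
      have "real (Suc m) * h m = Y (N m)" by (simp add: h_def)
      also have "\<dots> \<le> Y (m * k m)" by (intro decseqD [OF Y(1)]) (simp add: N_def)
      also have "\<dots> \<le> real m * h m" using m(2) [of "k m"] by (simp add: Zk)
      finally show False using h0 [of m] by simp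
    qed
  qed
qed

text \<open>The dilation is required to have the prescribed factor m, later the constant of a
  supposed domination, and a large cofactor r. Taking r above \<open>\<xi> 0 / \<eta> 0\<close>
  rules out the witness 0, for which \<open>weight_decay\<close> would not be available.\<close>

lemma not_dominatedE:
  assumes "\<not> dominated \<xi> \<eta>" "decseq \<xi>" "\<And>n. 0 \<le> \<eta> n" "\<eta> 0 > 0" "0 < m"
  obtains r k where "K < r" "0 < k" "\<xi> (m * r * k) > real (m * r) * \<eta> k"
proof -
  define r where "r = Suc (max K (nat \<lceil>\<xi> 0 / \<eta> 0\<rceil>))"
  have rK: "K < r" by (simp add: r_def)
  have r0: "\<xi> 0 / \<eta> 0 \<le> real r"
    using real_nat_ceiling_ge [of "\<xi> 0 / \<eta> 0"] unfolding r_def by linarith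
  have "0 < m * r" using assms(5) rK by simp
  then obtain k where k: "\<xi> (m * r * k) > real (m * r) * \<eta> k"
    using assms(1) unfolding dominated_def by (meson not_less)
  have "k \<noteq> 0"
  proof
    assume "k = 0"
    with k have "real (m * r) * \<eta> 0 < \<xi> 0" by simp
    also have "\<xi> 0 \<le> real r * \<eta> 0" using r0 assms(4) by (simp add: divide_le_eq)
    also have "\<dots> \<le> real (m * r) * \<eta> 0"
      using assms(4,5) by (intro mult_right_mono) (auto simp: mult_le_cancel_right1)
    finally show False by simp
  qed
  with k rK that show thesis by blast
qed

text \<open>Here the gap between the exponents becomes a quantitative decay: for positive a the
  ratio of \<open>Suc (r * a)\<close> to \<open>Suc a\<close> is at least r / 2, and its power p - q
  is what the weight n powr p has to spare.\<close>

lemma weight_decay: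
  assumes dec: "decseq (\<lambda>n. real (Suc n) powr p * \<xi> n)" and "q < p" "0 < a" "0 < r" "\<And>n. 0 \<le> \<xi> n"
  shows "(real r / 2) powr (p - q) * (real (Suc (r * a)) powr q * \<xi> (r * a)) \<le> real (Suc a) powr q * \<xi> a"
proof -
  have ra: "real r / 2 * real (Suc a) \<le> real (Suc (r * a))"
  proof -
    have "r * Suc a \<le> 2 * Suc (r * a)" using assms(3,4) by (cases a) auto
    then have "real (r * Suc a) \<le> real (2 * Suc (r * a))" by (rule of_nat_mono)
    then show ?thesis by (simp add: field_simps)
  qed
  have "(real r / 2) powr (p - q) * real (Suc a) powr (p - q) = (real r / 2 * real (Suc a)) powr (p - q)"
    by (rule powr_mult [symmetric])
  also have "\<dots> \<le> real (Suc (r * a)) powr (p - q)"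
    using assms ra by (intro powr_mono2) auto
  finally have "real (Suc a) powr (p - q) * ((real r / 2) powr (p - q) * (real (Suc (r * a)) powr q * \<xi> (r * a)))
      \<le> real (Suc (r * a)) powr (p - q) * (real (Suc (r * a)) powr q * \<xi> (r * a))"
    using assms(5) [of "r * a"] unfolding mult.assoc [symmetric] 
    by (intro mult_right_mono) (auto simp: mult.commute)
  also have "\<dots> = real (Suc (r * a)) powr p * \<xi> (r * a)"
    by (simp add: powr_add [symmetric] mult.assoc [symmetric] del: of_nat_Suc)
  also have "\<dots> \<le> real (Suc a) powr p * \<xi> a"
    using decseqD [OF dec, of a "r * a"] assms(4) by simp
  also have "\<dots> = real (Suc a) powr (p - q) * (real (Suc a) powr q * \<xi> a)"
    by (simp add: powr_add [symmetric] mult.assoc [symmetric] del: of_nat_Suc)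
  finally show ?thesis by (simp add: mult_le_cancel_left_pos del: of_nat_Suc)
qed

lemma eventually_powr_gt:
  fixes s C :: real
  assumes "0 < s"
  obtains K where "\<And>r. K < r \<Longrightarrow> (real r / 2) powr s > C"
proof -
  define K where "K = nat \<lceil>2 * (\<bar>C\<bar> + 1) powr (1 / s)\<rceil>"
  have "(real r / 2) powr s > C" if "K < r" for r
  proof -
    have "2 * (\<bar>C\<bar> + 1) powr (1 / s) \<le> real r"
      using that real_nat_ceiling_ge [of "2 * (\<bar>C\<bar> + 1) powr (1 / s)"] unfolding K_def
      by linarith
    then have "((\<bar>C\<bar> + 1) powr (1 / s)) powr s \<le> (real r / 2) powr s"
      using assms by (intro powr_mono2) auto
    with assms show ?thesis by (simp add: powr_powr)
  qed
  then show thesis by (rule that)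
qed

lemma decseq_of_weight:
  assumes "decseq (\<lambda>n. real (Suc n) powr p * \<xi> n)" "q \<le> p" "\<And>n. 0 \<le> \<xi> n"
  shows "decseq (\<lambda>n. real (Suc n) powr q * \<xi> n)"
proof (rule decseq_SucI)
  fix n
  have eq: "real (Suc n) powr q * \<xi> n = real (Suc n) powr (q - p) * (real (Suc n) powr p * \<xi> n)" for n
    by (simp add: powr_add [symmetric] mult.assoc [symmetric] del: of_nat_Suc)
  show "real (Suc (Suc n)) powr q * \<xi> (Suc n) \<le> real (Suc n) powr q * \<xi> n"
    unfolding eq
  proof (rule mult_mono)
    show "real (Suc (Suc n)) powr (q - p) \<le> real (Suc n) powr (q - p)"
      using assms(2) by (intro powr_mono2') auto
    show "real (Suc (Suc n)) powr p * \<xi> (Suc n) \<le> real (Suc n) powr p * \<xi> n"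
      using decseqD [OF assms(1), of n "Suc n"] by simp
  qed (use assms(3) in auto)
qed

text \<open>Under a dilation by m the weight grows by a factor between 1 and m powr q, so passing to
  weighted sequences changes only the constant.\<close>

lemma dominated_weight:
  assumes "decseq (\<lambda>n. real (Suc n) powr q * \<xi> n)" "\<And>n. 0 \<le> \<xi> n" "0 \<le> q" "\<And>n. 0 \<le> \<eta> n"
  shows "dominated (\<lambda>n. real (Suc n) powr q * \<xi> n) (\<lambda>n. real (Suc n) powr q * \<eta> n) \<longleftrightarrow> dominated \<xi> \<eta>"
proof
  assume "dominated (\<lambda>n. real (Suc n) powr q * \<xi> n) (\<lambda>n. real (Suc n) powr q * \<eta> n)"
  then obtain m where m: "0 < m"
    "\<And>n. real (Suc (m * n)) powr q * \<xi> (m * n) \<le> real m * (real (Suc n) powr q * \<eta> n)"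
    by (auto simp: dominated_def)
  have "\<xi> (m * n) \<le> real m * \<eta> n" for n
  proof -
    have "real (Suc n) powr q * \<xi> (m * n) \<le> real (Suc (m * n)) powr q * \<xi> (m * n)"
      using m(1) assms(2,3) by (intro mult_right_mono powr_mono2) (auto simp: mult_le_cancel_right1)
    also have "\<dots> \<le> real (Suc n) powr q * (real m * \<eta> n)" using m(2) [of n] by (simp add: mult_ac)
    finally show ?thesis by (simp add: mult_le_cancel_left_pos del: of_nat_Suc)
  qed
  with m(1) show "dominated \<xi> \<eta>" by (auto simp: dominated_def)
next
  assume "dominated \<xi> \<eta>"
  then obtain m where m: "0 < m" "\<And>n. \<xi> (m * n) \<le> real m * \<eta> n" by (auto simp: dominated_def)
  show "dominated (\<lambda>n. real (Suc n) powr q * \<xi> n) (\<lambda>n. real (Suc n) powr q * \<eta> n)"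
  proof (rule dominatedI [where m = m and C = "real m powr q * real m"])
    fix n
    have "real (Suc (m * n)) \<le> real (m * Suc n)" using m(1) by (intro of_nat_mono) simp
    then have "real (Suc (m * n)) powr q * \<xi> (m * n) \<le> real (m * Suc n) powr q * (real m * \<eta> n)"
      using m assms by (intro mult_mono powr_mono2) auto
    also have "real (m * Suc n) powr q = real m powr q * real (Suc n) powr q"
      by (simp only: of_nat_mult powr_mult)
    finally show "real (Suc (m * n)) powr q * \<xi> (m * n) \<le> real m powr q * real m * (real (Suc n) powr q * \<eta> n)"
      by (simp only: mult_ac)
  qed (use m assms in auto)
qed

lemma unweight_c0_star:
  assumes "decseq Z" "\<And>n. 0 \<le> Z n" "0 \<le> q" "\<And>n. Z n \<le> real (Suc n) powr q * \<eta> n" "\<eta> \<longlonglongrightarrow> 0"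
  shows "(\<lambda>n. Z n / real (Suc n) powr q) \<in> c0_star"
proof -
  have "decseq (\<lambda>n. Z n / real (Suc n) powr q)"
    using assms decseqD [OF assms(1)] by (intro decseq_SucI frac_le powr_mono2) auto
  moreover have "(\<lambda>n. Z n / real (Suc n) powr q) \<longlonglongrightarrow> 0"
  proof (rule tendsto_sandwich [OF _ _ tendsto_const assms(5)])
    show "\<forall>\<^sub>F n in sequentially. Z n / real (Suc n) powr q \<le> \<eta> n"
      using assms(4) by (simp add: divide_le_eq mult.commute del: of_nat_Suc)
  qed (use assms in auto)
  ultimately show ?thesis using assms by (auto simp: c0_star_def)
qed

text \<open>The staircase is inserted between the weighted sequences. After division by the weight
  it is \<infinity>-regular because q > 1, which a staircase between the unweighted sequences would
  not guarantee.\<close>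

lemma weight_interpolate:
  assumes q: "1 < q"
    and \<xi>: "decseq (\<lambda>n. real (Suc n) powr q * \<xi> n)" "\<And>n. 0 \<le> \<xi> n" "\<xi> 0 > 0"
    and \<eta>: "decseq (\<lambda>n. real (Suc n) powr q * \<eta> n)" "\<And>n. \<xi> n \<le> \<eta> n" "\<eta> \<longlonglongrightarrow> 0"
    and nd: "\<not> dominated (\<lambda>n. real (Suc n) powr q * \<eta> n) (\<lambda>n. real (Suc n) powr q * \<xi> n)"
  obtains \<zeta> where "\<zeta> \<in> c0_star" "inf_regular \<zeta>" "\<And>n. \<xi> n \<le> \<zeta> n" "\<And>n. \<zeta> n \<le> \<eta> n"
    "\<not> dominated \<zeta> \<xi>" "\<not> dominated \<eta> \<zeta>"
proof -
  define w where "w n = real (Suc n) powr q" for n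
  have w0: "0 < w n" for n by (simp add: w_def)
  have \<eta>0: "0 \<le> \<eta> n" for n using \<xi>(2) \<eta>(2) order_trans by blast
  obtain Z where Z: "decseq Z" "\<And>n. w n * \<xi> n \<le> Z n" "\<And>n. Z n \<le> w n * \<eta> n"
      "\<not> dominated Z (\<lambda>n. w n * \<xi> n)" "\<not> dominated (\<lambda>n. w n * \<eta> n) Z"
  proof (rule dominated_interpolate)
    show "decseq (\<lambda>n. w n * \<xi> n)" "decseq (\<lambda>n. w n * \<eta> n)"
      "\<not> dominated (\<lambda>n. w n * \<eta> n) (\<lambda>n. w n * \<xi> n)"
      using \<xi>(1) \<eta>(1) nd by (simp_all add: w_def)
    show "0 \<le> w n * \<xi> n" "w n * \<xi> n \<le> w n * \<eta> n" for n
      using w0 [of n] \<xi>(2) \<eta>(2) by (auto intro!: mult_left_mono mult_nonneg_nonneg)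
    show "0 < w 0 * \<xi> 0" using w0 [of 0] \<xi>(3) by simp
  qed blast
  define \<zeta> where "\<zeta> n = Z n / w n" for n
  have wn0: "w n \<noteq> 0" for n using w0 [of n] by simp
  have Z0: "0 \<le> Z n" for n
    using w0 [of n] \<xi>(2) [of n] by (intro order_trans [OF _ Z(2)]) simp
  have c: "\<zeta> \<in> c0_star"
    unfolding \<zeta>_def w_def
  proof (rule unweight_c0_star [of _ _ \<eta>])
    show "Z n \<le> real (Suc n) powr q * \<eta> n" for n using Z(3) by (simp add: w_def)
  qed (use Z(1) Z0 q \<eta>(3) in auto)
  have Zw: "Z = (\<lambda>n. w n * \<zeta> n)" by (simp add: \<zeta>_def wn0)
  have \<zeta>0: "0 \<le> \<zeta> n" for n using c c0_starD by blast
  have Zdec: "decseq (\<lambda>n. real (Suc n) powr q * \<zeta> n)" using Z(1) by (simp add: Zw w_def)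
  have q0: "0 \<le> q" using q by simp
  show thesis
  proof (rule that [OF c])
    show "inf_regular \<zeta>"
      using q Zdec c by (rule weight_inf_regular)
    show "\<xi> n \<le> \<zeta> n" for n
      using Z(2) [of n] w0 [of n] by (simp add: \<zeta>_def pos_le_divide_eq mult.commute)
    show "\<zeta> n \<le> \<eta> n" for n
      using Z(3) [of n] w0 [of n] by (simp add: \<zeta>_def pos_divide_le_eq mult.commute)
    show "\<not> dominated \<zeta> \<xi>"
      using Z(4) dominated_weight [OF Zdec \<zeta>0 q0 \<xi>(2)] unfolding Zw w_def by simp
    show "\<not> dominated \<eta> \<zeta>"
      using Z(5) dominated_weight [OF \<eta>(1) \<eta>0 q0 \<zeta>0] unfolding Zw w_def by simp
  qed
qed

section \<open>Density for \<infinity>-regular sequences\<close>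

text \<open>If the running minimum \<open>Y\<close> of \<open>w e\<close> were dominated by
  \<open>w t\<close> with constant k, a witness \<open>e (k * r * a) > k * r * t a\<close> would
  give \<open>w a * t a \<le> Y (k * r * a) \<le> k * (w (r * a) * t (r * a))\<close>, against
  \<open>weight_decay\<close> for large r. So \<open>weight_interpolate\<close> applies between
  \<open>t\<close> and \<open>y = Y / w\<close>.\<close>

lemma inf_regular_upper_dense:
  assumes \<xi>: "\<xi> \<in> c0_star" "inf_regular \<xi>" "\<xi> 0 > 0"
    and \<eta>: "\<eta> \<in> c0_star" "dominated \<xi> \<eta>" "\<not> dominated \<eta> \<xi>"
  obtains \<zeta> where "\<zeta> \<in> c0_star" "inf_regular \<zeta>" "dominated \<xi> \<zeta>" "\<not> dominated \<zeta> \<xi>"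
    "dominated \<zeta> \<eta>" "\<not> dominated \<eta> \<zeta>"
proof -
  obtain p where p: "1 < p" and wdec: "decseq (\<lambda>n. real (Suc n) powr p * tail_mean \<xi> n)"
    using inf_regular_weight [OF \<xi>(1,2)] .
  \<comment> \<open>The tail mean is equivalent to \<xi> and, unlike \<xi> itself, is known to
    decrease after weighting.\<close>
  define t where "t = tail_mean \<xi>"
  define q where "q = (1 + p) / 2"
  have q: "1 < q" "q < p" using p by (auto simp: q_def)
  have sm: "summable \<xi>" and t\<xi>: "dominated t \<xi>" using \<xi>(2) by (auto simp: inf_regular_def t_def)
  have tc: "t \<in> c0_star" unfolding t_def by (rule tail_mean_c0_star [OF \<xi>(1) sm])
  note t0 = c0_starD(1) [OF tc]
  have \<xi>t: "dominated \<xi> t" unfolding t_def by (rule dominated_tail_mean [OF \<xi>(1) sm])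
  have t00: "t 0 > 0"
  proof -
    have "0 < \<xi> 0 + (\<Sum>j. \<xi> (j + Suc 0))"
      using \<xi>(3) tail_nonneg [OF sm c0_starD(1) [OF \<xi>(1)], of "Suc 0"] by linarith
    then show ?thesis using tail_Suc [OF sm, of 0] by (simp add: t_def tail_mean_def)
  qed
  obtain m where m: "0 < m" "\<And>n. t n \<le> real m * \<eta> (n div m)"
    using dominated_divE [OF dominated_trans [OF t\<xi> \<eta>(2)] c0_starD(2) [OF tc]] by blast
  \<comment> \<open>This multiple of an ampliation generates the same ideal as \<eta> and lies above
    \<open>t\<close> pointwise.\<close>
  define e where "e n = real m * \<eta> (n div m)" for n
  have edec: "decseq e"
    unfolding decseq_def e_def
    by (intro allI impI mult_left_mono decseqD [OF c0_starD(2) [OF \<eta>(1)]] div_le_mono) auto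
  have te: "t n \<le> e n" for n using m by (simp add: e_def)
  have e0: "0 \<le> e n" for n using t0 te order_trans by blast
  have elim: "e \<longlonglongrightarrow> 0"
  proof -
    have "filterlim (\<lambda>n. n div m) at_top sequentially"
      using m(1) by (rule filterlim_at_top_div_const_nat)
    then have "(\<lambda>n. real m * \<eta> (n div m)) \<longlonglongrightarrow> real m * 0"
      using c0_starD(3) [OF \<eta>(1)] by (intro tendsto_mult_left) (rule filterlim_compose)
    then show ?thesis by (simp add: e_def [abs_def])
  qed
  have e\<eta>: "dominated e \<eta>"
    using dominated_div [OF edec _ m(1), of \<eta> "real m"] c0_starD(1) [OF \<eta>(1)] by (auto simp: e_def)
  have \<eta>e: "dominated \<eta> e"
  proof (rule dominatedI [where m = m and C = 1])
    fix n
    have "\<eta> (m * n) \<le> \<eta> n" using m(1) by (intro decseqD [OF c0_starD(2) [OF \<eta>(1)]]) simp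
    also have "\<dots> \<le> real m * \<eta> n"
      using m(1) c0_starD(1) [OF \<eta>(1), of n] by (simp add: mult_le_cancel_right1)
    also have "\<dots> \<le> real m * \<eta> (n div m)"
      by (intro mult_left_mono decseqD [OF c0_starD(2) [OF \<eta>(1)]]) auto
    finally show "\<eta> (m * n) \<le> 1 * e n" by (simp add: e_def)
  qed (use m e0 \<eta>(1) c0_starD in auto)
  have net: "\<not> dominated e t" using \<eta>(3) \<eta>e t\<xi> dominated_trans by blast
  define w where "w n = real (Suc n) powr q" for n
  have w0: "0 < w n" for n by (simp add: w_def)
  have wmono: "w i \<le> w j" if "i \<le> j" for i j
    unfolding w_def using that q by (intro powr_mono2) auto
  define Y where "Y n = Min ((\<lambda>j. w j * e j) ` {..n})" for n
  have Yle: "Y n \<le> w j * e j" if "j \<le> n" for n j unfolding Y_def using that by (intro Min_le) auto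
  have Yge: "c \<le> Y n" if "\<And>j. j \<le> n \<Longrightarrow> c \<le> w j * e j" for n c unfolding Y_def using that by (subst Min_ge_iff) auto
  have Ydec: "decseq Y" unfolding decseq_def by (intro allI impI Yge Yle) auto
  have Xdec: "decseq (\<lambda>n. w n * t n)"
    unfolding w_def t_def using q t0 by (intro decseq_of_weight [OF wdec]) (auto simp: t_def)
  have XY: "w n * t n \<le> Y n" for n
  proof (rule Yge)
    fix j assume "j \<le> n"
    then have "w n * t n \<le> w j * t j" by (rule decseqD [OF Xdec])
    also have "\<dots> \<le> w j * e j" using w0 [of j] te by (intro mult_left_mono) auto
    finally show "w n * t n \<le> w j * e j" .
  qed
  define y where "y n = Y n / w n" for n
  have wn0: "w n \<noteq> 0" for n using w0 [of n] by simp
  have Yw: "w n * y n = Y n" for n by (simp add: y_def wn0)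
  have Y0: "0 \<le> Y n" for n using XY [of n] w0 [of n] t0 [of n] by (intro order_trans [OF _ XY]) simp
  have ye: "y n \<le> e n" for n
    using Yle [of n n] w0 [of n] by (simp add: y_def pos_divide_le_eq mult.commute)
  have ty: "t n \<le> y n" for n
    using XY [of n] w0 [of n] by (simp add: y_def pos_le_divide_eq mult.commute)
  have ylim: "y \<longlonglongrightarrow> 0"
    by (rule tendsto_sandwich [OF _ _ tendsto_const elim])
       (intro always_eventually allI ye order_trans [OF t0 ty])+
  have "\<not> dominated Y (\<lambda>n. w n * t n)"
  proof
    assume "dominated Y (\<lambda>n. w n * t n)"
    then obtain k where k: "0 < k" "\<And>n. Y (k * n) \<le> real k * (w n * t n)"
      by (auto simp: dominated_def)
    obtain K where K: "\<And>r. K < r \<Longrightarrow> (real r / 2) powr (p - q) > real k"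
      using eventually_powr_gt [of "p - q" "real k"] q by auto
    obtain r a where r: "K < r" "0 < a" "e (k * r * a) > real (k * r) * t a"
      using not_dominatedE [OF net edec t0 t00 k(1)] .
    have r0: "0 < r" using r(1) by simp
    \<comment> \<open>For j up to a, \<open>w e\<close> lies above the decreasing
      \<open>w t\<close>. From a to \<open>k * r * a\<close> the sequence \<open>e\<close> has not
      yet fallen below \<open>t a\<close>, while the weight increases.\<close>
    have le1: "w a * t a \<le> Y (k * r * a)"
    proof (rule Yge)
      fix j assume j: "j \<le> k * r * a"
      show "w a * t a \<le> w j * e j"
      proof (cases "j \<le> a")
        case True
        have "w a * t a \<le> w j * t j" using True by (rule decseqD [OF Xdec])
        also have "\<dots> \<le> w j * e j" using w0 [of j] te by (intro mult_left_mono) auto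
        finally show ?thesis .
      next
        case False
        have "1 * t a \<le> real (k * r) * t a"
          using k(1) r0 t0 by (intro mult_right_mono) (auto simp: Suc_le_eq simp flip: of_nat_mult)
        also have "\<dots> \<le> e (k * r * a)" using r(3) by simp
        also have "\<dots> \<le> e j" using j by (rule decseqD [OF edec])
        finally show ?thesis
          using False w0 [of a] w0 [of j] t0 [of a] by (intro mult_mono wmono) auto
      qed
    qed
    \<comment> \<open>This excludes that \<open>t\<close> vanishes at \<open>r * a\<close>, where
      multiplying the strict inequality from \<open>K\<close> would give only 0 = 0.\<close>
    have pos: "0 < Y (k * r * a)"
    proof -
      have "0 < e (k * r * a)" using r(3) t0 [of a] by (intro le_less_trans [OF _ r(3)]) simp
      also have "\<dots> \<le> Y (k * r * a)"
      proof (rule Yge)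
        fix j assume "j \<le> k * r * a"
        then have "e (k * r * a) \<le> e j" by (rule decseqD [OF edec])
        also have "\<dots> = w 0 * e j" by (simp add: w_def)
        also have "\<dots> \<le> w j * e j" using e0 by (intro mult_right_mono wmono) auto
        finally show "e (k * r * a) \<le> w j * e j" .
      qed
      finally show ?thesis .
    qed
    have "Y (k * r * a) \<le> real k * (w (r * a) * t (r * a))"
      using k(2) [of "r * a"] by (simp add: mult.assoc)
    moreover from this have pos': "0 < w (r * a) * t (r * a)"
      using pos k(1) by (metis less_le_trans of_nat_0_less_iff zero_less_mult_pos)
    moreover have "real k * (w (r * a) * t (r * a)) < (real r / 2) powr (p - q) * (w (r * a) * t (r * a))"
      using K [OF r(1)] pos' by (rule mult_strict_right_mono)
    moreover have "(real r / 2) powr (p - q) * (w (r * a) * t (r * a)) \<le> w a * t a"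
      unfolding w_def t_def using wdec q r r0 t0 by (intro weight_decay) (auto simp: t_def)
    ultimately show False using le1 by linarith
  qed
  then have nd: "\<not> dominated (\<lambda>n. real (Suc n) powr q * y n) (\<lambda>n. real (Suc n) powr q * t n)"
    using Yw by (simp add: w_def)
  obtain \<zeta> where \<zeta>: "\<zeta> \<in> c0_star" "inf_regular \<zeta>" "\<And>n. t n \<le> \<zeta> n" "\<And>n. \<zeta> n \<le> y n"
    "\<not> dominated \<zeta> t" "\<not> dominated y \<zeta>"
  proof (rule weight_interpolate [OF q(1) _ t0 t00 _ ty ylim nd])
    show "decseq (\<lambda>n. real (Suc n) powr q * t n)" using Xdec by (simp add: w_def)
    show "decseq (\<lambda>n. real (Suc n) powr q * y n)" using Ydec Yw by (simp add: w_def)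
  qed blast
  show thesis
  proof (rule that [OF \<zeta>(1,2)])
    show "dominated \<xi> \<zeta>" using \<xi>t dominated_le [of t \<zeta>] \<zeta>(3) dominated_trans by blast
    show "\<not> dominated \<zeta> \<xi>" using \<zeta>(5) \<xi>t dominated_trans by blast
    show "dominated \<zeta> \<eta>"
      using e\<eta> dominated_le [of \<zeta> y] dominated_le [of y e] \<zeta>(4) ye dominated_trans by blast
    show "\<not> dominated \<eta> \<zeta>"
      using \<zeta>(6) e\<eta> dominated_le [of y e] ye dominated_trans by blast
  qed
qed

text \<open>Dual to the upper case: a witness \<open>t N > k * r * e a\<close> with
  \<open>N = k * r * a\<close> gives \<open>X a \<le> w N * t N\<close>. Domination of
  \<open>w t\<close> by \<open>X\<close> at a would then bound its value at \<open>k * a\<close> by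
  k times its value at \<open>N = r * (k * a)\<close>, against \<open>weight_decay\<close>.\<close>

lemma inf_regular_lower_dense:
  assumes \<xi>: "\<xi> \<in> c0_star" "inf_regular \<xi>"
    and \<eta>: "\<eta> \<in> c0_star" "\<eta> 0 > 0" "dominated \<eta> \<xi>" "\<not> dominated \<xi> \<eta>"
  obtains \<zeta> where "\<zeta> \<in> c0_star" "inf_regular \<zeta>" "dominated \<eta> \<zeta>" "\<not> dominated \<zeta> \<eta>"
    "dominated \<zeta> \<xi>" "\<not> dominated \<xi> \<zeta>"
proof -
  obtain p where p: "1 < p" and wdec: "decseq (\<lambda>n. real (Suc n) powr p * tail_mean \<xi> n)"
    using inf_regular_weight [OF \<xi>(1,2)] .
  define t where "t = tail_mean \<xi>"
  define q where "q = (1 + p) / 2"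
  have q: "1 < q" "q < p" using p by (auto simp: q_def)
  have sm: "summable \<xi>" and t\<xi>: "dominated t \<xi>" using \<xi>(2) by (auto simp: inf_regular_def t_def)
  have tc: "t \<in> c0_star" unfolding t_def by (rule tail_mean_c0_star [OF \<xi>(1) sm])
  note t0 = c0_starD(1) [OF tc] and tdec = c0_starD(2) [OF tc]
  have \<xi>t: "dominated \<xi> t" unfolding t_def by (rule dominated_tail_mean [OF \<xi>(1) sm])
  obtain m where m: "0 < m" "\<And>n. \<eta> (m * n) \<le> real m * t n"
    using dominated_trans [OF \<eta>(3) \<xi>t] by (auto simp: dominated_def)
  \<comment> \<open>Compressing and scaling down \<eta> gives an equivalent sequence that lies below
    \<open>t\<close> pointwise.\<close>
  define e where "e n = \<eta> (m * n) / real m" for n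
  note \<eta>dec = c0_starD(2) [OF \<eta>(1)] and \<eta>0 = c0_starD(1) [OF \<eta>(1)]
  have et: "e n \<le> t n" for n using m(2) [of n] m(1) by (simp add: e_def divide_le_eq mult.commute)
  have e0: "0 \<le> e n" for n using \<eta>0 by (simp add: e_def)
  have e00: "0 < e 0" using \<eta>(2) m(1) by (simp add: e_def)
  have edec: "decseq e"
    unfolding decseq_def e_def by (intro allI impI divide_right_mono decseqD [OF \<eta>dec]) auto
  have e\<eta>: "dominated e \<eta>"
  proof (rule dominatedI [where m = m and C = 1])
    fix n
    have "e (m * n) \<le> \<eta> (m * (m * n)) / 1"
      unfolding e_def using m(1) \<eta>0 by (intro divide_left_mono) (auto simp: Suc_le_eq)
    also have "\<dots> \<le> 1 * \<eta> n"
      using m(1) by (simp add: decseqD [OF \<eta>dec])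
    finally show "e (m * n) \<le> 1 * \<eta> n" .
  qed (use edec \<eta>0 m in auto)
  have \<eta>e: "dominated \<eta> e" unfolding dominated_def using m(1) by (intro exI [of _ m]) (auto simp: e_def)
  have nte: "\<not> dominated t e" using \<eta>(4) \<xi>t e\<eta> dominated_trans by blast
  define w where "w n = real (Suc n) powr q" for n
  have w0: "0 < w n" for n by (simp add: w_def)
  have wn0: "w n \<noteq> 0" for n using w0 [of n] by simp
  have wmono: "w i \<le> w j" if "i \<le> j" for i j
    unfolding w_def using that q by (intro powr_mono2) auto
  have Ydec: "decseq (\<lambda>n. w n * t n)"
    unfolding w_def t_def using q t0 by (intro decseq_of_weight [OF wdec]) (auto simp: t_def)
  \<comment> \<open>The least decreasing majorant of \<open>w e\<close>; the supremum is finite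
    since \<open>w n * t n\<close> is an upper bound.\<close>
  define X where "X n = (SUP j\<in>{n..}. w j * e j)" for n
  have bnd: "w j * e j \<le> w n * t n" if "n \<le> j" for n j
  proof -
    have "w j * e j \<le> w j * t j" using w0 [of j] et by (intro mult_left_mono) auto
    also have "\<dots> \<le> w n * t n" using that by (rule decseqD [OF Ydec])
    finally show ?thesis .
  qed
  have bdd: "bdd_above ((\<lambda>j. w j * e j) ` {n..})" for n using bnd by (intro bdd_aboveI [of _ "w n * t n"]) auto
  have Xge: "w j * e j \<le> X n" if "n \<le> j" for n j unfolding X_def using that bdd by (intro cSUP_upper) auto
  have Xle: "X n \<le> c" if "\<And>j. n \<le> j \<Longrightarrow> w j * e j \<le> c" for n c unfolding X_def using that by (intro cSUP_least) auto
  have Xdec: "decseq X" unfolding decseq_def by (intro allI impI Xle Xge) auto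
  have XY: "X n \<le> w n * t n" for n by (intro Xle bnd)
  define x where "x n = X n / w n" for n
  have Xw: "w n * x n = X n" for n by (simp add: x_def wn0)
  have ex: "e n \<le> x n" for n
    using Xge [of n n] w0 [of n] by (simp add: x_def pos_le_divide_eq mult.commute)
  have xt: "x n \<le> t n" for n
    using XY [of n] w0 [of n] by (simp add: x_def pos_divide_le_eq mult.commute)
  have x0: "0 \<le> x n" for n using e0 ex order_trans by blast
  have x00: "0 < x 0" using e00 ex less_le_trans by blast
  have "\<not> dominated (\<lambda>n. w n * t n) X"
  proof
    assume "dominated (\<lambda>n. w n * t n) X"
    then obtain k where k: "0 < k" "\<And>n. w (k * n) * t (k * n) \<le> real k * X n"
      by (auto simp: dominated_def)
    obtain K where K: "\<And>r. K < r \<Longrightarrow> (real r / 2) powr (p - q) > real k"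
      using eventually_powr_gt [of "p - q" "real k"] q by auto
    obtain r a where r: "K < r" "0 < a" "t (k * r * a) > real (k * r) * e a"
      using not_dominatedE [OF nte tdec e0 e00 k(1)] .
    have r0: "0 < r" using r(1) by simp
    define N where "N = k * r * a"
    have tN: "e a \<le> t N"
    proof -
      have "1 * e a \<le> real (k * r) * e a"
        using k(1) r0 e0 by (intro mult_right_mono) (auto simp: Suc_le_eq simp flip: of_nat_mult)
      with r(3) show ?thesis by (simp add: N_def)
    qed
    have pos: "0 < t N" unfolding N_def using e0 [of a] by (intro le_less_trans [OF _ r(3)]) simp
    \<comment> \<open>From a up to \<open>N\<close> one has \<open>e j \<le> e a \<le> t N\<close>
      and a weight of at most \<open>w N\<close>; beyond \<open>N\<close> the decreasing
      \<open>w t\<close> takes over.\<close>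
    have "X a \<le> w N * t N"
    proof (rule Xle)
      fix j assume j: "a \<le> j"
      show "w j * e j \<le> w N * t N"
      proof (cases "j \<le> N")
        case True
        have "e j \<le> e a" using j by (rule decseqD [OF edec])
        with tN have "e j \<le> t N" by simp
        then show ?thesis using True w0 [of N] e0 by (intro mult_mono wmono) auto
      next
        case False
        then show ?thesis by (intro bnd) simp
      qed
    qed
    then have "real k * X a \<le> real k * (w N * t N)" by (intro mult_left_mono) auto
    with k(2) [of a] have "w (k * a) * t (k * a) \<le> real k * (w N * t N)" by simp
    also have "\<dots> < (real r / 2) powr (p - q) * (w N * t N)"
      using K [OF r(1)] pos w0 [of N] by (intro mult_strict_right_mono) auto
    also have "\<dots> = (real r / 2) powr (p - q) * (w (r * (k * a)) * t (r * (k * a)))"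
      by (simp add: N_def mult_ac)
    also have "\<dots> \<le> w (k * a) * t (k * a)"
      unfolding w_def t_def using wdec q r r0 t0 k by (intro weight_decay) (auto simp: t_def)
    finally show False by simp
  qed
  then have nd: "\<not> dominated (\<lambda>n. real (Suc n) powr q * t n) (\<lambda>n. real (Suc n) powr q * x n)"
    using Xw by (simp add: w_def)
  obtain \<zeta> where \<zeta>: "\<zeta> \<in> c0_star" "inf_regular \<zeta>" "\<And>n. x n \<le> \<zeta> n" "\<And>n. \<zeta> n \<le> t n"
    "\<not> dominated \<zeta> x" "\<not> dominated t \<zeta>"
  proof (rule weight_interpolate [OF q(1) _ x0 x00 _ xt c0_starD(3) [OF tc] nd])
    show "decseq (\<lambda>n. real (Suc n) powr q * t n)" using Ydec by (simp add: w_def)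
    show "decseq (\<lambda>n. real (Suc n) powr q * x n)" using Xdec Xw by (simp add: w_def)
  qed blast
  show thesis
  proof (rule that [OF \<zeta>(1,2)])
    show "dominated \<eta> \<zeta>"
      using \<eta>e dominated_le [of e x] dominated_le [of x \<zeta>] ex \<zeta>(3) dominated_trans by blast
    show "\<not> dominated \<zeta> \<eta>"
      using \<zeta>(5) \<eta>e dominated_le [of e x] ex dominated_trans by blast
    show "dominated \<zeta> \<xi>" using t\<xi> dominated_le [of \<zeta> t] \<zeta>(4) dominated_trans by blast
    show "\<not> dominated \<xi> \<zeta>" using \<zeta>(6) t\<xi> dominated_trans by blast
  qed
qed

section \<open>Orthogonal series in complex Hilbert spaces\<close>

lemma cinner_add_right: "cinner x (y + z) = cinner x y + cinner x z"
  by (metis cinner_commute cinner_add_left complex_cnj_add)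

lemma cinner_scaleC_right: "cinner x (c *\<^sub>C y) = cnj c * cinner x y"
  by (metis cinner_commute cinner_scaleC_left complex_cnj_mult)

lemma cinner_self: "cinner x x = complex_of_real ((norm x)\<^sup>2)"
proof (rule complex_eqI)
  show "Re (cinner x x) = Re (complex_of_real ((norm x)\<^sup>2))"
    by (simp add: inner_eq_Re_cinner [symmetric] power2_norm_eq_inner)
  have "Im (cinner x x) = - Im (cinner x x)"
    using arg_cong [OF cinner_commute [of x x], of Im] by simp
  then show "Im (cinner x x) = Im (complex_of_real ((norm x)\<^sup>2))" by simp
qed

lemma norm_scaleC: "norm (c *\<^sub>C x) = cmod c * norm x"
proof -
  have "complex_of_real ((norm (c *\<^sub>C x))\<^sup>2) = c * cnj c * complex_of_real ((norm x)\<^sup>2)"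
    by (simp only: cinner_self [symmetric] cinner_scaleC_left cinner_scaleC_right mult_ac)
  also have "\<dots> = complex_of_real ((cmod c * norm x)\<^sup>2)"
    by (simp add: complex_norm_square [symmetric] power_mult_distrib)
  finally have "(norm (c *\<^sub>C x))\<^sup>2 = (cmod c * norm x)\<^sup>2"
    by (simp only: of_real_eq_iff)
  then show ?thesis by (simp add: power2_eq_iff_nonneg)
qed

text \<open>Multiplying x by a number of modulus 1 makes the product real and nonnegative, which
  reduces the claim to the real Cauchy-Schwarz inequality.\<close>

lemma norm_cinner_le: "cmod (cinner x y) \<le> norm x * norm y"
proof (cases "cinner x y = 0")
  case False
  define u where "u = cinner x y"
  define c where "c = cnj u / complex_of_real (cmod u)"
  have u: "cmod u \<noteq> 0" using False by (simp add: u_def)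
  have c1: "cmod c = 1" using u by (simp add: c_def norm_divide)
  have "cinner (c *\<^sub>C x) y = cnj u * u / complex_of_real (cmod u)"
    by (simp add: cinner_scaleC_left c_def u_def)
  also have "\<dots> = complex_of_real (cmod u)"
    using u by (simp add: mult.commute [of "cnj u"] complex_norm_square [symmetric] power2_eq_square)
  finally have "inner (c *\<^sub>C x) y = cmod u" by (simp add: inner_eq_Re_cinner)
  with norm_cauchy_schwarz [of "c *\<^sub>C x" y] show ?thesis by (simp add: norm_scaleC c1 u_def)
qed simp

lemma bounded_bilinear_cinner: "bounded_bilinear (cinner :: 'a::complex_hilbert \<Rightarrow> 'a \<Rightarrow> complex)"
proof
  show "\<exists>K. \<forall>a b. cmod (cinner (a::'a) b) \<le> norm a * norm b * K"
    by (intro exI [of _ 1]) (simp add: norm_cinner_le)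
qed (simp_all add: cinner_add_left cinner_add_right scaleR_scaleC cinner_scaleC_left cinner_scaleC_right scaleR_conv_of_real)

lemma bounded_bilinear_scaleC: "bounded_bilinear (scaleC :: complex \<Rightarrow> 'a::complex_hilbert \<Rightarrow> 'a)"
proof
  show "\<exists>K. \<forall>a b. norm (a *\<^sub>C (b::'a)) \<le> norm a * norm b * K"
    by (intro exI [of _ 1]) (simp add: norm_scaleC)
qed (simp_all add: scaleC_add_left scaleC_add_right scaleR_scaleC scaleC_scaleC scaleR_conv_of_real mult.commute)

global_interpretation cinner: bounded_bilinear "cinner :: 'a::complex_hilbert \<Rightarrow> 'a \<Rightarrow> complex"
  by (rule bounded_bilinear_cinner)

global_interpretation scaleC: bounded_bilinear "scaleC :: complex \<Rightarrow> 'a::complex_hilbert \<Rightarrow> 'a"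
  by (rule bounded_bilinear_scaleC)

lemma cinner_eqI:
  assumes "\<And>x. cinner x a = cinner x b"
  shows "a = b"
proof -
  have "cinner (a - b) (a - b) = 0" using assms by (simp add: cinner.diff_right)
  then show ?thesis by (simp add: cinner_self)
qed

definition orth_seq :: "(nat \<Rightarrow> 'a::complex_hilbert) \<Rightarrow> bool" where
  "orth_seq g \<longleftrightarrow> (\<forall>m n. m \<noteq> n \<longrightarrow> cinner (g m) (g n) = 0)"

definition orthonormal_seq :: "(nat \<Rightarrow> 'a::complex_hilbert) \<Rightarrow> bool" where
  "orthonormal_seq e \<longleftrightarrow> orth_seq e \<and> (\<forall>n. norm (e n) = 1)"

lemma norm_orth_sum:
  assumes "orth_seq g" "finite A"
  shows "(norm (\<Sum>i\<in>A. c i *\<^sub>C g i))\<^sup>2 = (\<Sum>i\<in>A. (cmod (c i))\<^sup>2 * (norm (g i))\<^sup>2)"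
proof -
  have "(norm (\<Sum>i\<in>A. c i *\<^sub>C g i))\<^sup>2 = (\<Sum>i\<in>A. (norm (c i *\<^sub>C g i))\<^sup>2)"
    using assms by (intro norm_sum_Pythagorean)
      (auto simp: pairwise_def orthogonal_def inner_eq_Re_cinner cinner_scaleC_left cinner_scaleC_right orth_seq_def)
  then show ?thesis by (simp add: norm_scaleC power_mult_distrib)
qed

text \<open>With \<open>a = inner x s\<close> and, by Pythagoras,
  \<open>(norm s)\<^sup>2 \<le> B\<^sup>2 * a\<close>, Cauchy-Schwarz bounds a. A bound
  \<open>B\<close> in place of unit norms covers the images \<open>X (e n)\<close>, which play the
  role of \<open>e\<close> in the adjoint.\<close>

lemma bessel:
  assumes e: "orth_seq e" "\<And>n. norm (e n) \<le> B" and A: "finite A"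
  shows "(\<Sum>i\<in>A. (cmod (cinner x (e i)))\<^sup>2) \<le> B\<^sup>2 * (norm x)\<^sup>2"
proof -
  define a where "a = (\<Sum>i\<in>A. (cmod (cinner x (e i)))\<^sup>2)"
  define s where "s = (\<Sum>i\<in>A. cinner x (e i) *\<^sub>C e i)"
  have a0: "0 \<le> a" by (simp add: a_def sum_nonneg)
  have "cinner x s = complex_of_real a"
    by (simp add: s_def a_def cinner.sum_right cinner_scaleC_right mult.commute [of "cnj _"] complex_norm_square del: of_real_power)
  then have "a = inner x s" by (simp add: inner_eq_Re_cinner)
  also have "\<dots> \<le> norm x * norm s" by (rule norm_cauchy_schwarz)
  finally have "a\<^sup>2 \<le> (norm x)\<^sup>2 * (norm s)\<^sup>2"
    using a0 by (simp add: power_mono flip: power_mult_distrib)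
  also have "\<dots> \<le> (norm x)\<^sup>2 * (B\<^sup>2 * a)"
  proof (rule mult_left_mono)
    show "(norm s)\<^sup>2 \<le> B\<^sup>2 * a"
      unfolding s_def norm_orth_sum [OF e(1) A] a_def sum_distrib_left
    proof (rule sum_mono)
      fix i
      have "(norm (e i))\<^sup>2 \<le> B\<^sup>2" using e(2) by (intro power_mono) auto
      then show "(cmod (cinner x (e i)))\<^sup>2 * (norm (e i))\<^sup>2 \<le> B\<^sup>2 * (cmod (cinner x (e i)))\<^sup>2"
        by (subst mult.commute) (rule mult_right_mono, auto)
    qed
  qed simp
  finally have "a * a \<le> (B\<^sup>2 * (norm x)\<^sup>2) * a"
    by (simp add: power2_eq_square [of a] mult_ac)
  then show ?thesis unfolding a_def [symmetric]
    using a0 by (cases "a = 0") auto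
qed

lemma summable_orth:
  assumes g: "orth_seq g" "\<And>n. norm (g n) \<le> B" and c: "summable (\<lambda>n. (cmod (c n))\<^sup>2)"
  shows "summable (\<lambda>n. c n *\<^sub>C g n)"
  unfolding summable_Cauchy
proof (intro allI impI)
  fix \<epsilon> :: real assume \<epsilon>: "0 < \<epsilon>"
  define B' where "B' = \<bar>B\<bar> + 1"
  have B': "0 < B'" "norm (g n) \<le> B'" for n
    using g(2) [of n] unfolding B'_def by linarith+
  have "0 < (\<epsilon> / B')\<^sup>2" using \<epsilon> B' by simp
  with c obtain N where N: "\<And>m n. m \<ge> N \<Longrightarrow> norm (\<Sum>i=m..<n. (cmod (c i))\<^sup>2) < (\<epsilon> / B')\<^sup>2"
    unfolding summable_Cauchy by blast
  have "norm (\<Sum>i=m..<n. c i *\<^sub>C g i) < \<epsilon>" if m: "m \<ge> N" for m n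
  proof -
    have "(norm (\<Sum>i=m..<n. c i *\<^sub>C g i))\<^sup>2 = (\<Sum>i=m..<n. (cmod (c i))\<^sup>2 * (norm (g i))\<^sup>2)"
      by (rule norm_orth_sum [OF g(1)]) simp
    also have "\<dots> \<le> (\<Sum>i=m..<n. (cmod (c i))\<^sup>2 * B'\<^sup>2)"
      using B' by (intro sum_mono mult_left_mono power_mono) auto
    also have "\<dots> = (\<Sum>i=m..<n. (cmod (c i))\<^sup>2) * B'\<^sup>2" by (simp add: sum_distrib_right)
    also have "\<dots> < (\<epsilon> / B')\<^sup>2 * B'\<^sup>2"
      using N [OF m, of n] B' by (intro mult_strict_right_mono) auto
    also have "\<dots> = \<epsilon>\<^sup>2" using B' by (simp add: power_divide)
    finally show ?thesis using \<epsilon> by (simp add: power2_less_imp_less)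
  qed
  then show "\<exists>N. \<forall>m\<ge>N. \<forall>n. norm (\<Sum>i=m..<n. c i *\<^sub>C g i) < \<epsilon>" by blast
qed

definition bdd_orth :: "(nat \<Rightarrow> 'a::complex_hilbert) \<Rightarrow> bool" where
  "bdd_orth g \<longleftrightarrow> orth_seq g \<and> bounded (range g)"

lemma bdd_orthE:
  assumes "bdd_orth g"
  obtains B where "0 < B" "orth_seq g" "\<And>n. norm (g n) \<le> B"
  using assms unfolding bdd_orth_def bounded_pos by auto

lemma bdd_orthI:
  assumes "orth_seq g" "\<And>n. norm (g n) \<le> B"
  shows "bdd_orth g"
  using assms unfolding bdd_orth_def bounded_iff by (auto intro!: exI [of _ B])

lemma bdd_orth_shift:
  assumes "bdd_orth g"
  shows "bdd_orth (\<lambda>n. g (n + N))"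
proof -
  obtain B where "orth_seq g" "\<And>n. norm (g n) \<le> B" using assms by (metis bdd_orthE)
  then show ?thesis by (intro bdd_orthI [where B = B]) (auto simp: orth_seq_def)
qed

lemma orthonormal_bdd: "orthonormal_seq e \<Longrightarrow> bdd_orth e"
  unfolding orthonormal_seq_def by (rule bdd_orthI [where B = 1]) auto

text \<open>The singular values are kept inside \<open>g\<close>: with \<open>g n = X (e n)\<close>
  no unit left singular vectors have to be invented where the singular value is 0.\<close>

definition schmidt :: "(nat \<Rightarrow> 'a) \<Rightarrow> (nat \<Rightarrow> 'a) \<Rightarrow> 'a \<Rightarrow> 'a::complex_hilbert" where
  "schmidt e g x = (\<Sum>n. cinner x (e n) *\<^sub>C g n)"

lemma schmidt_sums:
  assumes "bdd_orth e" "bdd_orth g"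
  shows "(\<lambda>n. cinner x (e n) *\<^sub>C g n) sums schmidt e g x"
proof -
  obtain B where B: "orth_seq g" "\<And>n. norm (g n) \<le> B" using assms(2) by (metis bdd_orthE)
  obtain A where A: "orth_seq e" "\<And>n. norm (e n) \<le> A" using assms(1) by (metis bdd_orthE)
  have "summable (\<lambda>n. (cmod (cinner x (e n)))\<^sup>2)"
    using bessel [OF A, of "{..<_}" x] by (intro summableI_nonneg_bounded) auto
  then show ?thesis unfolding schmidt_def by (intro summable_sums summable_orth [OF B])
qed

text \<open>Only those \<open>g n\<close> that x meets have to be bounded by c. This gives the
  boundedness of the operator, small remainders, and the estimate on the complement of the leading
  vectors in \<open>svd_upper\<close>.\<close>

lemma norm_schmidt_le:
  assumes "bdd_orth e" "bdd_orth g" and A: "\<And>n. norm (e n) \<le> A"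
    and c: "\<And>n. cinner x (e n) = 0 \<or> norm (g n) \<le> c" "0 \<le> c"
  shows "norm (schmidt e g x) \<le> c * A * norm x"
proof -
  have A0: "0 \<le> A" using A [of 0] norm_ge_zero [of "e 0"] by linarith
  have oe: "orth_seq e" and og: "orth_seq g" using assms by (auto simp: bdd_orth_def)
  have "(norm (\<Sum>i<n. cinner x (e i) *\<^sub>C g i))\<^sup>2 \<le> (c * A * norm x)\<^sup>2" for n
  proof -
    have "(norm (\<Sum>i<n. cinner x (e i) *\<^sub>C g i))\<^sup>2 = (\<Sum>i<n. (cmod (cinner x (e i)))\<^sup>2 * (norm (g i))\<^sup>2)"
      by (rule norm_orth_sum [OF og]) simp
    also have "\<dots> \<le> (\<Sum>i<n. (cmod (cinner x (e i)))\<^sup>2 * c\<^sup>2)"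
    proof (rule sum_mono)
      fix i show "(cmod (cinner x (e i)))\<^sup>2 * (norm (g i))\<^sup>2 \<le> (cmod (cinner x (e i)))\<^sup>2 * c\<^sup>2"
        using c(1) [of i] by (cases "cinner x (e i) = 0") (simp_all add: mult_left_mono power_mono)
    qed
    also have "\<dots> = c\<^sup>2 * (\<Sum>i<n. (cmod (cinner x (e i)))\<^sup>2)" by (simp add: sum_distrib_left mult.commute)
    also have "\<dots> \<le> c\<^sup>2 * (A\<^sup>2 * (norm x)\<^sup>2)" by (intro mult_left_mono bessel oe A) auto
    finally show ?thesis by (simp add: power_mult_distrib)
  qed
  then have le: "norm (\<Sum>i<n. cinner x (e i) *\<^sub>C g i) \<le> c * A * norm x" for n
    by (rule power2_le_imp_le) (simp add: A0 c(2))
  have "(\<lambda>n. \<Sum>i<n. cinner x (e i) *\<^sub>C g i) \<longlonglongrightarrow> schmidt e g x"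
    using schmidt_sums [OF assms(1,2)] by (simp add: sums_def)
  from tendsto_norm [OF this] show ?thesis by (rule LIMSEQ_le_const2) (use le in auto)
qed

lemma bounded_opsD:
  assumes "X \<in> bounded_ops"
  shows "bounded_linear X" "X (c *\<^sub>C x) = c *\<^sub>C X x" "X (x + y) = X x + X y"
    "X (x - y) = X x - X y" "X (sum f S) = (\<Sum>i\<in>S. X (f i))" "X 0 = 0"
proof -
  show bl: "bounded_linear X" "X (c *\<^sub>C x) = c *\<^sub>C X x" using assms by (auto simp: bounded_ops_def)
  interpret bounded_linear X by fact
  show "X (x + y) = X x + X y" "X (x - y) = X x - X y" "X (sum f S) = (\<Sum>i\<in>S. X (f i))" "X 0 = 0"
    by (rule add diff sum zero)+
qed

lemma bounded_opsE:
  assumes "X \<in> bounded_ops"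
  obtains K where "0 < K" "\<And>x. norm (X x) \<le> K * norm x"
proof -
  obtain K where "0 < K" "\<And>x. norm (X x) \<le> norm x * K"
    using bounded_linear.pos_bounded [OF bounded_opsD(1) [OF assms]] by blast
  then show thesis by (intro that [of K]) (simp_all add: mult.commute)
qed

lemma schmidt_bounded_ops:
  assumes "bdd_orth e" "bdd_orth g"
  shows "schmidt e g \<in> bounded_ops"
proof -
  note S = schmidt_sums [OF assms]
  have add: "schmidt e g (x + y) = schmidt e g x + schmidt e g y" for x y
  proof (rule sums_unique2 [OF S])
    show "(\<lambda>n. cinner (x + y) (e n) *\<^sub>C g n) sums (schmidt e g x + schmidt e g y)"
      using sums_add [OF S [of x] S [of y]] by (simp only: cinner_add_left scaleC_add_left)
  qed
  have scale: "schmidt e g (c *\<^sub>C x) = c *\<^sub>C schmidt e g x" for c x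
  proof (rule sums_unique2 [OF S])
    show "(\<lambda>n. cinner (c *\<^sub>C x) (e n) *\<^sub>C g n) sums (c *\<^sub>C schmidt e g x)"
      using bounded_linear.sums [OF scaleC.bounded_linear_right [of c] S [of x]]
      by (simp only: cinner_scaleC_left scaleC_scaleC)
  qed
  obtain A where A: "0 < A" "\<And>n. norm (e n) \<le> A" using assms(1) by (metis bdd_orthE)
  obtain B where B: "0 < B" "\<And>n. norm (g n) \<le> B" using assms(2) by (metis bdd_orthE)
  have le: "norm (schmidt e g x) \<le> norm x * (B * A)" for x
    using norm_schmidt_le [OF assms A(2), of x B] B by (simp add: mult_ac)
  have "bounded_linear (schmidt e g)"
  proof (rule bounded_linear_intro [where f = "schmidt e g" and K = "B * A"])
    show "schmidt e g (r *\<^sub>R x) = r *\<^sub>R schmidt e g x" for r x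
      by (simp only: scaleR_scaleC scale)
  qed (fact add le)+
  then show ?thesis by (simp add: bounded_ops_def scale)
qed

lemma schmidt_adjoint:
  assumes "bdd_orth e" "bdd_orth g"
  shows "cinner (schmidt e g x) y = cinner x (schmidt g e y)"
proof -
  have "(\<lambda>n. cinner (cinner x (e n) *\<^sub>C g n) y) sums cinner (schmidt e g x) y"
    by (rule bounded_linear.sums [OF cinner.bounded_linear_left schmidt_sums [OF assms]])
  moreover have "(\<lambda>n. cinner x (cinner y (g n) *\<^sub>C e n)) sums cinner x (schmidt g e y)"
    by (rule bounded_linear.sums [OF cinner.bounded_linear_right schmidt_sums [OF assms(2,1)]])
  moreover have "cinner (cinner x (e n) *\<^sub>C g n) y = cinner x (cinner y (g n) *\<^sub>C e n)" for n
    by (simp add: cinner_scaleC_left cinner_scaleC_right cinner_commute [of "g n" y] mult.commute)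
  ultimately show ?thesis using sums_unique2 by simp
qed

lemma schmidt_single:
  assumes "\<And>m. m \<noteq> n \<Longrightarrow> cinner x (e m) = 0"
  shows "schmidt e g x = cinner x (e n) *\<^sub>C g n"
proof -
  have "schmidt e g x = (\<Sum>i\<in>{n}. cinner x (e i) *\<^sub>C g i)"
    unfolding schmidt_def by (intro suminf_finite) (auto simp: assms)
  then show ?thesis by simp
qed

lemma schmidt_orthonormal:
  assumes "orthonormal_seq e"
  shows "schmidt e g (e n) = g n"
  using assms by (subst schmidt_single [where n = n]) (auto simp: orthonormal_seq_def orth_seq_def cinner_self)

text \<open>Total boundedness: a finite \<epsilon>/4-net of K, two approximations of \<epsilon>/4
  each and the triangle inequality give a finite \<epsilon>-net of the closed image.\<close>

lemma compact_opsI: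
  fixes X :: "'a::complex_hilbert \<Rightarrow> 'a"
  assumes X: "X \<in> bounded_ops"
    and ap: "\<And>\<epsilon>. 0 < \<epsilon> \<Longrightarrow> \<exists>K. compact K \<and> (\<forall>x. norm x \<le> 1 \<longrightarrow> (\<exists>y\<in>K. dist (X x) y \<le> \<epsilon>))"
  shows "X \<in> compact_ops"
proof -
  have "\<exists>k. finite k \<and> closure (X ` cball 0 1) \<subseteq> (\<Union>x\<in>k. ball x \<epsilon>)" if \<epsilon>: "0 < \<epsilon>" for \<epsilon>
  proof -
    obtain K where K: "compact K" "\<And>x. norm x \<le> 1 \<Longrightarrow> \<exists>y\<in>K. dist (X x) y \<le> \<epsilon> / 4"
      using ap [of "\<epsilon> / 4"] \<epsilon> by auto
    obtain k where k: "finite k" "K \<subseteq> (\<Union>x\<in>k. ball x (\<epsilon> / 4))"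
      using K(1) \<epsilon> unfolding compact_eq_totally_bounded by (meson zero_less_divide_iff zero_less_numeral)
    have "z \<in> (\<Union>x\<in>k. ball x \<epsilon>)" if z: "z \<in> closure (X ` cball 0 1)" for z
    proof -
      obtain x where x: "norm x \<le> 1" "dist (X x) z < \<epsilon> / 4"
        using z \<epsilon> unfolding closure_approachable by (force dest!: spec [of _ "\<epsilon> / 4"])
      obtain y where y: "y \<in> K" "dist (X x) y \<le> \<epsilon> / 4" using K(2) [OF x(1)] by blast
      obtain w where w: "w \<in> k" "dist w y < \<epsilon> / 4" using k(2) y(1) by auto
      have "dist w z \<le> dist w y + dist (X x) y + dist (X x) z"
        using dist_triangle [of w z y] dist_triangle [of y z "X x"] by (simp add: dist_commute)
      then have "dist w z < \<epsilon>" using x(2) y(2) w(2) \<epsilon> by simp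
      with w show ?thesis by auto
    qed
    with k(1) show ?thesis by blast
  qed
  then have "compact (closure (X ` cball 0 1))"
    unfolding compact_eq_totally_bounded by (auto simp: complete_eq_closed)
  with X show ?thesis by (simp add: compact_ops_def)
qed

lemma compact_coefficient_sums:
  fixes g :: "nat \<Rightarrow> 'a::complex_hilbert"
  shows "\<exists>K. compact K \<and> (\<forall>c. (\<forall>i. cmod (c i) \<le> A) \<longrightarrow> (\<Sum>i<N. c i *\<^sub>C g i) \<in> K)"
proof (induction N)
  case 0
  show ?case by (intro exI [of _ "{0}"]) auto
next
  case (Suc N)
  then obtain K where K: "compact K" "\<And>c. \<forall>i. cmod (c i) \<le> A \<Longrightarrow> (\<Sum>i<N. c i *\<^sub>C g i) \<in> K" by blast
  define L where "L = (\<lambda>c. c *\<^sub>C g N) ` cball 0 A"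
  have "compact L" unfolding L_def
    by (intro compact_continuous_image linear_continuous_on scaleC.bounded_linear_left compact_cball)
  then have "compact {x + y |x y. x \<in> K \<and> y \<in> L}" by (rule compact_sums [OF K(1)])
  moreover have "(\<Sum>i<Suc N. c i *\<^sub>C g i) \<in> {x + y |x y. x \<in> K \<and> y \<in> L}" if "\<forall>i. cmod (c i) \<le> A" for c
  proof -
    have "c N *\<^sub>C g N \<in> L" using that by (auto simp: L_def)
    with K(2) [OF that] show ?thesis by auto
  qed
  ultimately show ?case by blast
qed

text \<open>The first N terms send the unit ball into a compact set, and the remainder is again a
  Schmidt series, with uniformly small \<open>g\<close>.\<close>

lemma schmidt_compact:
  fixes g :: "nat \<Rightarrow> 'a::complex_hilbert"
  assumes "bdd_orth e" "bdd_orth g" and lim: "(\<lambda>n. norm (g n)) \<longlonglongrightarrow> 0"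
  shows "schmidt e g \<in> compact_ops"
proof (rule compact_opsI [OF schmidt_bounded_ops [OF assms(1,2)]])
  fix \<epsilon> :: real assume \<epsilon>: "0 < \<epsilon>"
  obtain A where A: "0 < A" "\<And>n. norm (e n) \<le> A" using assms(1) by (metis bdd_orthE)
  have "0 < \<epsilon> / A" using A \<epsilon> by simp
  with lim have "\<forall>\<^sub>F n in sequentially. norm (g n) < \<epsilon> / A" by (rule order_tendstoD)
  then obtain N where N: "\<And>n. N \<le> n \<Longrightarrow> norm (g n) < \<epsilon> / A"
    unfolding eventually_sequentially by blast
  obtain K where K: "compact K" "\<And>c. \<forall>i. cmod (c i) \<le> A \<Longrightarrow> (\<Sum>i<N. c i *\<^sub>C g i) \<in> K"
    using compact_coefficient_sums [of A g N] by blast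
  have sh: "bdd_orth (\<lambda>n. e (n + N))" "bdd_orth (\<lambda>n. g (n + N))"
    using assms(1,2) by (auto intro: bdd_orth_shift)
  have "\<exists>y\<in>K. dist (schmidt e g x) y \<le> \<epsilon>" if x: "norm x \<le> 1" for x
  proof
    have "cmod (cinner x (e i)) \<le> A" for i
      using norm_cinner_le [of x "e i"] A(2) [of i] mult_mono [OF x A(2) [of i]] by simp
    then show "(\<Sum>i<N. cinner x (e i) *\<^sub>C g i) \<in> K" by (intro K(2)) auto
    have "schmidt e g x = schmidt (\<lambda>n. e (n + N)) (\<lambda>n. g (n + N)) x + (\<Sum>i<N. cinner x (e i) *\<^sub>C g i)"
      unfolding schmidt_def using schmidt_sums [OF assms(1,2)] by (intro suminf_split_initial_segment) (rule sums_summable)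
    then have "dist (schmidt e g x) (\<Sum>i<N. cinner x (e i) *\<^sub>C g i) = norm (schmidt (\<lambda>n. e (n + N)) (\<lambda>n. g (n + N)) x)"
      by (simp add: dist_norm)
    also have "\<dots> \<le> \<epsilon> / A * A * norm x"
      using N A \<epsilon> by (intro norm_schmidt_le [OF sh]) (auto simp: less_imp_le)
    also have "\<dots> \<le> \<epsilon>" using A \<epsilon> x by (simp add: mult_left_le)
    finally show "dist (schmidt e g x) (\<Sum>i<N. cinner x (e i) *\<^sub>C g i) \<le> \<epsilon>" .
  qed
  with K(1) show "\<exists>K. compact K \<and> (\<forall>x. norm x \<le> 1 \<longrightarrow> (\<exists>y\<in>K. dist (schmidt e g x) y \<le> \<epsilon>))" by blast
qed

section \<open>Singular value decomposition\<close>

lemma compact_ops_bounded: "X \<in> compact_ops \<Longrightarrow> X \<in> bounded_ops"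
  by (simp add: compact_ops_def)

lemma compact_ops_subseq:
  fixes X :: "'a::complex_hilbert \<Rightarrow> 'a"
  assumes "X \<in> compact_ops" "\<And>n. norm (x n) \<le> 1"
  obtains r y where "strict_mono (r :: nat \<Rightarrow> nat)" "(\<lambda>n. X (x (r n))) \<longlonglongrightarrow> y"
proof -
  have "compact (closure (X ` cball 0 1))" using assms(1) by (simp add: compact_ops_def)
  moreover have "\<forall>n. X (x n) \<in> closure (X ` cball 0 1)"
    using assms(2) by (intro allI subsetD [OF closure_subset]) auto
  ultimately obtain l r where "strict_mono (r :: nat \<Rightarrow> nat)" "((\<lambda>n. X (x n)) \<circ> r) \<longlonglongrightarrow> l"
    unfolding compact_def by metis
  then show thesis using that by (simp add: comp_def)
qed

text \<open>By compactness \<open>X u\<^sub>n\<close> converges for a maximising sequence of unit vectors, and by the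
  parallelogram law this forces \<open>u\<^sub>n\<close> itself to converge; no adjoint is needed.\<close>

lemma maximiser_exists:
  fixes X :: "'a::complex_hilbert \<Rightarrow> 'a"
  assumes X: "X \<in> compact_ops" and "closed E"
    and add: "\<And>x y. x \<in> E \<Longrightarrow> y \<in> E \<Longrightarrow> x + y \<in> E" and scale: "\<And>c x. x \<in> E \<Longrightarrow> c *\<^sub>C x \<in> E"
    and v: "v \<in> E" "v \<noteq> 0"
  obtains x where "x \<in> E" "norm x = 1" "\<And>z. z \<in> E \<Longrightarrow> norm (X z) \<le> norm (X x) * norm z"
proof -
  note Xb = compact_ops_bounded [OF X]
  interpret X: bounded_linear X by (rule bounded_opsD(1) [OF Xb])
  have scaleR: "r *\<^sub>R x \<in> E" if "x \<in> E" for r x using scale [OF that] by (simp add: scaleR_scaleC)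
  define S where "S = {norm (X x) |x. x \<in> E \<and> norm x = 1}"
  define s where "s = Sup S"
  obtain K where K: "0 < K" "\<And>x. norm (X x) \<le> K * norm x" using bounded_opsE [OF Xb] by blast
  have bdd: "bdd_above S" unfolding S_def
  proof (rule bdd_aboveI [of _ K])
    fix t assume "t \<in> {norm (X x) |x. x \<in> E \<and> norm x = 1}"
    then obtain x where "norm x = 1" "t = norm (X x)" by auto
    with K(2) [of x] show "t \<le> K" by simp
  qed
  define v' where "v' = (1 / norm v) *\<^sub>R v"
  have v': "v' \<in> E" "norm v' = 1" using v by (auto simp: v'_def scaleR)
  then have ne: "S \<noteq> {}" by (auto simp: S_def)
  have up: "norm (X x) \<le> s" if "x \<in> E" "norm x = 1" for x
    unfolding s_def using that bdd by (intro cSup_upper) (auto simp: S_def)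
  have s0: "0 \<le> s" by (rule order_trans [OF norm_ge_zero up [OF v']])
  have le: "norm (X z) \<le> s * norm z" if z: "z \<in> E" for z
  proof (cases "z = 0")
    case False
    have "norm (X ((1 / norm z) *\<^sub>R z)) \<le> s" using False by (intro up scaleR z) simp
    with False show ?thesis by (simp add: X.scaleR field_simps)
  qed (simp add: X.zero)
  show thesis
  proof (cases "s = 0")
    case True
    show thesis
    proof (rule that [OF v'])
      fix z assume "z \<in> E"
      with le [of z] True show "norm (X z) \<le> norm (X v') * norm z" by simp
    qed
  next
    case False
    with s0 have s: "0 < s" by simp
    have "\<exists>x. x \<in> E \<and> norm x = 1 \<and> norm (X x) > s - inverse (real (Suc n))" for n
    proof -
      have "s - inverse (real (Suc n)) < Sup S" by (simp add: s_def)
      then show ?thesis unfolding less_cSup_iff [OF ne bdd] by (auto simp: S_def)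
    qed
    then obtain x where x: "\<And>n. x n \<in> E" "\<And>n. norm (x n) = 1" "\<And>n. norm (X (x n)) > s - inverse (real (Suc n))"
      by metis
    obtain r y where r: "strict_mono (r :: nat \<Rightarrow> nat)" and y: "(\<lambda>n. X (x (r n))) \<longlonglongrightarrow> y"
      using compact_ops_subseq [OF X, of x] x(2) by (metis order_refl)
    define u where "u n = x (r n)" for n
    have u: "u n \<in> E" "norm (u n) = 1" for n using x by (auto simp: u_def)
    have "(\<lambda>n. norm (X (x n))) \<longlonglongrightarrow> s"
    proof (rule tendsto_sandwich)
      show "(\<lambda>n. s - inverse (real (Suc n))) \<longlonglongrightarrow> s"
        using tendsto_diff [OF tendsto_const LIMSEQ_inverse_real_of_nat, of s] by simp
      show "(\<lambda>n. s) \<longlonglongrightarrow> s" by simp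
      show "\<forall>\<^sub>F n in sequentially. s - inverse (real (Suc n)) \<le> norm (X (x n))"
        using x(3) by (intro always_eventually allI less_imp_le)
      show "\<forall>\<^sub>F n in sequentially. norm (X (x n)) \<le> s"
        using x up by (intro always_eventually allI) auto
    qed
    from LIMSEQ_subseq_LIMSEQ [OF this r] have "(\<lambda>n. norm (X (u n))) \<longlonglongrightarrow> s" by (simp add: comp_def u_def)
    moreover have yu: "(\<lambda>n. X (u n)) \<longlonglongrightarrow> y" using y by (simp add: u_def)
    ultimately have ny: "norm y = s" using tendsto_norm LIMSEQ_unique by blast
    have "Cauchy u"
    proof (rule metric_CauchyI)
      fix \<epsilon> :: real assume \<epsilon>: "0 < \<epsilon>"
      \<comment> \<open>Images within d of y force \<open>norm (u m + u n)\<close> to be at least 2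
        (s - d) / s, so the parallelogram law leaves at most 8 d / s for the squared distance; this
        choice makes that at most half of \<epsilon> squared. The bound \<open>d \<le> s\<close>
        permits squaring.\<close>
      define d where "d = min s (\<epsilon>\<^sup>2 * s / 16)"
      have d: "0 < d" "d \<le> s" "d \<le> \<epsilon>\<^sup>2 * s / 16" using s \<epsilon> by (auto simp: d_def)
      obtain N where N: "\<And>n. N \<le> n \<Longrightarrow> norm (X (u n) - y) < d"
        using yu d(1) unfolding LIMSEQ_iff by blast
      have "dist (u m) (u n) < \<epsilon>" if mn: "N \<le> m" "N \<le> n" for m n
      proof -
        have "norm (2 *\<^sub>R y) \<le> norm (X (u m) + X (u n)) + norm (X (u m) - y) + norm (X (u n) - y)"
          using norm_triangle_ineq4 [of "X (u m) + X (u n)" "(X (u m) - y) + (X (u n) - y)"]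
            norm_triangle_ineq [of "X (u m) - y" "X (u n) - y"] by (simp add: scaleR_2)
        then have "2 * s - 2 * d \<le> norm (X (u m + u n))"
          using N [OF mn(1)] N [OF mn(2)] by (simp add: ny X.add)
        also have "\<dots> \<le> s * norm (u m + u n)" by (intro le add u)
        finally have "2 * (s - d) / s \<le> norm (u m + u n)" using s by (simp add: field_simps)
        then have "(2 * (s - d) / s)\<^sup>2 \<le> (norm (u m + u n))\<^sup>2" using s d by (intro power_mono) auto
        moreover have "(norm (u m + u n))\<^sup>2 + (norm (u m - u n))\<^sup>2 = 4"
          using dot_norm [of "u m" "u n"] dot_norm_neg [of "u m" "u n"] u(2) by simp
        moreover have "4 - (2 * (s - d) / s)\<^sup>2 \<le> 8 * d / s"
        proof -
          have "(2 * (s - d) / s)\<^sup>2 = 4 - 8 * d / s + 4 * (d / s)\<^sup>2"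
            using s by (simp add: power2_eq_square field_simps)
          then show ?thesis by simp
        qed
        moreover have "8 * d / s \<le> \<epsilon>\<^sup>2 / 2" using d(3) s by (simp add: field_simps)
        moreover have "\<epsilon>\<^sup>2 / 2 < \<epsilon>\<^sup>2" using \<epsilon> by simp
        ultimately have "(norm (u m - u n))\<^sup>2 < \<epsilon>\<^sup>2" by linarith
        then show ?thesis using \<epsilon> by (simp add: dist_norm power2_less_imp_less)
      qed
      then show "\<exists>M. \<forall>m\<ge>M. \<forall>n\<ge>M. dist (u m) (u n) < \<epsilon>" by blast
    qed
    then obtain w where w: "u \<longlonglongrightarrow> w" by (auto simp: Cauchy_convergent_iff convergent_def)
    have "w \<in> E" using \<open>closed E\<close> u(1) w by (rule closed_sequentially)
    moreover have "norm w = 1" using tendsto_norm [OF w] u(2) by (simp add: LIMSEQ_const_iff)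
    moreover have "norm (X w) = s" using X.tendsto [OF w] yu ny LIMSEQ_unique by blast
    ultimately show thesis using that le by metis
  qed
qed

text \<open>First variation: comparing X at x + t w and at x gives
  \<open>2 * t * a \<le> t\<^sup>2 * b\<close> for every real t, so the real part \<open>a\<close>
  vanishes. Replacing z by i z treats the imaginary part.\<close>

lemma maximiser_orthogonal:
  fixes X :: "'a::complex_hilbert \<Rightarrow> 'a"
  assumes X: "X \<in> bounded_ops"
    and add: "\<And>x y. x \<in> E \<Longrightarrow> y \<in> E \<Longrightarrow> x + y \<in> E" and scale: "\<And>c x. x \<in> E \<Longrightarrow> c *\<^sub>C x \<in> E"
    and x: "x \<in> E" "norm x = 1" "\<And>z. z \<in> E \<Longrightarrow> norm (X z) \<le> norm (X x) * norm z"
    and z: "z \<in> E" "cinner z x = 0"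
  shows "cinner (X z) (X x) = 0"
proof -
  interpret X: bounded_linear X by (rule bounded_opsD(1) [OF X])
  have re: "inner (X w) (X x) = 0" if w: "w \<in> E" "cinner w x = 0" for w
  proof -
    define a b where "a = inner (X w) (X x)" and "b = (norm (X x))\<^sup>2 * (norm w)\<^sup>2"
    have b0: "0 \<le> b" by (simp add: b_def)
    have inq: "2 * t * a \<le> t\<^sup>2 * b" for t
    proof -
      have tw: "t *\<^sub>R w \<in> E" using scale [OF w(1)] by (simp add: scaleR_scaleC)
      have wx: "inner w x = 0" using w(2) by (simp add: inner_eq_Re_cinner)
      have "(norm (X (x + t *\<^sub>R w)))\<^sup>2 \<le> (norm (X x) * norm (x + t *\<^sub>R w))\<^sup>2"
        by (intro power_mono x(3) add x(1) tw) simp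
      moreover have "(norm (X (x + t *\<^sub>R w)))\<^sup>2 = (norm (X x))\<^sup>2 + 2 * t * a + t\<^sup>2 * (norm (X w))\<^sup>2"
        using dot_norm [of "X x" "t *\<^sub>R X w"]
        by (simp add: X.add X.scaleR a_def inner_commute [of "X x"] power_mult_distrib)
      moreover have "(norm (x + t *\<^sub>R w))\<^sup>2 = 1 + t\<^sup>2 * (norm w)\<^sup>2"
        using x(2) wx dot_norm [of x "t *\<^sub>R w"]
        by (simp add: inner_commute [of x] power_mult_distrib)
      ultimately have "2 * t * a + t\<^sup>2 * (norm (X w))\<^sup>2 \<le> t\<^sup>2 * b"
        by (simp add: power_mult_distrib b_def algebra_simps)
      moreover have "0 \<le> t\<^sup>2 * (norm (X w))\<^sup>2" by simp
      ultimately show ?thesis by linarith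
    qed
    \<comment> \<open>The inequality is used at t = a / k; adding 1 keeps the denominator
      nonzero.\<close>
    define k where "k = b + 1"
    have k: "k \<noteq> 0" using b0 by (simp add: k_def)
    have "k\<^sup>2 * (2 * (a / k) * a) \<le> k\<^sup>2 * ((a / k)\<^sup>2 * b)"
      by (intro mult_left_mono inq) simp
    moreover have "k\<^sup>2 * (2 * (a / k) * a) = 2 * k * a\<^sup>2" using k by (simp add: power2_eq_square)
    moreover have "k\<^sup>2 * ((a / k)\<^sup>2 * b) = b * a\<^sup>2" using k by (simp add: power_divide)
    ultimately have "2 * k * a\<^sup>2 \<le> b * a\<^sup>2" by (simp only:)
    then have "2 * (b + 1) * a\<^sup>2 \<le> b * a\<^sup>2" by (simp only: k_def)
    then have "(b + 2) * a\<^sup>2 \<le> 0" by (simp add: algebra_simps)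
    with b0 have "a\<^sup>2 \<le> 0" by (simp add: mult_le_0_iff)
    then show ?thesis by (simp add: a_def)
  qed
  have "inner (X (\<i> *\<^sub>C z)) (X x) = 0"
    using z by (intro re scale) (simp_all add: cinner_scaleC_left)
  then have "Im (cinner (X z) (X x)) = 0"
    by (simp add: bounded_opsD(2) [OF X] inner_eq_Re_cinner cinner_scaleC_left)
  moreover have "Re (cinner (X z) (X x)) = 0" using re [OF z] by (simp add: inner_eq_Re_cinner)
  ultimately show ?thesis by (simp add: complex_eq_iff)
qed

lemma exists_orthogonal_vector:
  fixes e :: "nat \<Rightarrow> 'a::complex_hilbert"
  assumes inf: "infinite_dim_hilbert TYPE('a)"
    and e: "\<And>i. i < n \<Longrightarrow> norm (e i) = 1" "\<And>i j. i < j \<Longrightarrow> j < n \<Longrightarrow> cinner (e j) (e i) = 0"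
  obtains v where "v \<noteq> 0" "\<And>i. i < n \<Longrightarrow> cinner v (e i) = 0"
proof -
  have "complex_vector.span (e ` {..<n}) \<noteq> UNIV" using inf by (auto simp: infinite_dim_hilbert_def)
  then obtain x where x: "x \<notin> complex_vector.span (e ` {..<n})" by blast
  define p where "p = (\<Sum>i<n. cinner x (e i) *\<^sub>C e i)"
  have "p \<in> complex_vector.span (e ` {..<n})"
    unfolding p_def by (intro complex_vector.span_sum complex_vector.span_scale complex_vector.span_base) auto
  with x have "x - p \<noteq> 0" by auto
  moreover have "cinner (x - p) (e j) = 0" if j: "j < n" for j
  proof -
    have off: "cinner (e i) (e j) = 0" if "i < n" "i \<noteq> j" for i
      using e(2) [of i j] e(2) [of j i] that j cinner_commute [of "e i" "e j"] by (cases "i < j") auto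
    have "cinner p (e j) = (\<Sum>i<n. cinner x (e i) * cinner (e i) (e j))"
      by (simp add: p_def cinner.sum_left cinner_scaleC_left)
    also have "\<dots> = (\<Sum>i<n. if i = j then cinner x (e j) else 0)"
      by (intro sum.cong refl) (auto simp: off cinner_self e(1))
    also have "\<dots> = cinner x (e j)" using j by simp
    finally show ?thesis by (simp add: cinner.diff_left)
  qed
  ultimately show thesis by (rule that)
qed

text \<open>The sequence \<open>e\<close> consists of right singular vectors and is infinite even
  for finite rank. It need not be a basis; the expansion makes X vanish on its orthogonal
  complement.\<close>

definition svd :: "('a::complex_hilbert \<Rightarrow> 'a) \<Rightarrow> (nat \<Rightarrow> 'a) \<Rightarrow> bool" where
  "svd X e \<longleftrightarrow> orthonormal_seq e \<and> orth_seq (\<lambda>n. X (e n)) \<and>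
     (\<lambda>n. norm (X (e n))) \<in> c0_star \<and> X = schmidt e (\<lambda>n. X (e n))"

lemma orthonormal_remainder:
  assumes "orthonormal_seq e"
  shows "norm (x - (\<Sum>i<n. cinner x (e i) *\<^sub>C e i)) \<le> 2 * norm x"
proof -
  have oe: "orth_seq e" "\<And>n. norm (e n) = 1" using assms by (auto simp: orthonormal_seq_def)
  have "(norm (\<Sum>i<n. cinner x (e i) *\<^sub>C e i))\<^sup>2 = (\<Sum>i<n. (cmod (cinner x (e i)))\<^sup>2)"
    by (simp add: norm_orth_sum [OF oe(1)] oe(2))
  also have "\<dots> \<le> 1\<^sup>2 * (norm x)\<^sup>2" by (intro bessel oe) (simp_all add: oe)
  finally have "norm (\<Sum>i<n. cinner x (e i) *\<^sub>C e i) \<le> norm x"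
    by (intro power2_le_imp_le [OF _ norm_ge_zero]) simp
  then show ?thesis using norm_triangle_ineq4 [of x "\<Sum>i<n. cinner x (e i) *\<^sub>C e i"] by simp
qed

text \<open>Greedy choice: \<open>e n\<close> maximises \<open>norm (X x)\<close> over the unit
  vectors orthogonal to the earlier choices. Then the images are orthogonal by first variation, the
  maxima tend to 0 by compactness, and the remainder of x after n terms, being admissible at stage
  n, has an image tending to 0.\<close>

lemma svd_exists:
  fixes X :: "'a::complex_hilbert \<Rightarrow> 'a"
  assumes inf: "infinite_dim_hilbert TYPE('a)" and X: "X \<in> compact_ops"
  obtains e where "svd X e"
proof -
  note Xb = compact_ops_bounded [OF X]
  define E where "E f n = {x :: 'a. \<forall>i<n. cinner x (f i) = 0}" for f and n :: nat
  define P where "P f n x \<longleftrightarrow> x \<in> E f n \<and> norm x = 1 \<and> (\<forall>z\<in>E f n. norm (X z) \<le> norm (X x) * norm z)" for f n x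
  have Eadd: "x + y \<in> E f n" if "x \<in> E f n" "y \<in> E f n" for x y f n
    using that by (simp add: E_def cinner_add_left)
  have Escale: "c *\<^sub>C x \<in> E f n" if "x \<in> E f n" for c x f n
    using that by (simp add: E_def cinner_scaleC_left)
  \<comment> \<open>Well-founded recursion applies because \<open>P f n\<close> sees
    \<open>f\<close> only below n.\<close>
  have "\<exists>e. \<forall>n. P e n (e n)"
  proof (rule dependent_wellorder_choice)
    fix r :: 'a and f g :: "nat \<Rightarrow> 'a" and n :: nat
    assume "\<And>i. i < n \<Longrightarrow> f i = g i"
    then have "E f n = E g n" by (auto simp: E_def)
    then show "P f n r = P g n r" by (simp add: P_def)
  next
    fix n :: nat and f :: "nat \<Rightarrow> 'a"
    assume IH: "\<And>i. i < n \<Longrightarrow> P f i (f i)"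
    obtain v where v: "v \<noteq> 0" "\<And>i. i < n \<Longrightarrow> cinner v (f i) = 0"
    proof (rule exists_orthogonal_vector [OF inf, of n f])
      show "norm (f i) = 1" if "i < n" for i using IH [OF that] by (simp add: P_def)
      show "cinner (f j) (f i) = 0" if "i < j" "j < n" for i j using IH [OF that(2)] that(1) by (simp add: P_def E_def)
    qed blast
    have "closed (E f n)"
    proof -
      have "E f n = (\<Inter>i\<in>{..<n}. {x. cinner x (f i) = 0})" by (auto simp: E_def)
      moreover have "closed {x. cinner x (f i) = 0}" for i
        by (intro closed_Collect_eq linear_continuous_on cinner.bounded_linear_left continuous_on_const)
      ultimately show ?thesis by auto
    qed
    moreover have "v \<in> E f n" using v by (simp add: E_def)
    ultimately obtain x where "x \<in> E f n" "norm x = 1" "\<And>z. z \<in> E f n \<Longrightarrow> norm (X z) \<le> norm (X x) * norm z"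
      using maximiser_exists [OF X _ Eadd Escale _ v(1)] by metis
    then show "\<exists>x. P f n x" by (auto simp: P_def)
  qed
  then obtain e where e: "\<And>n. P e n (e n)" by blast
  have mem: "e n \<in> E e m" if "m \<le> n" for m n using e [of n] that by (simp add: P_def E_def)
  have norm1: "norm (e n) = 1" for n using e [of n] by (simp add: P_def)
  have mx: "norm (X z) \<le> norm (X (e n)) * norm z" if "z \<in> E e n" for z n
    using e [of n] that by (simp add: P_def)
  have orth: "cinner (e n) (e m) = 0 \<and> cinner (X (e n)) (X (e m)) = 0" if "m < n" for m n
  proof
    show o: "cinner (e n) (e m) = 0" using mem [of n n] that by (simp add: E_def)
    show "cinner (X (e n)) (X (e m)) = 0"
    proof (rule maximiser_orthogonal [OF Xb, where E = "E e m"])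
      show "e m \<in> E e m" "e n \<in> E e m" using mem that by auto
    qed (use Eadd Escale mx norm1 o in auto)
  qed
  have "cinner (e m) (e n) = 0" "cinner (X (e m)) (X (e n)) = 0" if "m \<noteq> n" for m n
    using orth [of m n] orth [of n m] that cinner_commute [of "e m" "e n"] cinner_commute [of "X (e m)" "X (e n)"]
    by (cases "m < n"; auto)+
  then have on: "orthonormal_seq e" and oX: "orth_seq (\<lambda>n. X (e n))"
    using norm1 by (auto simp: orthonormal_seq_def orth_seq_def)
  define s where "s n = norm (X (e n))" for n
  have dec: "decseq s"
    unfolding s_def using mx [OF mem, of _ "Suc _"] norm1 by (intro decseq_SucI) simp
  have lim: "s \<longlonglongrightarrow> 0"
  proof (rule ccontr)
    assume "\<not> s \<longlonglongrightarrow> 0"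
    then obtain c where c: "0 < c" "\<And>N. \<exists>n\<ge>N. c \<le> s n"
      unfolding LIMSEQ_iff by (auto simp: s_def not_less)
    have cs: "c \<le> s n" for n
    proof -
      obtain k where "n \<le> k" "c \<le> s k" using c(2) by blast
      with decseqD [OF dec, of n k] show ?thesis by simp
    qed
    \<comment> \<open>Orthogonal images of norm at least \<open>c\<close> are at distance at least
      \<open>c\<close> from each other, so none of their subsequences converges.\<close>
    obtain r y where r: "strict_mono (r :: nat \<Rightarrow> nat)" and y: "(\<lambda>n. X (e (r n))) \<longlonglongrightarrow> y"
      using compact_ops_subseq [OF X, of e] norm1 by (metis order_refl)
    have "Cauchy (\<lambda>n. X (e (r n)))" using y by (rule LIMSEQ_imp_Cauchy)
    with c(1) obtain N where N: "\<And>m n. N \<le> m \<Longrightarrow> N \<le> n \<Longrightarrow> dist (X (e (r m))) (X (e (r n))) < c"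
      unfolding Cauchy_def by blast
    define p q where "p = r (Suc N)" and "q = r N"
    have pq: "q < p" using r by (simp add: p_def q_def strict_mono_def)
    have "inner (X (e p)) (X (e q)) = 0" using orth [OF pq] by (simp add: inner_eq_Re_cinner)
    then have "(norm (X (e p) - X (e q)))\<^sup>2 = (s p)\<^sup>2 + (s q)\<^sup>2"
      using dot_norm_neg [of "X (e p)" "X (e q)"] by (simp add: s_def)
    moreover have "c\<^sup>2 \<le> (s p)\<^sup>2" "0 \<le> (s q)\<^sup>2" using c cs by (auto intro!: power_mono)
    ultimately have "c\<^sup>2 \<le> (norm (X (e p) - X (e q)))\<^sup>2" by linarith
    then have "c \<le> norm (X (e p) - X (e q))" by (rule power2_le_imp_le) simp
    moreover have "norm (X (e p) - X (e q)) < c" using N [of "Suc N" N] by (simp add: dist_norm p_def q_def)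
    ultimately show False by simp
  qed
  have "X x = schmidt e (\<lambda>n. X (e n)) x" for x
  proof -
    define d where "d n = x - (\<Sum>i<n. cinner x (e i) *\<^sub>C e i)" for n
    have dE: "d n \<in> E e n" for n
    proof -
      have "cinner (d n) (e j) = 0" if j: "j < n" for j
      proof -
        have "cinner (\<Sum>i<n. cinner x (e i) *\<^sub>C e i) (e j) = (\<Sum>i<n. cinner x (e i) * cinner (e i) (e j))"
          by (simp add: cinner.sum_left cinner_scaleC_left)
        also have "\<dots> = (\<Sum>i<n. if i = j then cinner x (e j) else 0)"
          using on by (intro sum.cong refl) (auto simp: orthonormal_seq_def orth_seq_def cinner_self)
        also have "\<dots> = cinner x (e j)" using j by simp
        finally show ?thesis by (simp add: d_def cinner.diff_left)
      qed
      then show ?thesis by (simp add: E_def)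
    qed
    have dn: "norm (X (d n)) \<le> s n * (2 * norm x)" for n
    proof -
      have "norm (X (d n)) \<le> s n * norm (d n)" using mx [OF dE] by (simp add: s_def)
      also have "\<dots> \<le> s n * (2 * norm x)"
        unfolding d_def by (intro mult_left_mono orthonormal_remainder [OF on]) (simp add: s_def)
      finally show ?thesis .
    qed
    have "(\<lambda>n. s n * (2 * norm x)) \<longlonglongrightarrow> 0 * (2 * norm x)" by (intro tendsto_intros lim)
    then have lim0: "(\<lambda>n. s n * (2 * norm x)) \<longlonglongrightarrow> 0" by simp
    have "(\<lambda>n. X (d n)) \<longlonglongrightarrow> 0"
      by (rule Lim_null_comparison [OF _ lim0]) (simp add: dn)
    then have "(\<lambda>n. X x - X (d n)) \<longlonglongrightarrow> X x - 0" by (intro tendsto_intros)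
    moreover have "X x - X (d n) = (\<Sum>i<n. cinner x (e i) *\<^sub>C X (e i))" for n
      by (simp add: d_def bounded_opsD [OF Xb])
    ultimately have "(\<lambda>n. cinner x (e n) *\<^sub>C X (e n)) sums X x" by (simp add: sums_def)
    then show ?thesis by (simp add: schmidt_def sums_iff)
  qed
  then have "X = schmidt e (\<lambda>n. X (e n))" by (rule ext)
  moreover have "(\<lambda>n. norm (X (e n))) \<in> c0_star"
    using dec lim unfolding c0_star_def s_def by simp
  ultimately have "svd X e" unfolding svd_def using on oX by blast
  then show thesis by (rule that)
qed

section \<open>Singular numbers\<close>

text \<open>Elimination: an unknown \<open>k0\<close> with nonzero coefficient in equation n is
  removed from the other equations, whose new coefficients are \<psi>; \<open>d\<close> restores it
  by back substitution.\<close>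

lemma underdetermined_system:
  fixes \<phi> :: "nat \<Rightarrow> 'b \<Rightarrow> complex"
  assumes "finite K" "n < card K"
  shows "\<exists>c. (\<exists>k\<in>K. c k \<noteq> 0) \<and> (\<forall>i<n. (\<Sum>k\<in>K. c k * \<phi> i k) = 0)"
  using assms
proof (induction n arbitrary: K \<phi>)
  case 0
  then have "K \<noteq> {}" by auto
  then show ?case by (intro exI [of _ "\<lambda>_. 1"]) auto
next
  case (Suc n)
  show ?case
  proof (cases "\<forall>k\<in>K. \<phi> n k = 0")
    case True
    obtain c where "\<exists>k\<in>K. c k \<noteq> 0" "\<forall>i<n. (\<Sum>k\<in>K. c k * \<phi> i k) = 0"
      using Suc.IH [OF Suc.prems(1), of \<phi>] Suc.prems(2) by auto
    with True show ?thesis by (intro exI [of _ c]) (auto simp: less_Suc_eq)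
  next
    case False
    then obtain k0 where k0: "k0 \<in> K" "\<phi> n k0 \<noteq> 0" by blast
    define L where "L = K - {k0}"
    have L: "finite L" "n < card L" "k0 \<notin> L" "K = insert k0 L"
      using Suc.prems k0 by (auto simp: L_def)
    define \<psi> where "\<psi> i k = \<phi> i k - \<phi> i k0 / \<phi> n k0 * \<phi> n k" for i k
    obtain c where c: "\<exists>k\<in>L. c k \<noteq> 0" "\<And>i. i < n \<Longrightarrow> (\<Sum>k\<in>L. c k * \<psi> i k) = 0"
      using Suc.IH [OF L(1,2), of \<psi>] by blast
    define S where "S = (\<Sum>k\<in>L. c k * \<phi> n k)"
    define d where "d k = (if k = k0 then - S / \<phi> n k0 else c k)" for k
    have sum_d: "(\<Sum>k\<in>K. d k * \<phi> i k) = - S / \<phi> n k0 * \<phi> i k0 + (\<Sum>k\<in>L. c k * \<phi> i k)" for i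
    proof -
      have "(\<Sum>k\<in>L. d k * \<phi> i k) = (\<Sum>k\<in>L. c k * \<phi> i k)"
        using L(3) by (intro sum.cong) (auto simp: d_def)
      then show ?thesis using L by (simp add: d_def)
    qed
    have "(\<Sum>k\<in>K. d k * \<phi> i k) = 0" if i: "i < Suc n" for i
    proof (cases "i = n")
      case True
      then show ?thesis using k0 by (simp add: sum_d S_def)
    next
      case False
      have "0 = (\<Sum>k\<in>L. c k * \<phi> i k - \<phi> i k0 / \<phi> n k0 * (c k * \<phi> n k))"
        using c(2) [of i] i False by (simp add: \<psi>_def algebra_simps)
      also have "\<dots> = (\<Sum>k\<in>L. c k * \<phi> i k) - \<phi> i k0 / \<phi> n k0 * S"
        by (simp only: sum_subtractf sum_distrib_left S_def)
      finally show ?thesis by (simp add: sum_d)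
    qed
    moreover have "\<exists>k\<in>K. d k \<noteq> 0"
      using c(1) L(3,4) by (auto simp: d_def)
    ultimately show ?thesis by blast
  qed
qed

lemma svdD:
  assumes "svd X e"
  shows "orthonormal_seq e" "orth_seq (\<lambda>n. X (e n))" "(\<lambda>n. norm (X (e n))) \<in> c0_star"
    "X = schmidt e (\<lambda>n. X (e n))" "bdd_orth e" "bdd_orth (\<lambda>n. X (e n))"
    "n \<le> m \<Longrightarrow> norm (X (e m)) \<le> norm (X (e n))"
proof -
  show a: "orthonormal_seq e" "orth_seq (\<lambda>n. X (e n))" "(\<lambda>n. norm (X (e n))) \<in> c0_star"
    "X = schmidt e (\<lambda>n. X (e n))" using assms by (auto simp: svd_def)
  show "bdd_orth e" using a(1) by (rule orthonormal_bdd)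
  note dec = c0_starD(2) [OF a(3)]
  show "n \<le> m \<Longrightarrow> norm (X (e m)) \<le> norm (X (e n))" using decseqD [OF dec] .
  show "bdd_orth (\<lambda>n. X (e n))" by (rule bdd_orthI [OF a(2), of "norm (X (e 0))"]) (rule decseqD [OF dec], simp)
qed

text \<open>Exchanging the two sequences of the Schmidt expansion exhibits an adjoint, and
  \<open>cinner_eqI\<close> shows that there is no other, so the description defining
  \<open>cadjoint\<close> resolves.\<close>

lemma svd_adjoint:
  assumes "svd X e"
  shows "cadjoint X = schmidt (\<lambda>n. X (e n)) e"
    and "cinner (X x) y = cinner x (cadjoint X y)"
proof -
  note S = svdD [OF assms]
  have adj: "cinner (X x) y = cinner x (schmidt (\<lambda>n. X (e n)) e y)" for x y
    using schmidt_adjoint [OF S(5,6), of x y] S(4) by simp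
  show eq: "cadjoint X = schmidt (\<lambda>n. X (e n)) e"
    unfolding cadjoint_def
  proof (rule the_equality)
    show "\<forall>x y. cinner (X x) y = cinner x (schmidt (\<lambda>n. X (e n)) e y)" using adj by blast
    fix Y assume Y: "\<forall>x y. cinner (X x) y = cinner x (Y y)"
    show "Y = schmidt (\<lambda>n. X (e n)) e"
      by (rule ext, rule cinner_eqI) (simp add: adj [symmetric] Y)
  qed
  show "cinner (X x) y = cinner x (cadjoint X y)" by (simp add: eq adj)
qed

text \<open>The operator \<open>T\<close> is diagonal along \<open>e\<close> with the squared
  singular values as entries. Self-adjointness makes an eigenvector orthogonal to every
  \<open>e n\<close> with a different singular value, so only finitely many terms of
  \<open>T v\<close> survive.\<close>

lemma svd_eigenspace:
  assumes X: "svd X e" and t: "0 < t"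
  shows "finite {n. norm (X (e n)) = t}"
    and "{v. cadjoint X (X v) = complex_of_real (t\<^sup>2) *\<^sub>C v} = complex_vector.span (e ` {n. norm (X (e n)) = t})"
proof -
  note S = svdD [OF X]
  define N where "N = {n. norm (X (e n)) = t}"
  define T where "T v = cadjoint X (X v)" for v
  have "\<forall>\<^sub>F n in sequentially. norm (X (e n)) < t"
    using c0_starD(3) [OF S(3)] t by (rule order_tendstoD)
  then obtain M where M: "\<And>n. M \<le> n \<Longrightarrow> norm (X (e n)) < t" unfolding eventually_sequentially by blast
  have "N \<subseteq> {..<M}"
  proof
    fix n assume "n \<in> N"
    then show "n \<in> {..<M}" using M [of n] by (auto simp: N_def not_less [symmetric])
  qed
  then have fin: "finite N" by (rule finite_subset) simp
  then show "finite {n. norm (X (e n)) = t}" by (simp add: N_def)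
  have Xb: "X \<in> bounded_ops" using schmidt_bounded_ops [OF S(5,6)] S(4) by simp
  have Ab: "cadjoint X \<in> bounded_ops" using schmidt_bounded_ops [OF S(6,5)] svd_adjoint(1) [OF X] by simp
  have Te: "T (e n) = complex_of_real ((norm (X (e n)))\<^sup>2) *\<^sub>C e n" for n
    unfolding T_def svd_adjoint(1) [OF X]
    using S(2) by (subst schmidt_single [where n = n]) (auto simp: orth_seq_def cinner_self)
  have Tc: "T (c *\<^sub>C v) = c *\<^sub>C T v" for c v by (simp add: T_def bounded_opsD(2) [OF Xb] bounded_opsD(2) [OF Ab])
  have Ta: "T (v + w) = T v + T w" for v w by (simp add: T_def bounded_opsD(3) [OF Xb] bounded_opsD(3) [OF Ab])
  have T0: "T 0 = 0" by (simp add: T_def bounded_opsD(6) [OF Xb] bounded_opsD(6) [OF Ab])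
  have "{v. T v = complex_of_real (t\<^sup>2) *\<^sub>C v} = complex_vector.span (e ` N)"
  proof
    show "complex_vector.span (e ` N) \<subseteq> {v. T v = complex_of_real (t\<^sup>2) *\<^sub>C v}"
    proof (rule complex_vector.span_minimal)
      show "e ` N \<subseteq> {v. T v = complex_of_real (t\<^sup>2) *\<^sub>C v}" by (auto simp: Te N_def)
      show "complex_vector.subspace {v. T v = complex_of_real (t\<^sup>2) *\<^sub>C v}"
        by (rule complex_vector.subspaceI) (simp_all add: T0 Ta Tc scaleC_add_right scaleC_scaleC mult.commute)
    qed
    show "{v. T v = complex_of_real (t\<^sup>2) *\<^sub>C v} \<subseteq> complex_vector.span (e ` N)"
    proof
      fix v assume "v \<in> {v. T v = complex_of_real (t\<^sup>2) *\<^sub>C v}"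
      then have v: "T v = complex_of_real (t\<^sup>2) *\<^sub>C v" by simp
      have XX: "cinner (X v) (X (e n)) = complex_of_real ((norm (X (e n)))\<^sup>2) * cinner v (e n)" for n
      proof -
        have "cinner (X v) (X (e n)) = cinner v (T (e n))" unfolding T_def by (rule svd_adjoint(2) [OF X])
        then show ?thesis by (simp add: Te cinner_scaleC_right)
      qed
      have zero: "cinner v (e n) = 0" if "n \<notin> N" for n
      proof -
        have "cinner (T v) (e n) = cinner (X v) (X (e n))"
          unfolding T_def by (metis cinner_commute svd_adjoint(2) [OF X])
        then have "complex_of_real (t\<^sup>2) * cinner v (e n) = complex_of_real ((norm (X (e n)))\<^sup>2) * cinner v (e n)"
          by (simp add: XX v cinner_scaleC_left)
        moreover have "complex_of_real (t\<^sup>2) \<noteq> complex_of_real ((norm (X (e n)))\<^sup>2)"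
          using that t unfolding of_real_eq_iff by (simp add: N_def power2_eq_iff_nonneg)
        ultimately show ?thesis by (metis mult_right_cancel)
      qed
      have "T v = (\<Sum>n\<in>N. cinner (X v) (X (e n)) *\<^sub>C e n)"
        unfolding T_def svd_adjoint(1) [OF X] schmidt_def
        by (rule suminf_finite [OF fin]) (simp add: XX zero)
      also have "\<dots> \<in> complex_vector.span (e ` N)"
        by (intro complex_vector.span_sum complex_vector.span_scale complex_vector.span_base imageI)
      finally have "T v \<in> complex_vector.span (e ` N)" .
      \<comment> \<open>Dividing by the positive eigenvalue recovers v from \<open>T v\<close>; as
        \<open>e\<close> may fail to be a basis, v could not be expanded directly.\<close>
      then have "complex_of_real (1 / t\<^sup>2) *\<^sub>C T v \<in> complex_vector.span (e ` N)"
        by (rule complex_vector.span_scale)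
      moreover have "complex_of_real (1 / t\<^sup>2) *\<^sub>C T v = v"
      proof -
        have "complex_of_real (1 / t\<^sup>2) * complex_of_real (t\<^sup>2) = 1"
          using t by (simp flip: of_real_mult of_real_power)
        then show ?thesis unfolding v scaleC_scaleC by simp
      qed
      ultimately show "v \<in> complex_vector.span (e ` N)" by simp
    qed
  qed
  then show "{v. cadjoint X (X v) = complex_of_real (t\<^sup>2) *\<^sub>C v} = complex_vector.span (e ` {n. norm (X (e n)) = t})"
    by (simp add: T_def N_def)
qed

lemma dim_span_orthonormal:
  assumes e: "orthonormal_seq e" and N: "finite N"
  shows "complex_vector.dim (complex_vector.span (e ` N)) = card N"
proof -
  have on: "cinner (e m) (e n) = (if m = n then 1 else 0)" for m n
    using e by (simp add: orthonormal_seq_def orth_seq_def cinner_self)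
  have inj: "inj e"
  proof (rule injI)
    fix m n assume "e m = e n"
    then have "cinner (e m) (e n) = cinner (e n) (e n)" by simp
    then show "m = n" by (auto simp: on split: if_splits)
  qed
  have "complex_vector.independent (e ` N)"
  proof (rule complex_vector.independent_if_scalars_zero)
    show "finite (e ` N)" using N by simp
    fix f x assume z: "(\<Sum>x\<in>e ` N. f x *\<^sub>C x) = 0" and "x \<in> e ` N"
    then obtain m where m: "m \<in> N" "x = e m" by auto
    have "0 = cinner (\<Sum>x\<in>e ` N. f x *\<^sub>C x) (e m)" by (simp add: z cinner.zero_left)
    also have "(\<Sum>x\<in>e ` N. f x *\<^sub>C x) = (\<Sum>n\<in>N. f (e n) *\<^sub>C e n)"
      using inj by (subst sum.reindex) (auto intro: inj_on_subset)
    also have "cinner \<dots> (e m) = (\<Sum>n\<in>N. if n = m then f (e m) else 0)"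
      by (auto simp: cinner.sum_left cinner_scaleC_left on intro!: sum.cong)
    also have "\<dots> = f x" using m N by simp
    finally show "f x = 0" by simp
  qed
  then show ?thesis
    using card_image [OF inj_on_subset [OF inj subset_UNIV], of N]
    by (simp add: complex_vector.dim_eq_card_independent)
qed

text \<open>At the first disagreement let \<open>s n < s' n = t\<close>. By monotonicity
  \<open>s\<close> takes the value t only before n, where the sequences agree, so its level set is
  strictly smaller. Convergence to 0 makes the level sets finite and the comparison of
  \<open>card\<close> meaningful.\<close>

lemma c0_star_eqI:
  assumes "s \<in> c0_star" "s' \<in> c0_star"
    and card: "\<And>t. 0 < t \<Longrightarrow> card {n. s n = t} = card {n. s' n = t}"
  shows "s = s'"
proof (rule ccontr)
  assume ne: "s \<noteq> s'"
  have aux: False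
    if s: "s \<in> c0_star" "s' \<in> c0_star" and card: "\<And>t. 0 < t \<Longrightarrow> card {n. s n = t} = card {n. s' n = t}"
      and less: "s n < s' n" and eq: "\<And>m. m < n \<Longrightarrow> s m = s' m" for s s' :: "nat \<Rightarrow> real" and n
  proof -
    define t where "t = s' n"
    have t: "0 < t" using less c0_starD(1) [OF s(1), of n] by (simp add: t_def)
    have sub: "{j. s j = t} \<subset> {j. s' j = t}"
    proof (rule psubsetI)
      show "{j. s j = t} \<subseteq> {j. s' j = t}"
      proof safe
        fix j assume "t = s j"
        have "j < n"
        proof (rule ccontr)
          assume "\<not> j < n"
          then have "s j \<le> s n" by (intro decseqD [OF c0_starD(2) [OF s(1)]]) simp
          with \<open>t = s j\<close> less show False by (simp add: t_def)
        qed
        then show "s' j = s j" using eq by simp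
      qed
      have "n \<in> {j. s' j = t}" "n \<notin> {j. s j = t}" using less by (auto simp: t_def)
      then show "{j. s j = t} \<noteq> {j. s' j = t}" by blast
    qed
    have "\<forall>\<^sub>F j in sequentially. s' j < t" using c0_starD(3) [OF s(2)] t by (rule order_tendstoD)
    then obtain M where M: "\<And>j. M \<le> j \<Longrightarrow> s' j < t" unfolding eventually_sequentially by blast
    have "{j. s' j = t} \<subseteq> {..<M}" using M by (force simp: not_less [symmetric])
    then have "finite {j. s' j = t}" by (rule finite_subset) simp
    from psubset_card_mono [OF this sub] card [OF t] show False by simp
  qed
  define n where "n = (LEAST n. s n \<noteq> s' n)"
  have n: "s n \<noteq> s' n" unfolding n_def by (rule LeastI_ex) (use ne in auto)
  have eq: "s m = s' m" if "m < n" for m using not_less_Least that unfolding n_def by blast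
  show False
  proof (cases "s n < s' n")
    case True
    then show False using aux [OF assms(1,2) card] eq by blast
  next
    case False
    with n have "s' n < s n" by simp
    then show False using aux [OF assms(2,1) card [symmetric]] eq by metis
  qed
qed

lemma s_numbers_svd:
  assumes X: "svd X e"
  shows "s_numbers X = (\<lambda>n. norm (X (e n)))"
proof -
  have c: "card {n. norm (X (e n)) = t} = complex_vector.dim {v. cadjoint X (X v) = complex_of_real (t\<^sup>2) *\<^sub>C v}"
    if "0 < t" for t
    using svd_eigenspace [OF X that] dim_span_orthonormal [OF svdD(1) [OF X]] by simp
  show ?thesis unfolding s_numbers_def
  proof (rule the_equality)
    show "(\<lambda>n. norm (X (e n))) \<in> c0_star \<and> (\<forall>t>0. card {n. norm (X (e n)) = t} =
        complex_vector.dim {v. cadjoint X (X v) = complex_of_real (t\<^sup>2) *\<^sub>C v})"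
      using svdD(3) [OF X] c by blast
    fix s assume "s \<in> c0_star \<and> (\<forall>t>0. card {n. s n = t} =
        complex_vector.dim {v. cadjoint X (X v) = complex_of_real (t\<^sup>2) *\<^sub>C v})"
    then show "s = (\<lambda>n. norm (X (e n)))"
      using c svdD(3) [OF X] by (intro c0_star_eqI) auto
  qed
qed

text \<open>Half of the min-max principle: only the terms of index at least n survive, and their
  singular values are at most the n-th.\<close>

lemma svd_upper:
  assumes X: "svd X e" and x: "\<And>i. i < n \<Longrightarrow> cinner x (e i) = 0"
  shows "norm (X x) \<le> s_numbers X n * norm x"
proof -
  note S = svdD [OF X]
  have "norm (schmidt e (\<lambda>n. X (e n)) x) \<le> norm (X (e n)) * 1 * norm x"
  proof (rule norm_schmidt_le [OF S(5,6)])
    show "norm (e i) \<le> 1" for i using S(1) by (simp add: orthonormal_seq_def)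
    show "cinner x (e i) = 0 \<or> norm (X (e i)) \<le> norm (X (e n))" for i
      using x [of i] S(7) [of n i] by (cases "i < n") auto
  qed simp
  then show ?thesis using S(4) by (simp add: s_numbers_svd [OF X])
qed

text \<open>The other half: among combinations of \<open>e 0\<close> to \<open>e n\<close> some
  nonzero x satisfies the n conditions, and there Pythagoras gives \<open>norm (X x)\<close> at
  least the n-th singular number times \<open>norm x\<close>. The conditions are placed on
  \<open>A x\<close> to serve for products with A on the right.\<close>

lemma svd_lower:
  assumes X: "svd X e" and A: "A \<in> bounded_ops"
    and le: "\<And>x. (\<And>i. i < n \<Longrightarrow> cinner (A x) (v i) = 0) \<Longrightarrow> norm (X x) \<le> c * norm x"
  shows "s_numbers X n \<le> c"
proof -
  note S = svdD [OF X]
  have Xb: "X \<in> bounded_ops" using schmidt_bounded_ops [OF S(5,6)] S(4) by simp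
  have e1: "norm (e i) = 1" "orth_seq e" for i using S(1) by (auto simp: orthonormal_seq_def)
  obtain a where a: "\<exists>k\<in>{..n}. a k \<noteq> 0" "\<And>i. i < n \<Longrightarrow> (\<Sum>k\<le>n. a k * cinner (A (e k)) (v i)) = 0"
    using underdetermined_system [of "{..n}" n "\<lambda>i k. cinner (A (e k)) (v i)"] by auto
  define x where "x = (\<Sum>k\<le>n. a k *\<^sub>C e k)"
  have x2: "(norm x)\<^sup>2 = (\<Sum>k\<le>n. (cmod (a k))\<^sup>2)"
    unfolding x_def by (simp add: norm_orth_sum [OF e1(2)] e1)
  have "0 < (norm x)\<^sup>2"
    unfolding x2 using a(1) by (auto intro!: sum_pos2)
  then have xpos: "0 < norm x" by simp
  have "cinner (A x) (v i) = 0" if "i < n" for i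
    using a(2) [OF that] by (simp add: x_def bounded_opsD(2,5) [OF A] cinner.sum_left cinner_scaleC_left)
  then have "norm (X x) \<le> c * norm x" by (rule le)
  moreover have "norm (X (e n)) * norm x \<le> norm (X x)"
  proof (rule power2_le_imp_le)
    have "(norm (X (e n)) * norm x)\<^sup>2 = (\<Sum>k\<le>n. (cmod (a k))\<^sup>2 * (norm (X (e n)))\<^sup>2)"
      by (simp add: power_mult_distrib x2 sum_distrib_left mult.commute)
    also have "\<dots> \<le> (\<Sum>k\<le>n. (cmod (a k))\<^sup>2 * (norm (X (e k)))\<^sup>2)"
      by (intro sum_mono mult_left_mono power_mono S(7)) auto
    also have "\<dots> = (norm (\<Sum>k\<le>n. a k *\<^sub>C X (e k)))\<^sup>2"
      by (rule norm_orth_sum [OF S(2), symmetric]) simp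
    also have "(\<Sum>k\<le>n. a k *\<^sub>C X (e k)) = X x" by (simp add: x_def bounded_opsD(2,5) [OF Xb])
    finally show "(norm (X (e n)) * norm x)\<^sup>2 \<le> (norm (X x))\<^sup>2" .
  qed simp
  ultimately have "norm (X (e n)) * norm x \<le> c * norm x" by simp
  then show ?thesis using xpos by (simp add: s_numbers_svd [OF X])
qed

section \<open>Ideals and their characteristic sets\<close>

lemma orth_seq_subseq: "orth_seq g \<Longrightarrow> inj r \<Longrightarrow> orth_seq (\<lambda>k. g (r k))"
  by (simp add: orth_seq_def inj_eq)

lemma
  fixes X :: "'a::complex_hilbert \<Rightarrow> 'a"
  assumes inf: "infinite_dim_hilbert TYPE('a)" and X: "X \<in> compact_ops"
  shows s_numbers_c0_star: "s_numbers X \<in> c0_star"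
    and norm_le_s_numbers: "norm (X x) \<le> s_numbers X 0 * norm x"
proof -
  obtain e where e: "svd X e" using svd_exists [OF inf X] .
  show "s_numbers X \<in> c0_star" using svdD(3) [OF e] by (simp add: s_numbers_svd [OF e])
  show "norm (X x) \<le> s_numbers X 0 * norm x" by (rule svd_upper [OF e]) simp
qed

lemma zero_compact_op: "(\<lambda>x :: 'a::complex_hilbert. 0) \<in> compact_ops"
proof (rule compact_opsI)
  show "(\<lambda>x :: 'a. 0) \<in> bounded_ops" by (simp add: bounded_ops_def scaleC.zero_right)
  show "\<exists>K. compact K \<and> (\<forall>x :: 'a. norm x \<le> 1 \<longrightarrow> (\<exists>y\<in>K. dist (0 :: 'a) y \<le> \<epsilon>))" if "0 < \<epsilon>" for \<epsilon>
    using that by (intro exI [of _ "{0}"]) auto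
qed

text \<open>Decomposing the zero operator yields nothing but an orthonormal sequence.\<close>

lemma orthonormal_exists:
  assumes inf: "infinite_dim_hilbert TYPE('a::complex_hilbert)"
  obtains e :: "nat \<Rightarrow> 'a::complex_hilbert" where "orthonormal_seq e"
proof -
  obtain e :: "nat \<Rightarrow> 'a" where "svd (\<lambda>x. 0) e" using svd_exists [OF inf zero_compact_op] .
  then show thesis using svdD(1) that by blast
qed

lemma svd_schmidt:
  assumes e: "orthonormal_seq e" and g: "orth_seq g" "(\<lambda>n. norm (g n)) \<in> c0_star"
  shows "schmidt e g \<in> compact_ops" "svd (schmidt e g) e" "s_numbers (schmidt e g) = (\<lambda>n. norm (g n))"
proof -
  have g': "bdd_orth g"
    by (rule bdd_orthI [OF g(1), of "norm (g 0)"]) (rule decseqD [OF c0_starD(2) [OF g(2)]], simp)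
  show "schmidt e g \<in> compact_ops"
    by (rule schmidt_compact [OF orthonormal_bdd [OF e] g' c0_starD(3) [OF g(2)]])
  have eq: "(\<lambda>n. schmidt e g (e n)) = g" by (simp add: schmidt_orthonormal [OF e])
  then have eq': "(\<lambda>n. norm (schmidt e g (e n))) = (\<lambda>n. norm (g n))" by (simp add: schmidt_orthonormal [OF e])
  show s: "svd (schmidt e g) e"
    unfolding svd_def eq eq' using e g by blast
  show "s_numbers (schmidt e g) = (\<lambda>n. norm (g n))"
    by (simp add: s_numbers_svd [OF s] eq')
qed

text \<open>Diagonal along an orthonormal sequence and zero on its complement; this realises any
  prescribed sequence of s-numbers.\<close>

definition diag_op :: "(nat \<Rightarrow> 'a) \<Rightarrow> (nat \<Rightarrow> real) \<Rightarrow> 'a \<Rightarrow> 'a::complex_hilbert" where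
  "diag_op e \<xi> = schmidt e (\<lambda>n. \<xi> n *\<^sub>R e n)"

lemma diag_op:
  assumes e: "orthonormal_seq e" and \<xi>: "\<xi> \<in> c0_star"
  shows "diag_op e \<xi> \<in> compact_ops" "s_numbers (diag_op e \<xi>) = \<xi>"
proof -
  have eq: "(\<lambda>n. norm (\<xi> n *\<^sub>R e n)) = \<xi>"
    using e c0_starD(1) [OF \<xi>] by (auto simp: orthonormal_seq_def)
  have o: "orth_seq (\<lambda>n. \<xi> n *\<^sub>R e n)"
    using e by (simp add: orthonormal_seq_def orth_seq_def cinner.scaleR_left cinner.scaleR_right)
  show "diag_op e \<xi> \<in> compact_ops" "s_numbers (diag_op e \<xi>) = \<xi>"
    unfolding diag_op_def using svd_schmidt(1,3) [OF e o, unfolded eq, OF \<xi>] by blast+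
qed

section \<open>Closure properties of bounded and compact operators\<close>

lemma bounded_ops_comp:
  assumes "A \<in> bounded_ops" "B \<in> bounded_ops"
  shows "A \<circ> B \<in> bounded_ops"
  using assms bounded_linear_compose [of A B] by (auto simp: bounded_ops_def comp_def)

lemma bounded_ops_add:
  assumes "A \<in> bounded_ops" "B \<in> bounded_ops"
  shows "(\<lambda>x. A x + B x) \<in> bounded_ops"
  using assms bounded_linear_add [of A B] by (auto simp: bounded_ops_def scaleC_add_right)

lemma closure_subset_compact:
  fixes S K :: "'a::complex_hilbert set"
  assumes "compact K" "S \<subseteq> K"
  shows "compact (closure S)"
  using assms closure_minimal [OF assms(2) compact_imp_closed] compact_Int_closed [of K "closure S"]
  by (simp add: Int_absorb1)

lemma compact_ops_comp_left:
  assumes X: "X \<in> compact_ops" and A: "A \<in> bounded_ops"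
  shows "A \<circ> X \<in> compact_ops"
proof -
  have "compact (A ` closure (X ` cball 0 1))"
    using X bounded_opsD(1) [OF A]
    by (intro compact_continuous_image linear_continuous_on) (auto simp: compact_ops_def)
  then have "compact (closure ((A \<circ> X) ` cball 0 1))"
    by (rule closure_subset_compact) (use closure_subset in force)
  then show ?thesis using bounded_ops_comp [OF A compact_ops_bounded [OF X]] by (simp add: compact_ops_def)
qed

lemma compact_ops_comp_right:
  assumes X: "X \<in> compact_ops" and A: "A \<in> bounded_ops"
  shows "X \<circ> A \<in> compact_ops"
proof -
  obtain K where K: "0 < K" "\<And>x. norm (A x) \<le> K * norm x" using bounded_opsE [OF A] by blast
  note Xb = compact_ops_bounded [OF X]
  interpret X: bounded_linear X by (rule bounded_opsD(1) [OF Xb])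
  have "compact ((\<lambda>y. K *\<^sub>R y) ` closure (X ` cball 0 1))"
    using X by (intro compact_scaling) (auto simp: compact_ops_def)
  moreover have "(X \<circ> A) ` cball 0 1 \<subseteq> (\<lambda>y. K *\<^sub>R y) ` closure (X ` cball 0 1)"
  proof
    fix z assume "z \<in> (X \<circ> A) ` cball 0 1"
    then obtain x where x: "norm x \<le> 1" "z = X (A x)" by auto
    define w where "w = (1 / K) *\<^sub>R A x"
    have "norm (A x) \<le> K" using K(2) [of x] x(1) K(1) mult_left_le [of "norm x" K] by linarith
    then have "norm w \<le> 1" using K(1) by (simp add: w_def divide_le_eq)
    then have "X w \<in> closure (X ` cball 0 1)" by (intro subsetD [OF closure_subset]) auto
    moreover have "z = K *\<^sub>R X w" using K(1) by (simp add: w_def x(2) X.scaleR)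
    ultimately show "z \<in> (\<lambda>y. K *\<^sub>R y) ` closure (X ` cball 0 1)" by blast
  qed
  ultimately have "compact (closure ((X \<circ> A) ` cball 0 1))" by (rule closure_subset_compact)
  then show ?thesis using bounded_ops_comp [OF Xb A] by (simp add: compact_ops_def)
qed

lemma compact_ops_add:
  assumes X: "X \<in> compact_ops" and Y: "Y \<in> compact_ops"
  shows "(\<lambda>x. X x + Y x) \<in> compact_ops"
proof -
  have "compact {x + y |x y. x \<in> closure (X ` cball 0 1) \<and> y \<in> closure (Y ` cball 0 1)}"
    using X Y by (intro compact_sums) (auto simp: compact_ops_def)
  moreover have "(\<lambda>x. X x + Y x) ` cball 0 1 \<subseteq>
      {x + y |x y. x \<in> closure (X ` cball 0 1) \<and> y \<in> closure (Y ` cball 0 1)}"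
  proof
    fix z assume "z \<in> (\<lambda>x. X x + Y x) ` cball 0 1"
    then obtain x where x: "x \<in> cball 0 1" "z = X x + Y x" by blast
    have "X x \<in> closure (X ` cball 0 1)" "Y x \<in> closure (Y ` cball 0 1)"
      using x(1) by (auto intro!: subsetD [OF closure_subset])
    with x(2) show "z \<in> {x + y |x y. x \<in> closure (X ` cball 0 1) \<and> y \<in> closure (Y ` cball 0 1)}" by blast
  qed
  ultimately have "compact (closure ((\<lambda>x. X x + Y x) ` cball 0 1))" by (rule closure_subset_compact)
  then show ?thesis
    using bounded_ops_add [OF compact_ops_bounded [OF X] compact_ops_bounded [OF Y]] by (simp add: compact_ops_def)
qed

lemma id_bounded_op: "(\<lambda>x. x) \<in> bounded_ops"
  by (simp add: bounded_ops_def)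

text \<open>The explicit form of a principal ideal; \<open>principal_ideal_eq\<close> identifies the
  two.\<close>

definition dominated_ops :: "(nat \<Rightarrow> real) \<Rightarrow> ('a::complex_hilbert \<Rightarrow> 'a) set" where
  "dominated_ops \<xi> = {Z \<in> compact_ops. dominated (s_numbers Z) \<xi>}"

section \<open>Ideals described by s-numbers\<close>

context
  assumes inf: "infinite_dim_hilbert TYPE('a::complex_hilbert)"
begin

lemma s_numbers_comp_left:
  fixes X A :: "'a \<Rightarrow> 'a"
  assumes X: "X \<in> compact_ops" and A: "A \<in> bounded_ops"
  shows "dominated (s_numbers (A \<circ> X)) (s_numbers X)"
proof -
  note AX = compact_ops_comp_left [OF X A]
  obtain K where K: "0 < K" "\<And>x. norm (A x) \<le> K * norm x" using bounded_opsE [OF A] by blast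
  obtain e where e: "svd X e" using svd_exists [OF inf X] .
  obtain e' where e': "svd (A \<circ> X) e'" using svd_exists [OF inf AX] .
  show ?thesis
  proof (rule dominatedI [where m = 1 and C = K])
    fix n
    have "s_numbers (A \<circ> X) n \<le> K * s_numbers X n"
    proof (rule svd_lower [OF e' id_bounded_op, where v = e])
      fix x assume "\<And>i. i < n \<Longrightarrow> cinner x (e i) = 0"
      then have "norm (X x) \<le> s_numbers X n * norm x" by (rule svd_upper [OF e])
      then have "K * norm (X x) \<le> K * (s_numbers X n * norm x)" using K(1) by simp
      with K(2) [of "X x"] show "norm ((A \<circ> X) x) \<le> K * s_numbers X n * norm x"
        by (simp add: mult.assoc)
    qed
    then show "s_numbers (A \<circ> X) (1 * n) \<le> K * s_numbers X n" by simp
  qed (use c0_starD [OF s_numbers_c0_star [OF inf AX]] c0_starD [OF s_numbers_c0_star [OF inf X]] in auto)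
qed

lemma s_numbers_comp_right:
  fixes X A :: "'a \<Rightarrow> 'a"
  assumes X: "X \<in> compact_ops" and A: "A \<in> bounded_ops"
  shows "dominated (s_numbers (X \<circ> A)) (s_numbers X)"
proof -
  note XA = compact_ops_comp_right [OF X A]
  obtain K where K: "0 < K" "\<And>x. norm (A x) \<le> K * norm x" using bounded_opsE [OF A] by blast
  obtain e where e: "svd X e" using svd_exists [OF inf X] .
  obtain e' where e': "svd (X \<circ> A) e'" using svd_exists [OF inf XA] .
  note sX = c0_starD [OF s_numbers_c0_star [OF inf X]]
  show ?thesis
  proof (rule dominatedI [where m = 1 and C = K])
    fix n
    have "s_numbers (X \<circ> A) n \<le> K * s_numbers X n"
    proof (rule svd_lower [OF e' A, where v = e])
      fix x assume "\<And>i. i < n \<Longrightarrow> cinner (A x) (e i) = 0"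
      then have "norm (X (A x)) \<le> s_numbers X n * norm (A x)" by (rule svd_upper [OF e])
      also have "\<dots> \<le> s_numbers X n * (K * norm x)" by (intro mult_left_mono K sX)
      finally show "norm ((X \<circ> A) x) \<le> K * s_numbers X n * norm x"
        by (simp add: mult_ac)
    qed
    then show "s_numbers (X \<circ> A) (1 * n) \<le> K * s_numbers X n" by simp
  qed (use c0_starD [OF s_numbers_c0_star [OF inf XA]] sX in auto)
qed

text \<open>Orthogonality to the first n right singular vectors of both operators amounts to 2 * n
  conditions, under which both upper bounds hold. The doubled index is absorbed by the dilation in
  \<open>dominated\<close>.\<close>

lemma s_numbers_add:
  fixes X Y :: "'a \<Rightarrow> 'a"
  assumes X: "X \<in> compact_ops" and Y: "Y \<in> compact_ops"
  shows "dominated (s_numbers (\<lambda>x. X x + Y x)) (\<lambda>n. s_numbers X n + s_numbers Y n)"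
proof -
  note XY = compact_ops_add [OF X Y]
  obtain e where e: "svd X e" using svd_exists [OF inf X] .
  obtain f where f: "svd Y f" using svd_exists [OF inf Y] .
  obtain h where h: "svd (\<lambda>x. X x + Y x) h" using svd_exists [OF inf XY] .
  show ?thesis
  proof (rule dominatedI [where m = 2 and C = 1])
    fix n
    define v where "v i = (if i < n then e i else f (i - n))" for i
    have "s_numbers (\<lambda>x. X x + Y x) (2 * n) \<le> s_numbers X n + s_numbers Y n"
    proof (rule svd_lower [OF h id_bounded_op, where v = v])
      fix x assume x: "\<And>i. i < 2 * n \<Longrightarrow> cinner x (v i) = 0"
      have "norm (X x) \<le> s_numbers X n * norm x"
      proof (rule svd_upper [OF e])
        show "cinner x (e i) = 0" if "i < n" for i using x [of i] that by (simp add: v_def)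
      qed
      moreover have "norm (Y x) \<le> s_numbers Y n * norm x"
      proof (rule svd_upper [OF f])
        show "cinner x (f i) = 0" if "i < n" for i using x [of "i + n"] that by (simp add: v_def)
      qed
      ultimately show "norm (X x + Y x) \<le> (s_numbers X n + s_numbers Y n) * norm x"
        using norm_triangle_ineq [of "X x" "Y x"] by (simp add: distrib_right)
    qed
    then show "s_numbers (\<lambda>x. X x + Y x) (2 * n) \<le> 1 * (s_numbers X n + s_numbers Y n)" by simp
  qed (use c0_starD [OF s_numbers_c0_star [OF inf XY]] c0_starD(1) [OF s_numbers_c0_star [OF inf X]]
        c0_starD(1) [OF s_numbers_c0_star [OF inf Y]] in \<open>auto intro: add_nonneg_nonneg\<close>)
qed

lemma s_numbers_zero: "s_numbers (\<lambda>x :: 'a. 0) = (\<lambda>n. 0)"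
proof -
  obtain e :: "nat \<Rightarrow> 'a" where e: "svd (\<lambda>x. 0) e" using svd_exists [OF inf zero_compact_op] .
  show ?thesis by (simp add: s_numbers_svd [OF e])
qed

lemma op_ideal_dominated_ops:
  assumes \<xi>: "\<And>n. 0 \<le> \<xi> n"
  shows "op_ideal (dominated_ops \<xi> :: ('a \<Rightarrow> 'a) set)"
  unfolding op_ideal_def
proof (intro conjI ballI)
  show "dominated_ops \<xi> \<subseteq> (compact_ops :: ('a \<Rightarrow> 'a) set)" by (auto simp: dominated_ops_def)
  show "(\<lambda>x :: 'a. 0) \<in> dominated_ops \<xi>"
    using \<xi> by (auto simp: dominated_ops_def zero_compact_op s_numbers_zero intro!: dominated_le)
next
  fix X Y :: "'a \<Rightarrow> 'a" assume "X \<in> dominated_ops \<xi>" "Y \<in> dominated_ops \<xi>"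
  then have X: "X \<in> compact_ops" "dominated (s_numbers X) \<xi>"
    and Y: "Y \<in> compact_ops" "dominated (s_numbers Y) \<xi>" by (auto simp: dominated_ops_def)
  have "dominated (\<lambda>n. s_numbers X n + s_numbers Y n) \<xi>"
    by (rule dominated_add [OF X(2) Y(2)])
      (use c0_starD(2) [OF s_numbers_c0_star [OF inf X(1)]] c0_starD(2) [OF s_numbers_c0_star [OF inf Y(1)]] in auto)
  with s_numbers_add [OF X(1) Y(1)] show "(\<lambda>x. X x + Y x) \<in> dominated_ops \<xi>"
    by (auto simp: dominated_ops_def compact_ops_add [OF X(1) Y(1)] intro: dominated_trans)
next
  fix X A :: "'a \<Rightarrow> 'a" assume "X \<in> dominated_ops \<xi>" and A: "A \<in> bounded_ops"
  then have X: "X \<in> compact_ops" "dominated (s_numbers X) \<xi>" by (auto simp: dominated_ops_def)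
  show "A \<circ> X \<in> dominated_ops \<xi>"
    using dominated_trans [OF s_numbers_comp_left [OF X(1) A] X(2)] compact_ops_comp_left [OF X(1) A]
    by (simp add: dominated_ops_def)
  show "X \<circ> A \<in> dominated_ops \<xi>"
    using dominated_trans [OF s_numbers_comp_right [OF X(1) A] X(2)] compact_ops_comp_right [OF X(1) A]
    by (simp add: dominated_ops_def)
qed

lemma op_ideal_sum:
  assumes "op_ideal I" "\<And>i. i < m \<Longrightarrow> F i \<in> I"
  shows "(\<lambda>x. \<Sum>i<(m::nat). F i x) \<in> I"
  using assms(2)
proof (induction m)
  case 0
  then show ?case using assms(1) by (simp add: op_ideal_def)
next
  case (Suc m)
  then have "(\<lambda>x. \<Sum>i<m. F i x) \<in> I" "F m \<in> I" by auto
  then show ?case using assms(1) by (auto simp: op_ideal_def)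
qed

text \<open>The operator \<open>Z\<close> is the sum over the residues \<open>i\<close> modulo \<open>m\<close> of \<open>A\<^sub>i \<circ> X \<circ> B\<^sub>i\<close>, where \<open>B\<^sub>i\<close>
  maps the right singular vector \<open>f (k * m + i)\<close> of \<open>Z\<close> to the \<open>k\<close>-th one of \<open>X\<close>.\<close>

lemma op_ideal_dominated:
  fixes X Z :: "'a \<Rightarrow> 'a"
  assumes I: "op_ideal I" and X: "X \<in> I" and Z: "Z \<in> compact_ops"
    and dom: "dominated (s_numbers Z) (s_numbers X)"
  shows "Z \<in> I"
proof -
  have Xc: "X \<in> compact_ops" using I X by (auto simp: op_ideal_def)
  note Xb = compact_ops_bounded [OF Xc]
  obtain e where e: "svd X e" using svd_exists [OF inf Xc] .
  obtain f where f: "svd Z f" using svd_exists [OF inf Z] .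
  note E = svdD [OF e] and F = svdD [OF f]
  obtain m where m: "0 < m" "\<And>n. norm (Z (f (m * n))) \<le> real m * norm (X (e n))"
    using dom by (auto simp: dominated_def s_numbers_svd [OF e] s_numbers_svd [OF f])
  have bound: "norm (Z (f (k * m + i))) \<le> real m * norm (X (e k))" for k i
    using F(7) [of "k * m" "k * m + i"] m(2) [of k] by (simp add: mult.commute)
  have inj: "inj (\<lambda>k. k * m + i)" for i using m(1) by (auto simp: inj_def)
  \<comment> \<open>Where \<open>X (e k)\<close> is zero, division by zero makes \<open>u k\<close>
    and \<open>g i k\<close> zero, and \<open>bound\<close> forces the matching values of Z to
    vanish too, so \<open>AX\<close> still holds. Elsewhere \<open>bound\<close> keeps
    \<open>g i\<close> bounded by m.\<close>
  define u where "u k = (1 / norm (X (e k))) *\<^sub>R X (e k)" for k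
  define g where "g i k = (1 / norm (X (e k))) *\<^sub>R Z (f (k * m + i))" for i k
  have bu: "bdd_orth u"
  proof (rule bdd_orthI [where B = 1])
    show "orth_seq u" using E(2) by (simp add: orth_seq_def u_def cinner.scaleR_left cinner.scaleR_right)
  qed (simp add: u_def)
  have bg: "bdd_orth (g i)" for i
  proof (rule bdd_orthI [where B = "real m"])
    show "orth_seq (g i)"
      using orth_seq_subseq [OF F(2) inj, of i]
      by (simp add: orth_seq_def g_def cinner.scaleR_left cinner.scaleR_right)
    show "norm (g i k) \<le> real m" for k
      using bound [of k i] by (cases "norm (X (e k)) = 0") (simp_all add: g_def divide_le_eq)
  qed
  have bf: "bdd_orth (\<lambda>k. f (k * m + i))" for i
    using F(1) orth_seq_subseq [OF _ inj, of f i]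
    by (intro bdd_orthI [where B = 1]) (auto simp: orthonormal_seq_def)
  define A where "A i = schmidt u (g i)" for i
  define B where "B i = schmidt (\<lambda>k. f (k * m + i)) e" for i
  have Ab: "A i \<in> bounded_ops" for i unfolding A_def by (rule schmidt_bounded_ops [OF bu bg])
  have Bb: "B i \<in> bounded_ops" for i unfolding B_def by (rule schmidt_bounded_ops [OF bf E(5)])
  have AX: "A i (X (e k)) = Z (f (k * m + i))" for i k
  proof -
    have "A i (X (e k)) = cinner (X (e k)) (u k) *\<^sub>C g i k"
      unfolding A_def using E(2)
      by (intro schmidt_single) (auto simp: orth_seq_def u_def cinner.scaleR_right)
    also have "\<dots> = Z (f (k * m + i))"
    proof (cases "X (e k) = 0")
      case True
      then show ?thesis using bound [of k i] by (simp add: cinner.zero_left scaleC.zero_left)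
    next
      case False
      have "cinner (X (e k)) (u k) = complex_of_real (norm (X (e k)))"
        using False by (simp add: u_def cinner.scaleR_right cinner_self scaleR_conv_of_real power2_eq_square)
      then have "cinner (X (e k)) (u k) *\<^sub>C g i k = norm (X (e k)) *\<^sub>R g i k"
        by (simp only: scaleR_scaleC)
      then show ?thesis using False by (simp add: g_def)
    qed
    finally show ?thesis .
  qed
  have sums: "(\<lambda>k. cinner x (f (k * m + i)) *\<^sub>C Z (f (k * m + i))) sums A i (X (B i x))" for i x
  proof -
    have "(\<lambda>k. cinner x (f (k * m + i)) *\<^sub>C e k) sums B i x"
      unfolding B_def by (rule schmidt_sums [OF bf E(5)])
    from bounded_linear.sums [OF bounded_linear_compose [OF bounded_opsD(1) [OF Ab] bounded_opsD(1) [OF Xb]] this]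
    show ?thesis by (simp add: bounded_opsD(2) [OF Xb] bounded_opsD(2) [OF Ab] AX)
  qed
  have "Z x = (\<Sum>i<m. A i (X (B i x)))" for x
  proof -
    have "(\<lambda>n. cinner x (f n) *\<^sub>C Z (f n)) sums Z x"
      using schmidt_sums [OF F(5,6), of x] F(4) by simp
    from sums_group [OF this m(1)]
    have "(\<lambda>k. \<Sum>n = k * m..<k * m + m. cinner x (f n) *\<^sub>C Z (f n)) sums Z x" .
    moreover have "(\<Sum>n = k * m..<k * m + m. cinner x (f n) *\<^sub>C Z (f n)) =
        (\<Sum>i<m. cinner x (f (k * m + i)) *\<^sub>C Z (f (k * m + i)))" for k
      using sum.shift_bounds_nat_ivl [of "\<lambda>n. cinner x (f n) *\<^sub>C Z (f n)" 0 "k * m" m]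
      by (simp add: add.commute lessThan_atLeast0)
    ultimately have "(\<lambda>k. \<Sum>i<m. cinner x (f (k * m + i)) *\<^sub>C Z (f (k * m + i))) sums Z x" by simp
    moreover have "(\<lambda>k. \<Sum>i<m. cinner x (f (k * m + i)) *\<^sub>C Z (f (k * m + i))) sums (\<Sum>i<m. A i (X (B i x)))"
      by (intro sums_sum sums)
    ultimately show ?thesis by (rule sums_unique2)
  qed
  then have "Z = (\<lambda>x. \<Sum>i<m. (A i \<circ> (X \<circ> B i)) x)" by (simp add: fun_eq_iff)
  also have "\<dots> \<in> I"
  proof (rule op_ideal_sum [OF I])
    fix i
    have "A i \<circ> (X \<circ> B i) \<in> I" using I X Ab Bb unfolding op_ideal_def by blast
    then show "(\<lambda>x. (A i \<circ> (X \<circ> B i)) x) \<in> I" by (simp add: comp_def)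
  qed
  finally show ?thesis .
qed

lemma principal_ideal_eq:
  fixes X :: "'a \<Rightarrow> 'a"
  assumes X: "X \<in> compact_ops"
  shows "principal_ideal X = dominated_ops (s_numbers X)"
proof
  show "principal_ideal X \<subseteq> dominated_ops (s_numbers X)"
    unfolding principal_ideal_def
    using op_ideal_dominated_ops [of "s_numbers X"] c0_starD(1) [OF s_numbers_c0_star [OF inf X]] X
    by (intro Inter_lower) (simp add: dominated_ops_def)
  show "dominated_ops (s_numbers X) \<subseteq> principal_ideal X"
    unfolding principal_ideal_def using op_ideal_dominated by (auto simp: dominated_ops_def)
qed

lemma char_set_dominated_ops:
  "char_set (dominated_ops \<xi> :: ('a \<Rightarrow> 'a) set) = {\<eta> \<in> c0_star. dominated \<eta> \<xi>}"
proof -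
  obtain e :: "nat \<Rightarrow> 'a" where e: "orthonormal_seq e" using orthonormal_exists [OF inf] .
  show ?thesis
  proof
    show "char_set (dominated_ops \<xi> :: ('a \<Rightarrow> 'a) set) \<subseteq> {\<eta> \<in> c0_star. dominated \<eta> \<xi>}"
      using s_numbers_c0_star [OF inf] by (auto simp: char_set_def dominated_ops_def)
    show "{\<eta> \<in> c0_star. dominated \<eta> \<xi>} \<subseteq> char_set (dominated_ops \<xi> :: ('a \<Rightarrow> 'a) set)"
    proof
      fix \<eta> assume "\<eta> \<in> {\<eta> \<in> c0_star. dominated \<eta> \<xi>}"
      then have "\<eta> = s_numbers (diag_op e \<eta>)" "diag_op e \<eta> \<in> dominated_ops \<xi>"
        using diag_op [OF e, of \<eta>] by (auto simp: dominated_ops_def)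
      then show "\<eta> \<in> char_set (dominated_ops \<xi> :: ('a \<Rightarrow> 'a) set)" unfolding char_set_def by blast
    qed
  qed
qed

lemma dominated_ops_subset_iff:
  assumes "\<xi> \<in> c0_star"
  shows "(dominated_ops \<xi> :: ('a \<Rightarrow> 'a) set) \<subseteq> dominated_ops \<eta> \<longleftrightarrow> dominated \<xi> \<eta>"
proof
  assume sub: "(dominated_ops \<xi> :: ('a \<Rightarrow> 'a) set) \<subseteq> dominated_ops \<eta>"
  have "char_set (dominated_ops \<xi> :: ('a \<Rightarrow> 'a) set) \<subseteq> char_set (dominated_ops \<eta> :: ('a \<Rightarrow> 'a) set)"
    unfolding char_set_def by (rule image_mono [OF sub])
  with assms show "dominated \<xi> \<eta>" by (auto simp: char_set_dominated_ops)
next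
  assume "dominated \<xi> \<eta>"
  then show "(dominated_ops \<xi> :: ('a \<Rightarrow> 'a) set) \<subseteq> dominated_ops \<eta>" by (auto simp: dominated_ops_def intro: dominated_trans)
qed

text \<open>With X an ideal contains every compact operator having the same s-numbers, by mutual
  domination. Hence ideals with equal characteristic sets coincide, as
  \<open>ideal_of_char_set\<close> requires.\<close>

lemma op_ideal_eq_char_set:
  assumes "op_ideal (I :: ('a \<Rightarrow> 'a) set)"
  shows "I = {Z :: 'a \<Rightarrow> 'a. Z \<in> compact_ops \<and> s_numbers Z \<in> char_set I}"
proof (intro set_eqI iffI)
  fix Z :: "'a \<Rightarrow> 'a" assume "Z \<in> I"
  then show "Z \<in> {Z. Z \<in> compact_ops \<and> s_numbers Z \<in> char_set I}"
    using assms by (auto simp: op_ideal_def char_set_def)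
next
  fix Z :: "'a \<Rightarrow> 'a" assume "Z \<in> {Z. Z \<in> compact_ops \<and> s_numbers Z \<in> char_set I}"
  then obtain X where "X \<in> I" "s_numbers Z = s_numbers X" "Z \<in> compact_ops" by (auto simp: char_set_def)
  then show "Z \<in> I" using op_ideal_dominated [OF assms, of X Z] by simp
qed

lemma ideal_of_char_set_eq:
  assumes "op_ideal (I :: ('a \<Rightarrow> 'a) set)"
  shows "ideal_of_char_set (char_set I) = I"
  unfolding ideal_of_char_set_def
proof (rule the_equality)
  show "op_ideal I \<and> char_set I = char_set I" using assms by simp
  fix J :: "('a \<Rightarrow> 'a) set" assume "op_ideal J \<and> char_set J = char_set I"
  then show "J = I" using op_ideal_eq_char_set [of J] op_ideal_eq_char_set [OF assms] by simp
qed

text \<open>The set of sequences defining \<open>pre_am_inf\<close> has to be shown to be a characteristic set,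
  since \<open>ideal_of_char_set\<close> is unspecified otherwise. For the zero ideal it is not one.\<close>

lemma char_set_pre_am_inf:
  assumes \<xi>: "\<xi> \<in> c0_star" "\<xi> 0 > 0"
  obtains I :: "('a \<Rightarrow> 'a) set"
  where "op_ideal I" "char_set I = {\<eta> \<in> l1_star. am_inf \<eta> \<in> char_set (dominated_ops \<xi> :: ('a \<Rightarrow> 'a) set)}"
proof -
  \<comment> \<open>In this form the set is visibly closed under domination and sums;
    \<open>\<xi> 0 > 0\<close> makes it agree with the description by \<open>am_inf\<close>.\<close>
  define S where "S = {\<eta> \<in> c0_star. summable \<eta> \<and> dominated (tail_mean \<eta>) \<xi>}"
  have S_eq: "{\<eta> \<in> l1_star. am_inf \<eta> \<in> char_set (dominated_ops \<xi> :: ('a \<Rightarrow> 'a) set)} = S"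
    using dominated_am_inf_iff [OF _ _ \<xi>] am_inf_c0_star
    by (auto simp: S_def l1_star_def char_set_dominated_ops)
  have hered: "\<eta> \<in> S" if "\<zeta> \<in> S" "\<eta> \<in> c0_star" "dominated \<eta> \<zeta>" for \<eta> \<zeta>
    using that tail_mean_mono [OF that(3,2)] by (auto simp: S_def intro: dominated_trans)
  have S_add: "(\<lambda>n. \<eta> n + \<zeta> n) \<in> S" if "\<eta> \<in> S" "\<zeta> \<in> S" for \<eta> \<zeta>
  proof -
    have c: "\<eta> \<in> c0_star" "\<zeta> \<in> c0_star" "summable \<eta>" "summable \<zeta>"
      "dominated (tail_mean \<eta>) \<xi>" "dominated (tail_mean \<zeta>) \<xi>" using that by (auto simp: S_def)
    have "(\<lambda>n. \<eta> n + \<zeta> n) \<longlonglongrightarrow> 0 + 0" by (intro tendsto_add c0_starD c)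
    moreover have "decseq (\<lambda>n. \<eta> n + \<zeta> n)"
      unfolding decseq_def by (intro allI impI add_mono decseqD [OF c0_starD(2)] c)
    ultimately have "(\<lambda>n. \<eta> n + \<zeta> n) \<in> c0_star"
      using c0_starD(1) c by (auto simp: c0_star_def intro: add_nonneg_nonneg)
    moreover have "dominated (tail_mean (\<lambda>n. \<eta> n + \<zeta> n)) \<xi>"
      unfolding tail_mean_add [OF c(3,4)]
      by (intro dominated_add c c0_starD(2) tail_mean_c0_star)
    ultimately show ?thesis using c by (simp add: S_def summable_add)
  qed
  define I :: "('a \<Rightarrow> 'a) set" where "I = {Z. Z \<in> compact_ops \<and> s_numbers Z \<in> S}"
  note sc = s_numbers_c0_star [OF inf]
  have "op_ideal I" unfolding op_ideal_def
  proof (intro conjI ballI)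
    show "I \<subseteq> compact_ops" by (auto simp: I_def)
    have "(\<lambda>n. 0) \<in> S"
      using c0_starD(1) [OF \<xi>(1)] by (auto simp: S_def c0_star_def tail_mean_def [abs_def] decseq_def intro!: dominated_le)
    then show "(\<lambda>x :: 'a. 0 :: 'a) \<in> I" by (simp add: I_def zero_compact_op s_numbers_zero)
  next
    fix X Y :: "'a \<Rightarrow> 'a" assume "X \<in> I" "Y \<in> I"
    then have X: "X \<in> compact_ops" "s_numbers X \<in> S" and Y: "Y \<in> compact_ops" "s_numbers Y \<in> S"
      by (auto simp: I_def)
    show "(\<lambda>x. X x + Y x) \<in> I"
      unfolding I_def
      using hered [OF S_add [OF X(2) Y(2)] sc [OF compact_ops_add [OF X(1) Y(1)]] s_numbers_add [OF X(1) Y(1)]]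
        compact_ops_add [OF X(1) Y(1)] by blast
  next
    fix X A :: "'a \<Rightarrow> 'a" assume "X \<in> I" and A: "A \<in> bounded_ops"
    then have X: "X \<in> compact_ops" "s_numbers X \<in> S" by (auto simp: I_def)
    show "A \<circ> X \<in> I"
      unfolding I_def
      using hered [OF X(2) sc [OF compact_ops_comp_left [OF X(1) A]] s_numbers_comp_left [OF X(1) A]]
        compact_ops_comp_left [OF X(1) A] by blast
    show "X \<circ> A \<in> I"
      unfolding I_def
      using hered [OF X(2) sc [OF compact_ops_comp_right [OF X(1) A]] s_numbers_comp_right [OF X(1) A]]
        compact_ops_comp_right [OF X(1) A] by blast
  qed
  moreover have "char_set I = S"
  proof -
    obtain e :: "nat \<Rightarrow> 'a" where e: "orthonormal_seq e" using orthonormal_exists [OF inf] .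
    have "\<eta> \<in> char_set I" if "\<eta> \<in> S" for \<eta>
    proof -
      have "\<eta> \<in> c0_star" using that by (simp add: S_def)
      from diag_op [OF e this] that show ?thesis unfolding char_set_def I_def by force
    qed
    then show ?thesis by (auto simp: char_set_def I_def)
  qed
  ultimately show thesis using S_eq that by simp
qed

text \<open>Stability says that the characteristic set equals \<open>S\<close>. Membership of \<xi>
  itself in \<open>S\<close> is regularity. Conversely, regularity puts everything dominated by
  \<xi> into \<open>S\<close> because tail means are monotone, and \<open>S\<close> consists of such
  sequences because each is dominated by its tail mean.\<close>

lemma am_inf_stable_iff:
  assumes \<xi>: "\<xi> \<in> c0_star" "\<xi> 0 > 0"
  shows "am_inf_stable (dominated_ops \<xi> :: ('a \<Rightarrow> 'a) set) \<longleftrightarrow> inf_regular \<xi>"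
proof -
  define S where "S = {\<eta> \<in> l1_star. am_inf \<eta> \<in> char_set (dominated_ops \<xi> :: ('a \<Rightarrow> 'a) set)}"
  have ideal: "op_ideal (dominated_ops \<xi> :: ('a \<Rightarrow> 'a) set)" using c0_starD(1) [OF \<xi>(1)] by (intro op_ideal_dominated_ops)
  obtain I :: "('a \<Rightarrow> 'a) set" where I: "op_ideal I" "char_set I = S"
    using char_set_pre_am_inf [OF \<xi>] unfolding S_def .
  have S_iff: "\<eta> \<in> S \<longleftrightarrow> \<eta> \<in> c0_star \<and> summable \<eta> \<and> dominated (tail_mean \<eta>) \<xi>" for \<eta>
    using dominated_am_inf_iff [OF _ _ \<xi>, of \<eta>] am_inf_c0_star [of \<eta>]
    by (auto simp: S_def l1_star_def char_set_dominated_ops)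
  have pre: "pre_am_inf (dominated_ops \<xi> :: ('a \<Rightarrow> 'a) set) = I"
    unfolding pre_am_inf_def S_def [symmetric] I(2) [symmetric] by (rule ideal_of_char_set_eq [OF I(1)])
  have "am_inf_stable (dominated_ops \<xi> :: ('a \<Rightarrow> 'a) set) \<longleftrightarrow> char_set (dominated_ops \<xi> :: ('a \<Rightarrow> 'a) set) = S"
    unfolding am_inf_stable_def pre I(2) [symmetric]
    using ideal ideal_of_char_set_eq [OF I(1)] ideal_of_char_set_eq [OF ideal] by metis
  also have "\<dots> \<longleftrightarrow> inf_regular \<xi>"
  proof
    assume "char_set (dominated_ops \<xi> :: ('a \<Rightarrow> 'a) set) = S"
    then have "\<xi> \<in> S" using \<xi> by (metis (lifting) char_set_dominated_ops dominated_refl mem_Collect_eq)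
    then show "inf_regular \<xi>" unfolding S_iff by (simp add: inf_regular_def)
  next
    assume reg: "inf_regular \<xi>"
    have "\<eta> \<in> c0_star \<and> dominated \<eta> \<xi> \<longleftrightarrow> \<eta> \<in> S" for \<eta>
    proof
      assume \<eta>: "\<eta> \<in> c0_star \<and> dominated \<eta> \<xi>"
      with reg tail_mean_mono [of \<eta> \<xi>] \<xi> show "\<eta> \<in> S"
        unfolding S_iff inf_regular_def by (auto intro: dominated_trans)
    next
      assume "\<eta> \<in> S"
      then show "\<eta> \<in> c0_star \<and> dominated \<eta> \<xi>"
        unfolding S_iff using dominated_tail_mean by (auto intro: dominated_trans)
    qed
    then show "char_set (dominated_ops \<xi> :: ('a \<Rightarrow> 'a) set) = S" by (auto simp: char_set_dominated_ops)
  qed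
  finally show ?thesis .
qed

text \<open>The 0-th s-number bounds the operator norm and dilations fix index 0, so the ideal is
  zero precisely when that number is.\<close>

lemma PL_iff:
  "I \<in> PL \<longleftrightarrow> (\<exists>\<xi>\<in>c0_star. \<xi> 0 > 0 \<and> I = (dominated_ops \<xi> :: ('a \<Rightarrow> 'a) set))"
proof
  assume "I \<in> PL"
  then obtain X where X: "X \<in> compact_ops" "I = principal_ideal X" and ne: "I \<noteq> {\<lambda>x. 0}" by (auto simp: PL_def)
  note s = s_numbers_c0_star [OF inf X(1)]
  have "s_numbers X 0 > 0"
  proof (rule ccontr)
    assume "\<not> s_numbers X 0 > 0"
    then have s0: "s_numbers X 0 \<le> 0" by simp
    have "Z = (\<lambda>x. 0)" if "Z \<in> I" for Z
    proof -
      have Z: "Z \<in> compact_ops" "dominated (s_numbers Z) (s_numbers X)"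
        using that X by (auto simp: principal_ideal_eq dominated_ops_def)
      obtain m where "0 < m" "\<And>n. s_numbers Z (m * n) \<le> real m * s_numbers X n"
        using Z(2) by (auto simp: dominated_def)
      from this(2) [of 0] s0 have "s_numbers Z 0 \<le> 0"
        using mult_nonneg_nonpos [of "real m" "s_numbers X 0"] by simp
      then have "norm (Z x) \<le> 0" for x
        by (intro order_trans [OF norm_le_s_numbers [OF inf Z(1)]] mult_nonpos_nonneg norm_ge_zero)
      then show ?thesis by auto
    qed
    moreover have "(\<lambda>x. 0) \<in> I"
      using op_ideal_dominated_ops [of "s_numbers X"] c0_starD(1) [OF s]
      by (simp add: X principal_ideal_eq op_ideal_def)
    ultimately show False using ne by blast
  qed
  with s X show "\<exists>\<xi>\<in>c0_star. \<xi> 0 > 0 \<and> I = dominated_ops \<xi>" using principal_ideal_eq by blast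
next
  assume "\<exists>\<xi>\<in>c0_star. \<xi> 0 > 0 \<and> I = dominated_ops \<xi>"
  then obtain \<xi> where \<xi>: "\<xi> \<in> c0_star" "\<xi> 0 > 0" "I = dominated_ops \<xi>" by blast
  obtain e :: "nat \<Rightarrow> 'a" where e: "orthonormal_seq e" using orthonormal_exists [OF inf] .
  note D = diag_op [OF e \<xi>(1)]
  have eq: "I = principal_ideal (diag_op e \<xi>)" by (simp add: \<xi>(3) principal_ideal_eq [OF D(1)] D(2))
  have "diag_op e \<xi> \<noteq> (\<lambda>x. 0)" using D(2) s_numbers_zero \<xi>(2) by auto
  moreover have "diag_op e \<xi> \<in> I" using D by (simp add: \<xi>(3) dominated_ops_def)
  ultimately have "I \<noteq> {\<lambda>x. 0}" by blast
  with eq D(1) show "I \<in> PL" by (auto simp: PL_def)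
qed

end

theorem theorem3p13:
  assumes "separable_hilbert TYPE('h::complex_hilbert)"
    and "infinite_dim_hilbert TYPE('h)"
  shows "(\<forall>I \<in> S_inf_PL. \<forall>J \<in> (PL :: ('h \<Rightarrow> 'h) set set). I \<subset> J \<longrightarrow>
            (\<exists>L \<in> S_inf_PL. I \<subset> L \<and> L \<subset> J)) \<and>
         (\<forall>I \<in> S_inf_PL. \<forall>J \<in> (PL :: ('h \<Rightarrow> 'h) set set). J \<subset> I \<longrightarrow>
            (\<exists>L \<in> S_inf_PL. J \<subset> L \<and> L \<subset> I))"
proof -
  note inf = assms(2)
  note sub = dominated_ops_subset_iff [OF inf]
  have S_iff: "I \<in> S_inf_PL \<longleftrightarrow> (\<exists>\<xi>\<in>c0_star. \<xi> 0 > 0 \<and> inf_regular \<xi> \<and> I = dominated_ops \<xi>)"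
    for I :: "('h \<Rightarrow> 'h) set"
    unfolding S_inf_PL_def using PL_iff [OF inf] am_inf_stable_iff [OF inf] by auto
  have psub: "dominated_ops \<xi> \<subset> (dominated_ops \<eta> :: ('h \<Rightarrow> 'h) set) \<longleftrightarrow> dominated \<xi> \<eta> \<and> \<not> dominated \<eta> \<xi>"
    if "\<xi> \<in> c0_star" "\<eta> \<in> c0_star" for \<xi> \<eta>
    using that by (simp add: less_le_not_le sub)
  \<comment> \<open>Positivity at 0 passes upwards along domination, so the intermediate ideal is
    nonzero together with the smaller one.\<close>
  have pos: "\<zeta> 0 > 0" if asm: "\<xi> 0 > 0" "dominated \<xi> \<zeta>" for \<xi> \<zeta> :: "nat \<Rightarrow> real"
  proof -
    obtain m where "0 < m" "\<xi> (m * 0) \<le> real m * \<zeta> 0" using asm(2) unfolding dominated_def by blast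
    then have "0 < real m * \<zeta> 0" using asm(1) by simp
    then show ?thesis by (rule zero_less_mult_pos) (use \<open>0 < m\<close> in simp)
  qed
  show ?thesis
  proof (intro conjI ballI impI)
    fix I J :: "('h \<Rightarrow> 'h) set" assume "I \<in> S_inf_PL" "J \<in> PL" "I \<subset> J"
    then obtain \<xi> \<eta> where \<xi>: "\<xi> \<in> c0_star" "\<xi> 0 > 0" "inf_regular \<xi>" "I = dominated_ops \<xi>"
      and J: "\<eta> \<in> c0_star" "J = dominated_ops \<eta>"
      unfolding S_iff PL_iff [OF inf] by blast
    have \<eta>: "\<eta> \<in> c0_star" "J = dominated_ops \<eta>" "dominated \<xi> \<eta>" "\<not> dominated \<eta> \<xi>"
      using J \<open>I \<subset> J\<close> psub [OF \<xi>(1) J(1)] by (simp_all add: \<xi>(4))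
    obtain \<zeta> where \<zeta>: "\<zeta> \<in> c0_star" "inf_regular \<zeta>" "dominated \<xi> \<zeta>" "\<not> dominated \<zeta> \<xi>"
        "dominated \<zeta> \<eta>" "\<not> dominated \<eta> \<zeta>"
      using inf_regular_upper_dense [OF \<xi>(1,3,2) \<eta>(1,3,4)] .
    show "\<exists>L \<in> S_inf_PL. I \<subset> L \<and> L \<subset> J"
    proof (intro bexI conjI)
      show "I \<subset> dominated_ops \<zeta>" "dominated_ops \<zeta> \<subset> J" using \<xi> \<eta> \<zeta> by (simp_all add: psub)
      show "(dominated_ops \<zeta> :: ('h \<Rightarrow> 'h) set) \<in> S_inf_PL" unfolding S_iff using \<zeta> pos [of \<xi> \<zeta>] \<xi>(2) by blast
    qed
  next
    fix I J :: "('h \<Rightarrow> 'h) set" assume "I \<in> S_inf_PL" "J \<in> PL" "J \<subset> I"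
    then obtain \<xi> \<eta> where \<xi>: "\<xi> \<in> c0_star" "\<xi> 0 > 0" "inf_regular \<xi>" "I = dominated_ops \<xi>"
      and J: "\<eta> \<in> c0_star" "\<eta> 0 > 0" "J = dominated_ops \<eta>"
      unfolding S_iff PL_iff [OF inf] by blast
    have \<eta>: "\<eta> \<in> c0_star" "\<eta> 0 > 0" "J = dominated_ops \<eta>" "dominated \<eta> \<xi>" "\<not> dominated \<xi> \<eta>"
      using J \<open>J \<subset> I\<close> psub [OF J(1) \<xi>(1)] by (simp_all add: \<xi>(4))
    obtain \<zeta> where \<zeta>: "\<zeta> \<in> c0_star" "inf_regular \<zeta>" "dominated \<eta> \<zeta>" "\<not> dominated \<zeta> \<eta>"
        "dominated \<zeta> \<xi>" "\<not> dominated \<xi> \<zeta>"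
      using inf_regular_lower_dense [OF \<xi>(1,3) \<eta>(1,2,4,5)] .
    show "\<exists>L \<in> S_inf_PL. J \<subset> L \<and> L \<subset> I"
    proof (intro bexI conjI)
      show "J \<subset> dominated_ops \<zeta>" "dominated_ops \<zeta> \<subset> I" using \<xi> \<eta> \<zeta> by (simp_all add: psub)
      show "(dominated_ops \<zeta> :: ('h \<Rightarrow> 'h) set) \<in> S_inf_PL" unfolding S_iff using \<zeta> pos [of \<eta> \<zeta>] \<eta>(2) by blast
    qed
  qed
qed

end
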